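(* Let $m\ge0$, and let $K_{\Omega\Lambda}(q,t)$ be the coefficients defined by $$J_\Lambda\left[\frac{X}{1-t};q,t\right]=\sum_\Omega K_{\Omega\Lambda}(q,t)\,s_\Omega(x;t),$$ with $K_{\Omega\Lambda}(q,1)$ their specialization at $t=1$. Then for all $m$-partitions $\Lambda$ and $\Omega$ and any permutation $\sigma\in S_m$, $$K_{\Omega\Lambda}(q,1)=K_{\sigma(\Omega)\sigma(\Lambda)}(q,1),$$ where $\sigma(\Lambda)=(a_{\sigma^{-1}(1)},\dots,a_{\sigma^{-1}(m)};\lambda)$ for $\Lambda=(\pmb a;\lambda)$.
   Context: **$m$-partitions.** $R_m\simeq\mathbb Q(q,t)[x_1,\dots,x_m]\otimes\mathbf\Lambda_m$ is the ring of $m$-symmetric functions, i.e. the formal power series (of bounded degree) in $x_1,x_2,\dots$ over $\mathbb Q(q,t)$ that are symmetric in $x_{m+1},x_{m+2},\dots$ ($\mathbf\Lambda_m$ is the ring of symmetric functions in $x_{m+1},x_{m+2},\dots$). An $m$-partition is a pair $\Lambda=(\pmb a;\lambda)$ with $\pmb a=(a_1,\dots,a_m)\in\mathbb Z_{\ge0}^m$ and $\lambda$ a partition; $|\pmb a|=\sum_i a_i$. $\Lambda$ (or $\pmb a$) is dominant if $a_1\ge\cdots\ge a_m$. $\pmb a\cup\lambda$ is the partition obtained by sorting all the entries of $\pmb a$ and $\lambda$. The diagram of $\Lambda$ (English notation) is the Young diagram of $\pmb a\cup\lambda$ with, for each $i=1,\dots,m$, an $i$-circle added at the right end of a row of size $a_i$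 (possibly $0$); among the rows of a given size the circles occupy the topmost ones, in increasing order from top to bottom. For $0\le i\le m$, $\Lambda^{(i)}=(a_1+1,\dots,a_i+1,a_{i+1},\dots,a_m)\cup\lambda$. Order: $\Lambda\ge\Omega$ iff $\Lambda^{(i)}\ge\Omega^{(i)}$ in the dominance order on partitions for all $i=0,\dots,m$. Monomials: $m_\Lambda(x)=x_1^{a_1}\cdots x_m^{a_m}\,m_\lambda(x_{m+1},x_{m+2},\dots)$. **Hecke algebra and power sums.** $T_i=t+\frac{tx_i-x_{i+1}}{x_i-x_{i+1}}(K_{i,i+1}-1)$ for $1\le i\le m-1$, where $K_{i,i+1}$ exchanges $x_i$ and $x_{i+1}$. $H_{\pmb a}(x;t)$ is defined by $H_{\pmb a}=x^{\pmb a}$ if $\pmb a$ is dominant, and $T_iH_{\pmb a}=H_{s_i\pmb a}$ if $a_i>a_{i+1}$ ($s_i$ swaps entries $i$ and $i+1$). $p_\Lambda(x;t)=H_{\pmb a}(x;t)\,p_\lambda(x)$, where $p_\lambda(x)$ is the power sum in all the variables $x_1,x_2,\dots$; these form a basis of $R_m$. $\mathrm{Inv}(\pmb a)=\#\{i<j: a_i<a_j\}$; $z_\lambda=\prod_i i^{n_\lambda(i)}n_\lambda(i)!$, with $n_\lambda(i)$ the multiplicity of $i$ in $\lambda$. **Macdonald polynomials.** Let $\langle\cdot,\cdot\rangle_{q,t}$ be the bilinear form on $R_m$ with $\langle p_\Lambda(x;t),p_\Omega(x;t)\rangle_{q,t}=\delta_{\Lambda\Omega}q^{|\pmb a|}t^{\mathrm{Inv}(\pmb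 a)}z_\lambda\prod_i\frac{1-q^{\lambda_i}}{1-t^{\lambda_i}}$. The $m$-symmetric Macdonald polynomials $\{P_\Lambda(x;q,t)\}$ are the unique basis of $R_m$ that is orthogonal for this form and satisfies $P_\Lambda=m_\Lambda+\sum_{\Omega<\Lambda}d_{\Lambda\Omega}(q,t)m_\Omega$. The integral form is $J_\Lambda(x;q,t)=c_\Lambda(q,t)P_\Lambda(x;q,t)$, $c_\Lambda(q,t)=\prod_{s\in\Lambda}(1-q^{a(s)}t^{\ell(s)+1})$, the product being over the square cells $s$ of the diagram, where $a(s)$ is the number of squares strictly to the right of $s$ in its row, plus $1$ if the row ends with a circle, and $\ell(s)$ is the number of squares strictly below $s$ in its column, plus, if the row of $s$ ends with a circle labelled $i$, the number of circles at the bottom of the column of $s$ with label smaller than $i$. $J_\Lambda[\frac{X}{1-t};q,t]$ is the image of $J_\Lambda(x;q,t)$ under the $\mathbb Q(q,t)$-linear map $p_\Lambda(x;t)\mapsto p_\Lambda(x;t)/\prod_i(1-t^{\lambda_i})$. **$m$-symmetric Schur functions.** Plethystic notation: $X=x_1+x_2+\cdots$, $h_r[X]=h_r(x)$, $h_r[X+x_1+\cdots+x_k]=h_r(x_1,\dots,x_k,x_1,x_2,\dots)$. If $\Lambda$ is dominant, $s^*_\Lambda(x;t)=\det(h_{\nu_i-i+j}[X_i])_{1\le i,j\le\ell(\nu)}$ with $\nu=\pmb a\cup\lambda$ and $X_i=X+x_1+\cdots+x_k$, $k$ being the number of circles weakly above row $i$ in the diagram of $\Lambda$ ($h_r=0$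 for $r<0$). If $a_i<a_{i+1}$, $s^*_\Lambda(x;t)=T_i\,s^*_{s_i\Lambda}(x;t)$, where $s_i\Lambda=(s_i\pmb a;\lambda)$. With the bilinear form $\langle p_\Lambda(x;t),p_\Omega(x;t)\rangle_m=\delta_{\Lambda\Omega}t^{\mathrm{Inv}(\pmb a)}z_\lambda$, the $m$-symmetric Schur functions $s_\Lambda(x;t)$ are the unique basis of $R_m$ with $\langle s_\Lambda(x;t),s^*_\Omega(x;t)\rangle_m=\delta_{\Lambda\Omega}t^{\mathrm{Inv}(\pmb a)}$. The $K_{\Omega\Lambda}(q,1)$ are thus the coefficients in $\lim_{t\to1}J_\Lambda[\frac{X}{1-t};q,t]=\sum_\Omega K_{\Omega\Lambda}(q,1)s_\Omega(x;1)$. *)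

theory Defs
  imports
    "HOL-Library.Multiset"
    "HOL-Combinatorics.Permutations"
    "HOL-Computational_Algebra.Polynomial"
    "HOL-Computational_Algebra.Fraction_Field"
    "Jordan_Normal_Form.Determinant"
begin

text \<open>All indices are shifted by one: variables, entries of compositions, circle labels and rows
  of diagrams are numbered from 0, so that \<open>x\<^sub>i\<close> of the usual notation is variable \<open>i - 1\<close>.\<close>

section \<open>Formal power series in countably many variables\<close>

text \<open>A monomial is represented by the multiset of (the indices of) its variables: the exponent of
  variable \<open>i\<close> in \<open>M\<close> is \<open>count M i\<close>, the degree is \<open>size M\<close>, the product is the sum of multisets.\<close>

typedef 'a pseries = "UNIV :: (nat multiset \<Rightarrow> 'a) set"
  morphisms pcoeff Abs_pseries ..

setup_lifting type_definition_pseries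

lemma pseries_eqI: "(\<And>M. pcoeff f M = pcoeff g M) \<Longrightarrow> f = g"
  by transfer auto

lemma finite_submultisets: "finite {A. A \<subseteq># (M :: 'b multiset)}"
proof (induction M)
  case empty
  then show ?case by simp
next
  case (add x M)
  have "{A. A \<subseteq># add_mset x M} \<subseteq> {A. A \<subseteq># M} \<union> add_mset x ` {A. A \<subseteq># M}"
  proof
    fix A assume "A \<in> {A. A \<subseteq># add_mset x M}"
    then have A: "A \<subseteq># add_mset x M" by simp
    show "A \<in> {A. A \<subseteq># M} \<union> add_mset x ` {A. A \<subseteq># M}"
    proof (cases "x \<in># A")
      case True
      then obtain B where "A = add_mset x B" by (metis insert_DiffM)
      with A show ?thesis by auto
    next
      case False
      with A have "A \<subseteq># M"
        by (metis add_mset_remove_trivial diff_single_trivial subset_eq_diff_conv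
            add_mset_add_single)
      then show ?thesis by simp
    qed
  qed
  with add show ?case by (meson finite_UnI finite_imageI finite_subset)
qed

lemma finite_splittings: "finite {(A, B). A + B = (M :: 'b multiset)}"
proof (rule finite_subset)
  show "{(A, B). A + B = M} \<subseteq> {A. A \<subseteq># M} \<times> {A. A \<subseteq># M}" by auto
qed (simp add: finite_submultisets)

instantiation pseries :: (comm_ring_1) comm_ring_1
begin

lift_definition zero_pseries :: "'a pseries" is "\<lambda>M. 0" .
lift_definition one_pseries :: "'a pseries" is "\<lambda>M. if M = {#} then 1 else 0" .
lift_definition plus_pseries :: "'a pseries \<Rightarrow> 'a pseries \<Rightarrow> 'a pseries" is
  "\<lambda>f g M. f M + g M" .
lift_definition minus_pseries :: "'a pseries \<Rightarrow> 'a pseries \<Rightarrow> 'a pseries" is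
  "\<lambda>f g M. f M - g M" .
lift_definition uminus_pseries :: "'a pseries \<Rightarrow> 'a pseries" is "\<lambda>f M. - f M" .
lift_definition times_pseries :: "'a pseries \<Rightarrow> 'a pseries \<Rightarrow> 'a pseries" is
  "\<lambda>f g M. \<Sum>(A, B) | A + B = M. f A * g B" .

instance
proof
  fix f g h :: "'a pseries"
  show "f + g + h = f + (g + h)" by transfer (simp add: add.assoc)
  show "f + g = g + f" by transfer (simp add: add.commute)
  show "0 + f = f" by transfer simp
  show "- f + f = 0" by transfer simp
  show "f - g = f + - g" by transfer simp
  show "(0 :: 'a pseries) \<noteq> 1" by transfer (metis zero_neq_one)
  show "f * g = g * f"
  proof (transfer, rule ext)
    fix f g :: "nat multiset \<Rightarrow> 'a" and M
    show "(\<Sum>(A, B) | A + B = M. f A * g B) = (\<Sum>(A, B) | A + B = M. g A * f B)"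
      by (rule sum.reindex_bij_witness[of _ prod.swap prod.swap])
        (auto simp: add.commute mult.commute)
  qed
  show "1 * f = f"
  proof (transfer, rule ext)
    fix f :: "nat multiset \<Rightarrow> 'a" and M
    have "(\<Sum>(A, B) | A + B = M. (if A = {#} then 1 else 0) * f B)
        = (\<Sum>(A, B) \<in> {({#} :: nat multiset, M)}. (if A = {#} then 1 else 0) * f B)"
      by (rule sum.mono_neutral_right) (auto simp: finite_splittings split: if_splits)
    then show "(\<Sum>(A, B) | A + B = M. (if A = {#} then 1 else 0) * f B) = f M" by simp
  qed
  show "(f + g) * h = f * h + g * h"
    by transfer (auto simp: sum.distrib[symmetric] algebra_simps intro!: ext sum.cong)
  show "f * g * h = f * (g * h)"
  proof (transfer, rule ext)
    fix f g h :: "nat multiset \<Rightarrow> 'a" and M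
    have "(\<Sum>(A, B) | A + B = M. (\<Sum>(C, D) | C + D = A. f C * g D) * h B)
        = (\<Sum>((A, B), (C, D)) \<in> (SIGMA (A, B) : {(A, B). A + B = M}. {(C, D). C + D = A}).
            f C * g D * h B)"
      by (subst sum.Sigma[symmetric])
        (auto simp: finite_splittings[unfolded split_def] sum_distrib_right split_def intro!: sum.cong)
    also have "\<dots> = (\<Sum>((A, B), (C, D)) \<in> (SIGMA (A, B) : {(A, B). A + B = M}. {(C, D). C + D = B}).
            f A * (g C * h D))"
      by (rule sum.reindex_bij_witness
          [of _ "\<lambda>((A, B), (C, D)). ((A + C, D), (A, C))" "\<lambda>((A, B), (C, D)). ((C, D + B), (D, B))"])
        (auto simp: ac_simps)
    also have "\<dots> = (\<Sum>(A, B) | A + B = M. f A * (\<Sum>(C, D) | C + D = B. g C * h D))"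
      by (subst sum.Sigma[symmetric])
        (auto simp: finite_splittings[unfolded split_def] sum_distrib_left split_def intro!: sum.cong)
    finally show "(\<Sum>(A, B) | A + B = M. (\<Sum>(C, D) | C + D = A. f C * g D) * h B)
        = (\<Sum>(A, B) | A + B = M. f A * (\<Sum>(C, D) | C + D = B. g C * h D))" .
  qed
qed

end

lift_definition pscale :: "'a::comm_ring_1 \<Rightarrow> 'a pseries \<Rightarrow> 'a pseries" is "\<lambda>c f M. c * f M" .

global_interpretation ps: vector_space "pscale :: 'a::field \<Rightarrow> 'a pseries \<Rightarrow> 'a pseries"
  by unfold_locales (transfer; simp add: algebra_simps)+

lift_definition pvar :: "nat \<Rightarrow> 'a::comm_ring_1 pseries" is "\<lambda>i M. if M = {#i#} then 1 else 0" .

text \<open>The operator \<open>K\<^sub>i\<^sub>,\<^sub>i\<^sub>+\<^sub>1\<close> exchanging two consecutive variables.\<close>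

lift_definition swap_vars :: "nat \<Rightarrow> 'a pseries \<Rightarrow> 'a pseries" is
  "\<lambda>i f M. f (image_mset (transpose i (Suc i)) M)" .

text \<open>\<open>h\<^sub>r[X + x\<^sub>1 + \<dots> + x\<^sub>k]\<close>: every monomial of degree \<open>r\<close> in the alphabet
  \<open>x\<^sub>1, \<dots>, x\<^sub>k, x\<^sub>1, x\<^sub>2, \<dots>\<close> has coefficient 1, so the coefficient of \<open>M\<close> is the number of its
  factorizations into a monomial in the first copies and a monomial in the second ones.\<close>

lift_definition hcomplete :: "nat \<Rightarrow> int \<Rightarrow> 'a::comm_ring_1 pseries" is
  "\<lambda>k r M. if int (size M) = r
     then of_nat (card {(A, B). A + B = M \<and> set_mset A \<subseteq> {..<k}}) else 0" .

text \<open>The power sum \<open>p\<^sub>r\<close> in all the variables, for \<open>r > 0\<close>.\<close>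

lift_definition powersum :: "nat \<Rightarrow> 'a::comm_ring_1 pseries" is
  "\<lambda>r M. if \<exists>i. M = replicate_mset r i then 1 else 0" .

definition powersum_part :: "nat multiset \<Rightarrow> 'a::comm_ring_1 pseries" where
  "powersum_part l = (\<Prod>r\<in>#l. powersum r)"

text \<open>The monomial symmetric function \<open>m\<^sub>\<lambda>(x\<^sub>m\<^sub>+\<^sub>1, x\<^sub>m\<^sub>+\<^sub>2, \<dots>)\<close>.\<close>

lift_definition monomial_part :: "nat \<Rightarrow> nat multiset \<Rightarrow> 'a::comm_ring_1 pseries" is
  "\<lambda>m l M. if set_mset M \<subseteq> {m..} \<and> image_mset (count M) (mset_set (set_mset M)) = l
     then 1 else 0" .

definition xpow :: "nat list \<Rightarrow> 'a::comm_ring_1 pseries" where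
  "xpow a = (\<Prod>i<length a. pvar i ^ (a ! i))"


section \<open>The field of coefficients and the specialization at t = 1\<close>

text \<open>\<open>\<rat>(q,t)\<close> is realized as \<open>\<rat>(q)(t)\<close>: the inner polynomials are in \<open>q\<close>, the outer ones in \<open>t\<close>.\<close>

type_synonym Qq = "rat poly fract"
type_synonym Qqt = "Qq poly fract"

definition qv :: Qqt where "qv = Fract [:Fract [:0, 1:] 1:] 1"
definition tv :: Qqt where "tv = Fract [:0, 1:] 1"

definition regular_at_t1 :: "Qqt \<Rightarrow> bool" where
  "regular_at_t1 f \<longleftrightarrow> (\<exists>a b. f = Fract a b \<and> poly b 1 \<noteq> 0)"

definition at_t1 :: "Qqt \<Rightarrow> Qq" where
  "at_t1 f = (THE v. \<exists>a b. f = Fract a b \<and> poly b 1 \<noteq> 0 \<and> v = poly a 1 / poly b 1)"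


section \<open>The ring of m-symmetric functions\<close>

definition Rm :: "nat \<Rightarrow> Qqt pseries set" where
  "Rm m = {f. (\<exists>d. \<forall>M. pcoeff f M \<noteq> 0 \<longrightarrow> size M \<le> d) \<and>
     (\<forall>\<pi> M. \<pi> permutes {m..} \<longrightarrow> pcoeff f (image_mset \<pi> M) = pcoeff f M)}"


section \<open>m-partitions\<close>

text \<open>A partition is the multiset of its (positive) parts.\<close>

type_synonym mpart = "nat list \<times> nat multiset"

definition mparts :: "nat \<Rightarrow> mpart set" where
  "mparts m = {(a, l). length a = m \<and> 0 \<notin># l}"

definition permute_mpart :: "(nat \<Rightarrow> nat) \<Rightarrow> mpart \<Rightarrow> mpart" where
  "permute_mpart \<sigma> \<Lambda> = (map (\<lambda>i. fst \<Lambda> ! inv_into UNIV \<sigma> i) [0..<length (fst \<Lambda>)], snd \<Lambda>)"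

definition inversions :: "nat list \<Rightarrow> nat" where
  "inversions a = card {(i, j). i < j \<and> j < length a \<and> a ! i < a ! j}"

definition zee :: "nat multiset \<Rightarrow> nat" where
  "zee l = (\<Prod>i\<in>set_mset l. i ^ count l i * fact (count l i))"

text \<open>Dominance order; parts equal to 0 are irrelevant here.\<close>

definition dominated :: "nat multiset \<Rightarrow> nat multiset \<Rightarrow> bool" where
  "dominated l l' \<longleftrightarrow> sum_mset l = sum_mset l' \<and>
     (\<forall>k. sum_list (take k (rev (sorted_list_of_multiset l)))
        \<le> sum_list (take k (rev (sorted_list_of_multiset l'))))"

definition raise :: "nat \<Rightarrow> mpart \<Rightarrow> nat multiset" where
  "raise i \<Lambda> = mset (map Suc (take i (fst \<Lambda>))) + mset (drop i (fst \<Lambda>)) + snd \<Lambda>"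

definition mpart_le :: "nat \<Rightarrow> mpart \<Rightarrow> mpart \<Rightarrow> bool" where
  "mpart_le m \<Omega> \<Lambda> \<longleftrightarrow> (\<forall>i\<le>m. dominated (raise i \<Omega>) (raise i \<Lambda>))"

text \<open>The rows of the diagram from top to bottom, each given by its number of squares and the label
  of its circle, if any. As the sorting is stable, among the rows of equal size the circled ones
  come first, with increasing labels.\<close>

definition diagram :: "mpart \<Rightarrow> (nat \<times> nat option) list" where
  "diagram \<Lambda> = sort_key (\<lambda>(r, _). - int r)
     (zip (fst \<Lambda>) (map Some [0..<length (fst \<Lambda>)])
      @ map (\<lambda>r. (r, None)) (sorted_list_of_multiset (snd \<Lambda>)))"

text \<open>Arm and leg of the square in row \<open>r\<close> and column \<open>c\<close>. A circle at the bottom of column \<open>c\<close>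
  is one ending a row with exactly \<open>c\<close> squares.\<close>

definition arm :: "mpart \<Rightarrow> nat \<Rightarrow> nat \<Rightarrow> nat" where
  "arm \<Lambda> r c = (let D = diagram \<Lambda> in
     fst (D ! r) - Suc c + (if snd (D ! r) = None then 0 else 1))"

definition leg :: "mpart \<Rightarrow> nat \<Rightarrow> nat \<Rightarrow> nat" where
  "leg \<Lambda> r c = (let D = diagram \<Lambda> in
     card {r'. r < r' \<and> r' < length D \<and> c < fst (D ! r')} +
     (case snd (D ! r) of None \<Rightarrow> 0
      | Some i \<Rightarrow> card {r'. r' < length D \<and> fst (D ! r') = c \<and> (\<exists>j<i. snd (D ! r') = Some j)}))"

definition cnorm :: "mpart \<Rightarrow> Qqt" where
  "cnorm \<Lambda> = (let D = diagram \<Lambda> in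
     \<Prod>r<length D. \<Prod>c<fst (D ! r). 1 - qv ^ arm \<Lambda> r c * tv ^ (leg \<Lambda> r c + 1))"


section \<open>Hecke operators\<close>

definition divided_diff :: "nat \<Rightarrow> Qqt pseries \<Rightarrow> Qqt pseries" where
  "divided_diff i f = (THE g. (pvar i - pvar (Suc i)) * g = swap_vars i f - f)"

definition hecke_T :: "nat \<Rightarrow> Qqt pseries \<Rightarrow> Qqt pseries" where
  "hecke_T i f = pscale tv f + (pscale tv (pvar i) - pvar (Suc i)) * divided_diff i f"

definition ascent :: "nat list \<Rightarrow> nat \<Rightarrow> bool" where
  "ascent a i \<longleftrightarrow> Suc i < length a \<and> a ! i < a ! Suc i"

text \<open>The family that is given by \<open>f\<close> on dominant compositions and is extended by
  \<open>F a = T\<^sub>i (F (s\<^sub>i a))\<close> whenever \<open>a\<^sub>i < a\<^sub>i\<^sub>+\<^sub>1\<close>. By the braid relations of the \<open>T\<^sub>i\<close> the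
  result does not depend on the ascent that is used; we take the first one.\<close>

function hecke_extend :: "(nat list \<Rightarrow> Qqt pseries) \<Rightarrow> nat list \<Rightarrow> Qqt pseries" where
  "hecke_extend f a = (if \<exists>i. ascent a i
     then let i = (LEAST i. ascent a i)
          in hecke_T i (hecke_extend f (a[i := a ! Suc i, Suc i := a ! i]))
     else f a)"
  by auto

lemma weight_swap_less:
  assumes "ascent a i"
  shows "(\<Sum>j<length a. j * (a[i := a ! Suc i, Suc i := a ! i]) ! j) < (\<Sum>j<length a. j * a ! j)"
proof -
  let ?b = "a[i := a ! Suc i, Suc i := a ! i]"
  from assms have i: "Suc i < length a" and lt: "a ! i < a ! Suc i" by (auto simp: ascent_def)
  have split: "(\<Sum>j<length a. g j) = g i + g (Suc i) + (\<Sum>j\<in>{..<length a} - {i, Suc i}. g j)"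
    for g :: "nat \<Rightarrow> nat"
  proof -
    have "(\<Sum>j<length a. g j)
        = (\<Sum>j\<in>{i, Suc i}. g j) + (\<Sum>j\<in>{..<length a} - {i, Suc i}. g j)"
      using i by (subst sum.subset_diff[of "{i, Suc i}"]) auto
    then show ?thesis by simp
  qed
  have "(\<Sum>j\<in>{..<length a} - {i, Suc i}. j * ?b ! j)
      = (\<Sum>j\<in>{..<length a} - {i, Suc i}. j * a ! j)"
    by (rule sum.cong) auto
  then show ?thesis
    using i lt by (simp add: split[of "\<lambda>j. j * ?b ! j"] split[of "\<lambda>j. j * a ! j"])
qed

termination
proof (relation "measure (\<lambda>(f, a). \<Sum>j<length a. j * a ! j)", goal_cases)
  case (2 f a i)
  then have "ascent a i" using LeastI_ex[of "ascent a"] by simp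
  from weight_swap_less[OF this] show ?case by simp
qed simp

declare hecke_extend.simps [simp del]


section \<open>Bases of m-symmetric functions\<close>

definition is_basis_of_Rm :: "nat \<Rightarrow> (mpart \<Rightarrow> Qqt pseries) \<Rightarrow> bool" where
  "is_basis_of_Rm m B \<longleftrightarrow> inj_on B (mparts m) \<and> ps.independent (B ` mparts m) \<and>
     ps.span (B ` mparts m) = Rm m"

text \<open>The coefficient of \<open>B \<Lambda>\<close> in the expansion of \<open>f\<close> in the basis \<open>B\<close> of \<open>Rm m\<close>.\<close>

definition coord :: "nat \<Rightarrow> (mpart \<Rightarrow> Qqt pseries) \<Rightarrow> Qqt pseries \<Rightarrow> mpart \<Rightarrow> Qqt" where
  "coord m B f \<Lambda> = ps.representation (B ` mparts m) f (B \<Lambda>)"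

definition mmonomial :: "mpart \<Rightarrow> Qqt pseries" where
  "mmonomial \<Lambda> = xpow (fst \<Lambda>) * monomial_part (length (fst \<Lambda>)) (snd \<Lambda>)"

definition mpowersum :: "mpart \<Rightarrow> Qqt pseries" where
  "mpowersum \<Lambda> = hecke_extend xpow (fst \<Lambda>) * powersum_part (snd \<Lambda>)"

text \<open>The bilinear form on \<open>Rm m\<close> for which the power sums are orthogonal and \<open>mpowersum \<Lambda>\<close> has
  squared norm \<open>w \<Lambda>\<close>.\<close>

definition powersum_form ::
  "nat \<Rightarrow> (mpart \<Rightarrow> Qqt) \<Rightarrow> Qqt pseries \<Rightarrow> Qqt pseries \<Rightarrow> Qqt" where
  "powersum_form m w f g =
     (\<Sum>\<Lambda> | \<Lambda> \<in> mparts m \<and> coord m mpowersum f \<Lambda> \<noteq> 0.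
        coord m mpowersum f \<Lambda> * coord m mpowersum g \<Lambda> * w \<Lambda>)"

definition form_qt :: "nat \<Rightarrow> Qqt pseries \<Rightarrow> Qqt pseries \<Rightarrow> Qqt" where
  "form_qt m = powersum_form m (\<lambda>(a, l). qv ^ sum_list a * tv ^ inversions a * of_nat (zee l) *
     (\<Prod>r\<in>#l. (1 - qv ^ r) / (1 - tv ^ r)))"

definition form_m :: "nat \<Rightarrow> Qqt pseries \<Rightarrow> Qqt pseries \<Rightarrow> Qqt" where
  "form_m m = powersum_form m (\<lambda>(a, l). tv ^ inversions a * of_nat (zee l))"

text \<open>The linear map \<open>f \<mapsto> f[X/(1-t)]\<close>.\<close>

definition plethysm_1mt :: "nat \<Rightarrow> Qqt pseries \<Rightarrow> Qqt pseries" where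
  "plethysm_1mt m f =
     (\<Sum>\<Lambda> | \<Lambda> \<in> mparts m \<and> coord m mpowersum f \<Lambda> \<noteq> 0.
        pscale (coord m mpowersum f \<Lambda> / (\<Prod>r\<in>#snd \<Lambda>. 1 - tv ^ r)) (mpowersum \<Lambda>))"


section \<open>m-symmetric Macdonald polynomials\<close>

definition is_macdonald_basis :: "nat \<Rightarrow> (mpart \<Rightarrow> Qqt pseries) \<Rightarrow> bool" where
  "is_macdonald_basis m P \<longleftrightarrow>
     is_basis_of_Rm m P \<and>
     (\<forall>\<Lambda>\<in>mparts m. \<forall>\<Omega>\<in>mparts m. \<Lambda> \<noteq> \<Omega> \<longrightarrow> form_qt m (P \<Lambda>) (P \<Omega>) = 0) \<and>
     (\<forall>\<Lambda>\<in>mparts m. \<exists>d. P \<Lambda> = mmonomial \<Lambda> +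
        (\<Sum>\<Omega> | \<Omega> \<in> mparts m \<and> mpart_le m \<Omega> \<Lambda> \<and> \<Omega> \<noteq> \<Lambda>. pscale (d \<Omega>) (mmonomial \<Omega>)))"

definition integral_form :: "(mpart \<Rightarrow> Qqt pseries) \<Rightarrow> mpart \<Rightarrow> Qqt pseries" where
  "integral_form P \<Lambda> = pscale (cnorm \<Lambda>) (P \<Lambda>)"


section \<open>m-symmetric Schur functions\<close>

definition dual_schur_dominant :: "mpart \<Rightarrow> Qqt pseries" where
  "dual_schur_dominant \<Lambda> =
     (let D = diagram \<Lambda>;
          \<nu> = filter (\<lambda>r. r > 0) (map fst D);
          k = (\<lambda>i. length (filter (\<lambda>(_, c). c \<noteq> None) (take (Suc i) D)))
      in det (mat (length \<nu>) (length \<nu>)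
           (\<lambda>(i, j). hcomplete (k i) (int (\<nu> ! i) - int i + int j))))"

definition dual_schur :: "mpart \<Rightarrow> Qqt pseries" where
  "dual_schur \<Lambda> = hecke_extend (\<lambda>a. dual_schur_dominant (a, snd \<Lambda>)) (fst \<Lambda>)"

definition is_schur_basis :: "nat \<Rightarrow> (mpart \<Rightarrow> Qqt pseries) \<Rightarrow> bool" where
  "is_schur_basis m s \<longleftrightarrow>
     is_basis_of_Rm m s \<and>
     (\<forall>\<Lambda>\<in>mparts m. \<forall>\<Omega>\<in>mparts m.
        form_m m (s \<Lambda>) (dual_schur \<Omega>) = (if \<Lambda> = \<Omega> then tv ^ inversions (fst \<Lambda>) else 0))"

text \<open>\<open>K\<^sub>\<Omega>\<^sub>\<Lambda>(q,t)\<close>, where \<open>P\<close> is the Macdonald basis and \<open>s\<close> the Schur basis.\<close>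

definition kostka ::
  "nat \<Rightarrow> (mpart \<Rightarrow> Qqt pseries) \<Rightarrow> (mpart \<Rightarrow> Qqt pseries) \<Rightarrow> mpart \<Rightarrow> mpart \<Rightarrow> Qqt" where
  "kostka m P s \<Omega> \<Lambda> = coord m s (plethysm_1mt m (integral_form P \<Lambda>)) \<Omega>"

end

theory Submission
  imports Defs
begin

text \<open>At \<open>t = 1\<close> the Hecke operators become permutations of the variables, so \<open>p\<^sub>\<Lambda>(x;t)\<close> becomes
  \<open>x\<^sup>a p\<^sub>\<lambda>\<close>, and row operations turn the determinant defining \<open>s\<^sup>*\<^sub>\<Lambda>\<close> into one that visibly commutes
  with permutations of \<open>x\<^sub>1, \<dots>, x\<^sub>m\<close>. The norm of \<open>p\<^sub>\<Lambda>\<close> has a pole of order \<open>\<ell>(\<lambda>)\<close> at \<open>t = 1\<close>, and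
  \<open>m\<^sub>\<Lambda>\<close> is \<open>p\<^sub>\<Lambda>\<close>, up to a constant and terms vanishing at \<open>t = 1\<close>, plus a combination of power
  sums with fewer parts. Hence the Gram matrix of the monomials is diagonal to leading order. As
  \<open>\<Omega> < \<Lambda>\<close> forces \<open>\<ell>(\<mu>) \<ge> \<ell>(\<lambda>)\<close> for the partitions \<open>\<mu>\<close> of \<open>\<Omega>\<close> and \<open>\<lambda>\<close> of \<open>\<Lambda>\<close>, orthogonalization
  gives \<open>P\<^sub>\<Lambda> = m\<^sub>\<Lambda>\<close> at \<open>t = 1\<close>, together with the leading term of the norm of \<open>P\<^sub>\<Lambda>\<close>.

  By adjunction \<open>t\<^bsup>Inv(\<Omega>)\<^esup> K\<^sub>\<Omega>\<^sub>\<Lambda>\<close> is the pairing of \<open>J\<^sub>\<Lambda>\<close> with the image of \<open>s\<^sup>*\<^sub>\<Omega>\<close> under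
  \<open>p\<^sub>\<Gamma> \<mapsto> p\<^sub>\<Gamma> / (q\<^sup>|\<^sup>a\<^sup>| \<Prod>(1 - q\<^bsup>\<gamma>\<^esup>))\<close>. So \<open>K\<^sub>\<Omega>\<^sub>\<Lambda>(q,1)\<close> is the coefficient of \<open>m\<^sub>\<Lambda>\<close> in that image at
  \<open>t = 1\<close>, times the value of \<open>c\<^sub>\<Lambda> \<langle>P\<^sub>\<Lambda>, P\<^sub>\<Lambda>\<rangle>\<close>, in which the zero of order \<open>\<ell>(\<lambda>)\<close> of \<open>c\<^sub>\<Lambda>\<close> cancels
  the pole. Both factors are compatible with permutations.\<close>

section \<open>Specialization of scalars at t = 1\<close>

text \<open>The obstacle is that an identity over Q(q,t) need not survive t = 1: the coefficients of
  an expansion may have poles that cancel in the sum. The remedy is always the same: if the family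
  in question stays linearly independent at t = 1, no such pole can occur. Independence is therefore
  shown first at t = 1, where the Hecke polynomials are plain monomials, and then lifted to Q(q,t).

  The only bases given are P and s. That the power sums span the ring is extracted from the nonzero
  pairing of each \<open>s \<Lambda>\<close> with \<open>dual_schur \<Lambda>\<close>, and that the
  monomials lie in the ring from the triangularity of P.

  The orthogonalization is delicate because the entries of the Gram matrix have poles of different
  orders; about the m-partitions below \<Lambda>, the analysis of these poles uses only the
  comparison of lengths. That comparison comes from raising all m entries of a: no entry is then
  zero, so the number of parts is m plus the length of the partition.\<close>

definition spec1 :: "Qqt \<Rightarrow> Qq \<Rightarrow> bool" where
  "spec1 x v \<longleftrightarrow> (\<exists>a b. x = Fract a b \<and> poly b 1 \<noteq> 0 \<and> v = poly a 1 / poly b 1)"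

lemma spec1I: "poly b 1 \<noteq> 0 \<Longrightarrow> spec1 (Fract a b) (poly a 1 / poly b 1)"
  by (auto simp: spec1_def)

lemma spec1_unique: assumes "spec1 x v" "spec1 x w" shows "v = w"
proof -
  obtain a b where 1: "x = Fract a b" "poly b 1 \<noteq> 0" "v = poly a 1 / poly b 1"
    using assms(1) by (auto simp: spec1_def)
  obtain c d where 2: "x = Fract c d" "poly d 1 \<noteq> 0" "w = poly c 1 / poly d 1"
    using assms(2) by (auto simp: spec1_def)
  have "b \<noteq> 0" "d \<noteq> 0" using 1 2 by auto
  then have "a * d = c * b" using 1 2 by (simp add: eq_fract)
  then have "poly a 1 * poly d 1 = poly c 1 * poly b 1" by (metis poly_mult)
  then show ?thesis unfolding 1(3) 2(3) using 1(2) 2(2) by (simp add: frac_eq_eq)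
qed

lemma spec1_regular: "spec1 x v \<Longrightarrow> regular_at_t1 x"
  by (auto simp: spec1_def regular_at_t1_def)

lemma spec1_at_t1: assumes "spec1 x v" shows "at_t1 x = v"
proof -
  have "(\<exists>a b. x = Fract a b \<and> poly b 1 \<noteq> 0 \<and> w = poly a 1 / poly b 1) \<longleftrightarrow> w = v" for w
    using assms spec1_unique unfolding spec1_def by blast
  then show ?thesis by (simp add: at_t1_def)
qed

lemma spec1_0 [simp]: "spec1 0 0"
  using spec1I[of 1 0] by (simp add: Zero_fract_def[where 'a = "Qq poly", symmetric])

lemma spec1_1 [simp]: "spec1 1 1"
  using spec1I[of 1 1] by (simp add: One_fract_def[where 'a = "Qq poly", symmetric])

lemma spec1_add:
  assumes "spec1 x v" "spec1 y w" shows "spec1 (x + y) (v + w)"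
proof -
  obtain a b where 1: "x = Fract a b" "poly b 1 \<noteq> 0" "v = poly a 1 / poly b 1"
    using assms(1) by (auto simp: spec1_def)
  obtain c d where 2: "y = Fract c d" "poly d 1 \<noteq> 0" "w = poly c 1 / poly d 1"
    using assms(2) by (auto simp: spec1_def)
  have "b \<noteq> 0" "d \<noteq> 0" using 1 2 by auto
  then show ?thesis unfolding 1(1,3) 2(1,3) using spec1I[of "b * d" "a * d + c * b"] 1(2) 2(2)
    by (simp add: add_frac_eq)
qed

lemma spec1_mult:
  assumes "spec1 x v" "spec1 y w" shows "spec1 (x * y) (v * w)"
proof -
  obtain a b where 1: "x = Fract a b" "poly b 1 \<noteq> 0" "v = poly a 1 / poly b 1"
    using assms(1) by (auto simp: spec1_def)
  obtain c d where 2: "y = Fract c d" "poly d 1 \<noteq> 0" "w = poly c 1 / poly d 1"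
    using assms(2) by (auto simp: spec1_def)
  show ?thesis using spec1I[of "b * d" "a * c"] 1 2 by simp
qed

lemma spec1_minus: assumes "spec1 x v" shows "spec1 (- x) (- v)"
proof -
  obtain a b where 1: "x = Fract a b" "poly b 1 \<noteq> 0" "v = poly a 1 / poly b 1"
    using assms(1) by (auto simp: spec1_def)
  show ?thesis using spec1I[of b "- a"] 1 by simp
qed

lemma spec1_diff:
  "spec1 x v \<Longrightarrow> spec1 y w \<Longrightarrow> spec1 (x - y) (v - w)"
  using spec1_add[OF _ spec1_minus, of x v y w] by simp

lemma spec1_inverse:
  assumes "spec1 x v" "v \<noteq> 0" shows "spec1 (inverse x) (inverse v)"
proof -
  obtain a b where 1: "x = Fract a b" "poly b 1 \<noteq> 0" "v = poly a 1 / poly b 1"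
    using assms(1) by (auto simp: spec1_def)
  then have "poly a 1 \<noteq> 0" using assms(2) by auto
  then show ?thesis using spec1I[of a b] 1 by simp
qed

lemma spec1_divide:
  "spec1 x v \<Longrightarrow> spec1 y w \<Longrightarrow> w \<noteq> 0 \<Longrightarrow> spec1 (x / y) (v / w)"
  by (simp add: divide_inverse spec1_mult spec1_inverse)

lemma spec1_sum:
  "(\<And>i. i \<in> A \<Longrightarrow> spec1 (f i) (g i)) \<Longrightarrow> spec1 (sum f A) (sum g A)"
  by (induction A rule: infinite_finite_induct) (auto intro: spec1_add)

lemma spec1_prod:
  "(\<And>i. i \<in> A \<Longrightarrow> spec1 (f i) (g i)) \<Longrightarrow> spec1 (prod f A) (prod g A)"
  by (induction A rule: infinite_finite_induct) (auto intro: spec1_mult)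

lemma spec1_prod_mset:
  "(\<And>i. i \<in># M \<Longrightarrow> spec1 (f i) (g i)) \<Longrightarrow>
     spec1 (\<Prod>i\<in>#M. f i) (\<Prod>i\<in>#M. g i)"
  by (induction M) (auto intro: spec1_mult)

lemma spec1_power: "spec1 x v \<Longrightarrow> spec1 (x ^ n) (v ^ n)"
  by (induction n) (auto intro: spec1_mult)

lemma spec1_of_nat [simp]: "spec1 (of_nat n) (of_nat n)"
  by (induction n) (auto intro: spec1_add)

lemma spec1_tv [simp]: "spec1 tv 1"
  using spec1I[of 1 "[:0, 1:]"] by (simp add: tv_def)

lemma spec1_qv: "spec1 qv (Fract [:0, 1:] 1)"
  using spec1I[of 1 "[:Fract [:0, 1:] 1:]"] by (simp add: qv_def)

lemma spec1_one_minus_tv: "spec1 (1 - tv) 0"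
  using spec1_diff[OF spec1_1 spec1_tv] by simp

lemma one_minus_tv_Fract: "1 - tv = Fract (- [:- 1, 1:]) 1"
  by (simp add: tv_def One_fract_def[where 'a = "Qq poly"] one_pCons)

lemma tv_neq_1 [simp]: "tv \<noteq> 1"
  by (simp add: tv_def One_fract_def[where 'a = "Qq poly"] eq_fract one_pCons)

text \<open>A numerator that vanishes at 1 contains the factor t - 1, which cancels. So if scaling
  by 1 - t produces the value 0, x was already regular without the scaling.\<close>

lemma spec1_cancel_one_minus_tv:
  assumes "spec1 ((1 - tv) * x) 0" obtains v where "spec1 x v"
proof -
  obtain a b where 1: "(1 - tv) * x = Fract a b" "poly b 1 \<noteq> 0" "poly a 1 = 0"
    using assms by (auto simp: spec1_def)
  then obtain c where c: "a = [:- 1, 1:] * c" by (metis poly_eq_0_iff_dvd dvdE)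
  have "b \<noteq> 0" using 1 by auto
  have "Fract ([:- 1, 1:] * c) b = (1 - tv) * Fract (- c) b"
    unfolding one_minus_tv_Fract mult_fract by (simp only: minus_mult_minus mult_1)
  then have "(1 - tv) * x = (1 - tv) * Fract (- c) b" using 1(1) c by simp
  then have "x = Fract (- c) b" by simp
  then show ?thesis using that spec1I[OF 1(2), of "- c"] by simp
qed

lemma Fract_power: "Fract (c ^ k) 1 = Fract c 1 ^ k"
proof (induction k)
  case (Suc k)
  then show ?case using mult_fract[of c 1 "c ^ k" 1] by simp
qed (simp add: One_fract_def)

text \<open>The fractions regular at t = 1 form a discrete valuation ring with uniformizer
  \<open>1 - tv\<close>. The valuation of x is \<open>- n\<close>, and \<open>v \<noteq> 0\<close>
  makes it exact.\<close>

lemma order_at_t1: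
  assumes "x \<noteq> 0"
  obtains n :: int and v where "v \<noteq> 0" "spec1 (x * (1 - tv) powi n) v"
proof -
  obtain a b where x: "x = Fract a b" "b \<noteq> 0" by (cases x) auto
  with assms have "a \<noteq> 0" by (auto simp: Zero_fract_def[where 'a = "Qq poly"] eq_fract)
  obtain a' where a: "a = [:- 1, 1:] ^ order 1 a * a'" "\<not> [:- 1, 1:] dvd a'"
    using order_decomp[OF \<open>a \<noteq> 0\<close>, of 1] by auto
  obtain b' where b: "b = [:- 1, 1:] ^ order 1 b * b'" "\<not> [:- 1, 1:] dvd b'"
    using order_decomp[OF \<open>b \<noteq> 0\<close>, of 1] by auto
  have nz: "poly a' 1 \<noteq> 0" "poly b' 1 \<noteq> 0" using a(2) b(2) by (auto simp: poly_eq_0_iff_dvd)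
  then have "a' \<noteq> 0" "b' \<noteq> 0" by auto
  have split: "Fract ([:- 1, 1:] ^ k * c) 1 = (- (1 - tv)) ^ k * Fract c 1" for k c
  proof -
    have "Fract ([:- 1, 1:] ^ k * c) 1 = Fract [:- 1, 1:] 1 ^ k * Fract c 1"
      using mult_fract[of "[:- 1, 1:] ^ k" 1 c 1] by (simp add: Fract_power)
    also have "Fract [:- 1, 1:] 1 = - (1 - tv)" by (simp add: one_minus_tv_Fract)
    finally show ?thesis .
  qed
  define n where "n = int (order 1 b) - int (order 1 a)"
  define e u where "e = 1 - tv" and "u = Fract a' b'"
  have e: "e \<noteq> 0" by (simp add: e_def)
  have b'1: "Fract b' 1 \<noteq> 0" "Fract a' 1 = u * Fract b' 1"
    using \<open>b' \<noteq> 0\<close> by (simp_all add: u_def Zero_fract_def[where 'a = "Qq poly"] eq_fract)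
  have "x = Fract a 1 / Fract b 1" using x by simp
  also have "\<dots> = ((- e) ^ order 1 a * Fract a' 1) / ((- e) ^ order 1 b * Fract b' 1)"
    by (subst a(1), subst b(1)) (simp only: split e_def)
  also have "\<dots> = (- e) ^ order 1 a * u / (- e) ^ order 1 b" using b'1 by simp
  finally have "x * e powi n * e ^ order 1 a = (- e) ^ order 1 a * u / (- e) ^ order 1 b * e ^ order 1 b"
    using e by (simp add: n_def power_int_diff)
  \<comment> \<open>The polynomial split off is t - 1, hence the powers of \<open>- e\<close>; they
    differ from those of \<open>e\<close> by signs, settled by parity.\<close>
  then have "x * e powi n * e ^ order 1 a
      = ((- 1) ^ order 1 a * (- 1) ^ order 1 b * u) * e ^ order 1 a"
    using e by (cases "even (order 1 a)"; cases "even (order 1 b)") simp_all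
  then have *: "x * (1 - tv) powi n = (- 1) ^ (order 1 a + order 1 b) * Fract a' b'"
    using e by (simp add: power_add e_def u_def)
  have "spec1 (- 1) (- 1)" using spec1_minus[OF spec1_1] .
  then have "spec1 (x * (1 - tv) powi n)
      ((- 1) ^ (order 1 a + order 1 b) * (poly a' 1 / poly b' 1))"
    unfolding * by (intro spec1_mult spec1_power spec1I nz)
  then show ?thesis by (rule that[rotated]) (use nz in auto)
qed

lemma spec1_after_scaling:
  obtains N v where "spec1 ((1 - tv) ^ N * x) v"
proof (cases "x = 0")
  case True
  then show ?thesis using that[of 0 0] by simp
next
  case False
  then obtain n :: int and v where v: "spec1 (x * (1 - tv) powi n) v"
    by (rule order_at_t1)
  show ?thesis
  proof (cases "n \<ge> 0")
    case True
    then show ?thesis using v that[of "nat n" v] by (simp add: power_int_def mult.commute)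
  next
    case False
    have "spec1 ((1 - tv) ^ nat (- n) * (x * (1 - tv) powi n)) (0 ^ nat (- n) * v)"
      by (intro spec1_mult v spec1_power spec1_one_minus_tv)
    moreover have "(1 - tv) ^ nat (- n) * (x * (1 - tv) powi n) = x"
      using False by (simp add: power_int_def power_inverse)
    ultimately show ?thesis using that[of 0 "0 ^ nat (- n) * v"] by simp
  qed
qed

text \<open>Compare q^n and 1 at q = 0. This keeps the factors 1 - q^n invertible at t = 1, in the
  norms of the power sums and in the denominators of the adjoint map.\<close>

lemma qv_power_specialized_neq_1:
  assumes "n > 0" shows "(Fract [:0, 1:] 1 :: Qq) ^ n \<noteq> 1"
proof -
  have "(Fract [:0, 1:] 1 :: Qq) ^ n = Fract ([:0, 1:] ^ n) 1" by (simp add: Fract_power)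
  also have "\<dots> \<noteq> 1"
  proof
    assume "Fract ([:0, 1 :: rat:] ^ n) 1 = 1"
    then have "[:0, 1 :: rat:] ^ n = 1" by (simp add: One_fract_def eq_fract)
    then have "poly ([:0, 1 :: rat:] ^ n) 0 = poly 1 0" by simp
    then show False using assms by (simp add: power_0_left)
  qed
  finally show ?thesis .
qed

section \<open>Series and their specialization\<close>

lemma pcoeff_0 [simp]: "pcoeff 0 M = 0" by transfer simp
lemma pcoeff_1: "pcoeff 1 M = (if M = {#} then 1 else 0)" by transfer simp
lemma pcoeff_add [simp]: "pcoeff (f + g) M = pcoeff f M + pcoeff g M" by transfer simp
lemma pcoeff_diff [simp]: "pcoeff (f - g) M = pcoeff f M - pcoeff g M" by transfer simp
lemma pcoeff_uminus [simp]: "pcoeff (- f) M = - pcoeff f M" by transfer simp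
lemma pcoeff_scale [simp]: "pcoeff (pscale c f) M = c * pcoeff f M" by transfer simp
lemma pcoeff_mult: "pcoeff (f * g) M = (\<Sum>(A, B) | A + B = M. pcoeff f A * pcoeff g B)"
  by transfer simp
lemma pcoeff_sum [simp]: "pcoeff (sum f A) M = (\<Sum>i\<in>A. pcoeff (f i) M)"
  by (induction A rule: infinite_finite_induct) auto
lemma pcoeff_swap_vars [simp]:
  "pcoeff (swap_vars i f) M = pcoeff f (image_mset (transpose i (Suc i)) M)"
  by transfer simp

lemma pscale_mult_left: "pscale c f * g = pscale c (f * g)"
  by (rule pseries_eqI) (auto simp: pcoeff_mult sum_distrib_left mult.assoc intro!: sum.cong)

section \<open>Monomials as series\<close>

lift_definition pmono :: "nat multiset \<Rightarrow> 'a::comm_ring_1 pseries" is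
  "\<lambda>X M. if M = X then 1 else 0" .

lemma pcoeff_pmono: "pcoeff (pmono X) M = (if M = X then 1 else 0)"
  by transfer simp

lemma pcoeff_pmono_mult:
  "pcoeff (pmono X * f) M = (if X \<subseteq># M then pcoeff f (M - X) else 0)"
proof -
  have "pcoeff (pmono X * f) M
      = (\<Sum>(A, B) | A + B = M. if A = X then pcoeff f B else 0)"
    unfolding pcoeff_mult by (rule sum.cong) (auto simp: pcoeff_pmono)
  also have "\<dots> = (\<Sum>(A, B) | A + B = M \<and> A = X. pcoeff f B)"
    by (rule sum.mono_neutral_cong_right) (auto simp: finite_splittings split: if_splits)
  also have "{(A, B). A + B = M \<and> A = X} = (if X \<subseteq># M then {(X, M - X)} else {})"
    by (auto simp: subset_mset.add_diff_inverse)
  finally show ?thesis by (auto split: if_splits)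
qed

lemma pmono_mult: "pmono X * pmono Y = pmono (X + Y)"
proof (rule pseries_eqI)
  fix M
  have "X \<subseteq># M \<Longrightarrow> M - X = Y \<longleftrightarrow> M = X + Y"
    by (auto simp: subset_mset.add_diff_inverse)
  then show "pcoeff (pmono X * pmono Y :: 'a pseries) M = pcoeff (pmono (X + Y)) M"
    by (auto simp: pcoeff_pmono_mult pcoeff_pmono)
qed

lemma pmono_empty: "pmono {#} = 1"
  by (rule pseries_eqI) (simp add: pcoeff_pmono pcoeff_1)

lemma pvar_eq_pmono: "pvar i = pmono {#i#}"
  by transfer simp

lemma pvar_power: "pvar i ^ n = pmono (replicate_mset n i)"
  by (induction n) (simp_all add: pmono_empty pvar_eq_pmono pmono_mult)

lemma pcoeff_pvar_mult:
  "pcoeff (pvar i * f) M = (if i \<in># M then pcoeff f (M - {#i#}) else 0)"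
  by (simp add: pvar_eq_pmono pcoeff_pmono_mult)

definition expo :: "nat list \<Rightarrow> nat multiset" where
  "expo a = (\<Sum>i<length a. replicate_mset (a ! i) i)"

lemma xpow_eq_pmono: "xpow a = pmono (expo a)"
proof -
  have "(\<Prod>i\<in>I. pvar i ^ (a ! i)) = pmono (\<Sum>i\<in>I. replicate_mset (a ! i) i)" if "finite I" for I
    using that by induction (simp_all add: pmono_empty pvar_power pmono_mult)
  from this[of "{..<length a}"] show ?thesis by (simp add: xpow_def expo_def)
qed

lemma count_expo: "count (expo a) i = (if i < length a then a ! i else 0)"
  by (simp add: expo_def count_sum if_distrib cong: if_cong)

lemma set_expo: "set_mset (expo a) \<subseteq> {..<length a}"
  by (auto simp: count_expo simp flip: count_greater_zero_iff split: if_splits)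

lemma expo_inject: "length a = length b \<Longrightarrow> expo a = expo b \<longleftrightarrow> a = b"
  by (metis (no_types, lifting) count_expo nth_equalityI)

lemma size_expo: "size (expo a) = sum_list a"
proof -
  have "size (\<Sum>i\<in>I. replicate_mset (a ! i) i) = (\<Sum>i\<in>I. a ! i)" if "finite I" for I
    using that by induction simp_all
  then show ?thesis by (simp add: expo_def sum_list_sum_nth atLeast0LessThan)
qed

lemma expo_surj: assumes "set_mset M \<subseteq> {..<m}" obtains a where "length a = m" "M = expo a"
proof
  show "length (map (count M) [0..<m]) = m" by simp
  show "M = expo (map (count M) [0..<m])"
    by (rule multiset_eqI) (use assms in \<open>auto simp: count_expo not_in_iff[symmetric]\<close>)
qed

text \<open>With the inverse in the body, a bijection \<pi> sends the variable i to the variable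
  \<open>\<pi> i\<close>, as \<open>permute_vars_pmono\<close> shows.\<close>

lift_definition permute_vars :: "(nat \<Rightarrow> nat) \<Rightarrow> 'a pseries \<Rightarrow> 'a pseries" is
  "\<lambda>\<pi> f M. f (image_mset (inv_into UNIV \<pi>) M)" .

lemma pcoeff_permute_vars: "pcoeff (permute_vars \<pi> f) M = pcoeff f (image_mset (inv_into UNIV \<pi>) M)"
  by transfer simp

lemma image_mset_inv:
  assumes "bij \<pi>"
  shows "image_mset \<pi> (image_mset (inv_into UNIV \<pi>) M) = M" (is ?A)
    and "image_mset (inv_into UNIV \<pi>) (image_mset \<pi> X) = X" (is ?B)
proof -
  have "\<pi> (inv_into UNIV \<pi> x) = x" "inv_into UNIV \<pi> (\<pi> y) = y" for x y
    using assms by (meson bij_is_surj surj_f_inv_f, meson bij_is_inj inv_f_f)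
  then show ?A ?B by (simp_all add: multiset.map_comp comp_def)
qed

lemma image_mset_inv_eq_iff:
  "bij \<pi> \<Longrightarrow> image_mset (inv_into UNIV \<pi>) M = X \<longleftrightarrow> M = image_mset \<pi> X"
  using image_mset_inv(1)[of \<pi> M] image_mset_inv(2)[of \<pi> X] by auto

lemma pcoeff_permute_vars_image:
  "bij \<pi> \<Longrightarrow> pcoeff (permute_vars \<pi> f) (image_mset \<pi> M) = pcoeff f M"
  by (simp add: pcoeff_permute_vars image_mset_inv)

lemma swap_vars_eq: "swap_vars i = permute_vars (transpose i (Suc i))"
  by (rule ext, rule pseries_eqI) (simp add: pcoeff_permute_vars)

lemma permute_vars_add: "permute_vars \<pi> (f + g) = permute_vars \<pi> f + permute_vars \<pi> g"
  by (rule pseries_eqI) (simp add: pcoeff_permute_vars)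

lemma permute_vars_0: "permute_vars \<pi> 0 = 0"
  by (rule pseries_eqI) (simp add: pcoeff_permute_vars)

lemma permute_vars_scale: "permute_vars \<pi> (pscale c f) = pscale c (permute_vars \<pi> f)"
  by (rule pseries_eqI) (simp add: pcoeff_permute_vars)

lemma permute_vars_sum: "permute_vars \<pi> (sum f A) = (\<Sum>i\<in>A. permute_vars \<pi> (f i))"
  by (rule pseries_eqI) (simp add: pcoeff_permute_vars)

lemma permute_vars_mult:
  assumes "bij \<pi>" shows "permute_vars \<pi> (f * g) = permute_vars \<pi> f * permute_vars \<pi> g"
proof (rule pseries_eqI)
  fix M
  show "pcoeff (permute_vars \<pi> (f * g)) M = pcoeff (permute_vars \<pi> f * permute_vars \<pi> g) M"
    unfolding pcoeff_permute_vars pcoeff_mult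
    by (rule sum.reindex_bij_witness[of _ "map_prod (image_mset (inv_into UNIV \<pi>)) (image_mset (inv_into UNIV \<pi>))"
          "map_prod (image_mset \<pi>) (image_mset \<pi>)"])
      (auto simp: image_mset_inv[OF assms] dest: arg_cong[of _ _ "image_mset \<pi>"])
qed

lemma permute_vars_pmono:
  assumes "bij \<pi>" shows "permute_vars \<pi> (pmono X) = pmono (image_mset \<pi> X)"
proof (rule pseries_eqI)
  fix M
  show "pcoeff (permute_vars \<pi> (pmono X)) M = pcoeff (pmono (image_mset \<pi> X)) M"
    using assms by (simp add: pcoeff_permute_vars pcoeff_pmono image_mset_inv_eq_iff)
qed

lemma permute_vars_1: "bij \<pi> \<Longrightarrow> permute_vars \<pi> 1 = 1"
  using permute_vars_pmono[of \<pi> "{#}"] by (simp add: pmono_empty)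

lemma permute_vars_prod_mset:
  "bij \<pi> \<Longrightarrow> permute_vars \<pi> (\<Prod>i\<in>#A. f i) = (\<Prod>i\<in>#A. permute_vars \<pi> (f i))"
  by (induction A) (simp_all add: permute_vars_1 permute_vars_mult)

lemma permute_vars_powersum: assumes "bij \<pi>" shows "permute_vars \<pi> (powersum r) = powersum r"
proof (rule pseries_eqI)
  fix M
  have *: "image_mset (inv_into UNIV \<pi>) M = replicate_mset r i \<longleftrightarrow> M = replicate_mset r (\<pi> i)" for i
    using assms by (simp add: image_mset_inv_eq_iff)
  have "(\<exists>i. M = replicate_mset r (\<pi> i)) \<longleftrightarrow> (\<exists>i. M = replicate_mset r i)"
    using assms by (metis bij_pointE)
  then show "pcoeff (permute_vars \<pi> (powersum r)) M = pcoeff (powersum r) M"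
    by (simp add: pcoeff_permute_vars powersum.rep_eq *)
qed

lemma permute_vars_powersum_part:
  "bij \<pi> \<Longrightarrow> permute_vars \<pi> (powersum_part l) = powersum_part l"
  by (simp add: powersum_part_def permute_vars_prod_mset permute_vars_powersum)

lemma permute_vars_det:
  fixes f :: "nat \<times> nat \<Rightarrow> 'a::comm_ring_1 pseries"
  assumes "bij \<pi>" shows "permute_vars \<pi> (det (mat n n f)) = det (mat n n (\<lambda>i. permute_vars \<pi> (f i)))"
proof -
  have hom: "comm_ring_hom (permute_vars \<pi> :: 'a pseries \<Rightarrow> _)"
    by unfold_locales
      (simp_all only: permute_vars_0 permute_vars_add permute_vars_mult[OF assms] permute_vars_1[OF assms])
  have "map_mat (permute_vars \<pi>) (mat n n f) = mat n n (\<lambda>i. permute_vars \<pi> (f i))"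
    unfolding map_mat_def by (rule eq_matI; simp only: dim_row_mat dim_col_mat index_mat)
  then show ?thesis using comm_ring_hom.hom_det[OF hom, of "mat n n f"] by metis
qed

section \<open>Coefficientwise specialization of series\<close>

definition pspec1 :: "Qqt pseries \<Rightarrow> Qq pseries \<Rightarrow> bool" where
  "pspec1 f g \<longleftrightarrow> (\<forall>M. spec1 (pcoeff f M) (pcoeff g M))"

lemma pspec1D: "pspec1 f g \<Longrightarrow> spec1 (pcoeff f M) (pcoeff g M)"
  by (simp add: pspec1_def)

lemma pspec1_unique: "pspec1 f g \<Longrightarrow> pspec1 f h \<Longrightarrow> g = h"
  by (meson pseries_eqI pspec1D spec1_unique)

lemma pspec1_0 [simp]: "pspec1 0 0"
  by (simp add: pspec1_def)

lemma pspec1_1 [simp]: "pspec1 1 1"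
  by (simp add: pspec1_def pcoeff_1)

lemma pspec1_pmono [simp]: "pspec1 (pmono X) (pmono X)"
  by (simp add: pspec1_def pcoeff_pmono)

lemma pspec1_pvar [simp]: "pspec1 (pvar i) (pvar i)"
  by (simp add: pvar_eq_pmono)

lemma pspec1_xpow [simp]: "pspec1 (xpow a) (xpow a)"
  by (simp add: xpow_eq_pmono)

lemma pspec1_powersum [simp]: "pspec1 (powersum r) (powersum r)"
  by (simp add: pspec1_def powersum.rep_eq)

lemma pspec1_add: "pspec1 f f' \<Longrightarrow> pspec1 g g' \<Longrightarrow> pspec1 (f + g) (f' + g')"
  by (simp add: pspec1_def spec1_add)

lemma pspec1_diff: "pspec1 f f' \<Longrightarrow> pspec1 g g' \<Longrightarrow> pspec1 (f - g) (f' - g')"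
  by (simp add: pspec1_def spec1_diff)

lemma pspec1_minus: "pspec1 f f' \<Longrightarrow> pspec1 (- f) (- f')"
  by (simp add: pspec1_def spec1_minus)

lemma pspec1_scale: "spec1 c c' \<Longrightarrow> pspec1 f f' \<Longrightarrow> pspec1 (pscale c f) (pscale c' f')"
  by (simp add: pspec1_def spec1_mult)

lemma pspec1_mult: "pspec1 f f' \<Longrightarrow> pspec1 g g' \<Longrightarrow> pspec1 (f * g) (f' * g')"
  by (auto simp: pspec1_def pcoeff_mult intro!: spec1_sum spec1_mult)

lemma pspec1_sum:
  "(\<And>i. i \<in> A \<Longrightarrow> pspec1 (f i) (g i)) \<Longrightarrow> pspec1 (sum f A) (sum g A)"
  by (induction A rule: infinite_finite_induct) (auto intro: pspec1_add)

lemma pspec1_prod: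
  "(\<And>i. i \<in> A \<Longrightarrow> pspec1 (f i) (g i)) \<Longrightarrow> pspec1 (prod f A) (prod g A)"
  by (induction A rule: infinite_finite_induct) (auto intro: pspec1_mult)

lemma pspec1_powersum_part: "pspec1 (powersum_part l) (powersum_part l)"
  unfolding powersum_part_def by (induction l) (auto intro: pspec1_mult)

lemma pspec1_swap_vars: "pspec1 f f' \<Longrightarrow> pspec1 (swap_vars i f) (swap_vars i f')"
  by (simp add: pspec1_def)

lemma pspec1_det:
  assumes "\<And>i j. i < n \<Longrightarrow> j < n \<Longrightarrow> pspec1 (f (i, j)) (g (i, j))"
  shows "pspec1 (det (mat n n f)) (det (mat n n g))"
proof -
  have "pspec1 (signof p) (signof p)" for p :: "nat \<Rightarrow> nat"
    by (auto simp: sign_def intro: pspec1_minus)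
  then show ?thesis using assms
    unfolding det_def by (auto intro!: pspec1_sum pspec1_mult pspec1_prod
        simp: permutes_in_image)
qed

text \<open>If the combination were not regular coefficientwise, scaling it by the right power of
  \<open>1 - t\<close> would specialize it to a nontrivial relation between the \<open>B' i\<close>.\<close>

lemma coefficients_specialize:
  fixes B :: "'i \<Rightarrow> Qqt pseries" and B' :: "'i \<Rightarrow> Qq pseries"
  assumes fin: "finite I"
    and B: "\<And>i. i \<in> I \<Longrightarrow> pspec1 (B i) (B' i)"
    and indep: "\<And>c. (\<Sum>i\<in>I. pscale (c i) (B' i)) = 0 \<Longrightarrow> \<forall>i\<in>I. c i = 0"
    and f: "pspec1 (\<Sum>i\<in>I. pscale (c i) (B i)) f'"
  obtains c' where "\<And>i. i \<in> I \<Longrightarrow> spec1 (c i) (c' i)" "f' = (\<Sum>i\<in>I. pscale (c' i) (B' i))"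
proof -
  define good where "good N \<longleftrightarrow> (\<forall>i\<in>I. \<exists>v. spec1 ((1 - tv) ^ N * c i) v)" for N
  have "\<exists>N. good N" unfolding good_def using fin
  proof induction
    case (insert j J)
    then obtain N where N: "\<forall>i\<in>J. \<exists>v. spec1 ((1 - tv) ^ N * c i) v" by blast
    obtain K w where K: "spec1 ((1 - tv) ^ K * c j) w" by (rule spec1_after_scaling)
    have "\<exists>v. spec1 ((1 - tv) ^ (N + K) * c i) v" if "i \<in> insert j J" for i
    proof -
      have "\<exists>v. spec1 ((1 - tv) ^ n * ((1 - tv) ^ k * c i)) v"
        if "spec1 ((1 - tv) ^ k * c i) v" for n k v
        using spec1_mult[OF spec1_power[OF spec1_one_minus_tv] that] by blast
      from this[of N _ K] this[of K _ N] that N K show ?thesis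
        by (auto simp: power_add mult_ac)
    qed
    then show ?case by blast
  qed simp
  define N where "N = (LEAST N. good N)"
  have N: "good N" unfolding N_def using \<open>\<exists>N. good N\<close> by (rule LeastI_ex)
  have "N = 0"
  proof (rule ccontr)
    assume "N \<noteq> 0"
    then obtain K where K: "N = Suc K" by (cases N) auto
    obtain d where d: "\<And>i. i \<in> I \<Longrightarrow> spec1 ((1 - tv) ^ N * c i) (d i)"
      using N unfolding good_def by metis
    have "pspec1 (\<Sum>i\<in>I. pscale ((1 - tv) ^ N * c i) (B i)) (\<Sum>i\<in>I. pscale (d i) (B' i))"
      by (intro pspec1_sum pspec1_scale d B)
    moreover have "(\<Sum>i\<in>I. pscale ((1 - tv) ^ N * c i) (B i))
        = pscale ((1 - tv) ^ N) (\<Sum>i\<in>I. pscale (c i) (B i))"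
      by (rule pseries_eqI) (simp add: sum_distrib_left mult.assoc)
    moreover have "pspec1 (pscale ((1 - tv) ^ N) (\<Sum>i\<in>I. pscale (c i) (B i))) (pscale (0 ^ N) f')"
      by (intro pspec1_scale f spec1_power spec1_one_minus_tv)
    ultimately have "(\<Sum>i\<in>I. pscale (d i) (B' i)) = pscale (0 ^ N) f'"
      by (metis pspec1_unique)
    then have "(\<Sum>i\<in>I. pscale (d i) (B' i)) = 0"
      using K by (simp add: pseries_eqI)
    then have "\<forall>i\<in>I. d i = 0" by (rule indep)
    then have "\<forall>i\<in>I. spec1 ((1 - tv) * ((1 - tv) ^ K * c i)) 0"
      using d unfolding K by (simp add: mult.assoc)
    then have "good K" unfolding good_def by (metis spec1_cancel_one_minus_tv)
    then show False using K not_less_Least[of K good] unfolding N_def by simp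
  qed
  then obtain c' where c': "\<And>i. i \<in> I \<Longrightarrow> spec1 (c i) (c' i)"
    using N unfolding good_def by simp metis
  have "pspec1 (\<Sum>i\<in>I. pscale (c i) (B i)) (\<Sum>i\<in>I. pscale (c' i) (B' i))"
    by (intro pspec1_sum pspec1_scale c' B)
  then show ?thesis using that[of c'] c' f pspec1_unique by blast
qed

text \<open>Scale a relation by the power of 1 - t that gives the coefficient of i a nonzero value
  at t = 1. Since its sum 0 is regular, \<open>coefficients_specialize\<close> makes all scaled
  coefficients regular, and their values form a nontrivial relation between the
  \<open>B' i\<close>.\<close>

lemma independent_lifts:
  fixes B :: "'i \<Rightarrow> Qqt pseries" and B' :: "'i \<Rightarrow> Qq pseries"
  assumes fin: "finite I"
    and B: "\<And>i. i \<in> I \<Longrightarrow> pspec1 (B i) (B' i)"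
    and indep: "\<And>c. (\<Sum>i\<in>I. pscale (c i) (B' i)) = 0 \<Longrightarrow> \<forall>i\<in>I. c i = 0"
    and z: "(\<Sum>i\<in>I. pscale (c i) (B i)) = 0" and "i \<in> I"
  shows "c i = 0"
proof (rule ccontr)
  assume "c i \<noteq> 0"
  then obtain n :: int and v where v: "v \<noteq> 0" "spec1 (c i * (1 - tv) powi n) v"
    by (rule order_at_t1)
  have z': "(\<Sum>i\<in>I. pscale (c i * u) (B i)) = 0" for u
  proof -
    have "(\<Sum>i\<in>I. pscale (c i * u) (B i)) = pscale u (\<Sum>i\<in>I. pscale (c i) (B i))"
      by (rule pseries_eqI) (simp add: sum_distrib_left mult_ac)
    then show ?thesis using z by simp
  qed
  then have "pspec1 (\<Sum>i\<in>I. pscale (c i * (1 - tv) powi n) (B i)) 0" by simp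
  then have "\<exists>c'. (\<forall>i\<in>I. spec1 (c i * (1 - tv) powi n) (c' i)) \<and> 0 = (\<Sum>i\<in>I. pscale (c' i) (B' i))"
    by (rule coefficients_specialize[OF fin, rotated 2]) (assumption | rule B indep | fast)+
  then obtain c' where "\<And>i. i \<in> I \<Longrightarrow> spec1 (c i * (1 - tv) powi n) (c' i)"
    "(\<Sum>i\<in>I. pscale (c' i) (B' i)) = 0" by auto
  then show False using indep[of c'] v \<open>i \<in> I\<close> spec1_unique by metis
qed

section \<open>Divided differences and Hecke operators\<close>

text \<open>The quotient g of h by x_i - x_{i+1}: comparing coefficients gives g(N) = h(N + i) + g(N
  + i - (i+1)), in multiset notation, and the recursion is unrolled until the variable i+1 is used
  up.\<close>

lift_definition divdiff :: "nat \<Rightarrow> 'a::comm_ring_1 pseries \<Rightarrow> 'a pseries" is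
  "\<lambda>i h N. \<Sum>k\<le>count N (Suc i). h (N - replicate_mset k (Suc i) + replicate_mset (Suc k) i)" .

text \<open>The two sums in the coefficient of the product telescope and leave h at M. Antisymmetry
  enters when x_i does not divide M, where the first sum has to vanish.\<close>

lemma divdiff_eq:
  fixes h :: "'a::field_char_0 pseries"
  assumes anti: "swap_vars i h = - h"
  shows "(pvar i - pvar (Suc i)) * divdiff i h = h"
proof (rule pseries_eqI)
  fix M :: "nat multiset"
  define u v where "u = count M i" and "v = count M (Suc i)"
  define R where "R = M - replicate_mset u i - replicate_mset v (Suc i)"
  \<comment> \<open>The coefficients of h at the monomials that differ from M only in the exponents
    of i and i+1; \<open>R\<close> collects the other variables.\<close>
  define \<phi> where "\<phi> j k = pcoeff h (R + replicate_mset j i + replicate_mset k (Suc i))" for j k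
  have \<phi>: "pcoeff h X = \<phi> j k"
    if "\<And>x. count X x = (if x = i then j else if x = Suc i then k else count M x)" for X j k
    unfolding \<phi>_def by (rule arg_cong[of _ _ "pcoeff h"], rule multiset_eqI)
      (simp add: that R_def u_def v_def)
  have D: "pcoeff (divdiff i h) N = (\<Sum>k\<le>v'. \<phi> (u' + Suc k) (v' - k))"
    if "\<And>x. count N x = (if x = i then u' else if x = Suc i then v' else count M x)" for N u' v'
    unfolding divdiff.rep_eq
    by (rule sum.cong) (use that in \<open>auto intro!: \<phi>\<close>)
  have \<phi>_swap: "\<phi> k j = - \<phi> j k" for j k
  proof -
    have "pcoeff (swap_vars i h) (R + replicate_mset j i + replicate_mset k (Suc i)) = - \<phi> j k"
      unfolding anti by (simp add: \<phi>_def)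
    moreover have "image_mset (transpose i (Suc i)) R = image_mset id R"
      by (rule image_mset_cong) (auto simp: R_def u_def v_def transpose_def simp flip: count_greater_zero_iff)
    ultimately show ?thesis by (simp add: \<phi>_def ac_simps)
  qed
  \<comment> \<open>Exchanging k and n - k shows that the sum equals its negative, so it is 0 in
    characteristic 0.\<close>
  have zero: "(\<Sum>k\<le>n. \<phi> k (n - k)) = 0" for n
  proof -
    have "(\<Sum>k\<le>n. \<phi> k (n - k)) = (\<Sum>k\<le>n. \<phi> (n - k) k)"
      by (rule sum.reindex_bij_witness[of _ "\<lambda>k. n - k" "\<lambda>k. n - k"]) auto
    also have "\<dots> = - (\<Sum>k\<le>n. \<phi> k (n - k))" by (simp add: \<phi>_swap[of "_ - _"] sum_negf)
    finally show ?thesis by simp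
  qed
  have first: "(if i \<in># M then pcoeff (divdiff i h) (M - {#i#}) else 0) = (\<Sum>k\<le>v. \<phi> (u + k) (v - k))"
  proof (cases "i \<in># M")
    case True
    then obtain u' where u': "u = Suc u'" unfolding u_def by (metis count_greater_zero_iff gr0_conv_Suc)
    have "pcoeff (divdiff i h) (M - {#i#}) = (\<Sum>k\<le>v. \<phi> (u' + Suc k) (v - k))"
      by (rule D) (use u' in \<open>auto simp: u_def v_def\<close>)
    with True u' show ?thesis by simp
  next
    case False
    then have "u = 0" by (simp add: u_def not_in_iff)
    with False zero[of v] show ?thesis by simp
  qed
  have second: "(if Suc i \<in># M then pcoeff (divdiff i h) (M - {#Suc i#}) else 0)
      = (\<Sum>k<v. \<phi> (u + Suc k) (v - Suc k))"
  proof (cases "Suc i \<in># M")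
    case True
    then obtain v' where v': "v = Suc v'" unfolding v_def by (metis count_greater_zero_iff gr0_conv_Suc)
    have "pcoeff (divdiff i h) (M - {#Suc i#}) = (\<Sum>k\<le>v'. \<phi> (u + Suc k) (v' - k))"
      by (rule D) (use v' in \<open>auto simp: u_def v_def\<close>)
    with True v' show ?thesis by (simp add: lessThan_Suc_atMost)
  next
    case False
    then have "v = 0" by (simp add: v_def not_in_iff)
    with False show ?thesis by simp
  qed
  have "pcoeff ((pvar i - pvar (Suc i)) * divdiff i h) M
      = (\<Sum>k\<le>v. \<phi> (u + k) (v - k)) - (\<Sum>k<v. \<phi> (u + Suc k) (v - Suc k))"
    unfolding left_diff_distrib pcoeff_diff pcoeff_pvar_mult first second ..
  also have "(\<Sum>k\<le>v. \<phi> (u + k) (v - k)) = \<phi> u v + (\<Sum>k<v. \<phi> (u + Suc k) (v - Suc k))"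
    by (subst sum.atMost_shift) simp
  also have "\<phi> u v = pcoeff h M"
    by (rule \<phi>[symmetric]) (simp add: u_def v_def)
  finally show "pcoeff ((pvar i - pvar (Suc i)) * divdiff i h) M = pcoeff h M" by simp
qed

text \<open>The coefficient of the product at N + i is g(N) minus a coefficient of g with a smaller
  exponent of x_{i+1}, hence induction on that exponent.\<close>

lemma vandermonde_factor_cancel:
  fixes g :: "'a::comm_ring_1 pseries"
  assumes "(pvar i - pvar (Suc i)) * g = 0" shows "g = 0"
proof (rule pseries_eqI)
  have "pcoeff g N = 0" if "count N (Suc i) = n" for n N
    using that
  proof (induction n arbitrary: N)
    case (0 N)
    have "0 = pcoeff ((pvar i - pvar (Suc i)) * g) (add_mset i N)" by (simp add: assms)
    also have "\<dots> = pcoeff g N"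
      using count_eq_zero_iff[of N "Suc i"] 0 by (simp add: left_diff_distrib pcoeff_pvar_mult)
    finally show ?case by simp
  next
    case (Suc n N)
    then have in_N: "Suc i \<in># N" by (metis count_greater_zero_iff zero_less_Suc)
    have "0 = pcoeff ((pvar i - pvar (Suc i)) * g) (add_mset i N)" by (simp add: assms)
    also have "\<dots> = pcoeff g N - pcoeff g (add_mset i N - {#Suc i#})" using in_N
      by (simp add: left_diff_distrib pcoeff_pvar_mult)
    also have "pcoeff g (add_mset i N - {#Suc i#}) = 0" using Suc.prems by (intro Suc.IH) simp
    finally show ?case by simp
  qed
  then show "pcoeff g M = pcoeff 0 M" for M by simp
qed

text \<open>Replaces the definite description by explicit coefficients, from which regularity at t =
  1 and degree bounds can be read off.\<close>

lemma divided_diff_eq: "divided_diff i f = divdiff i (swap_vars i f - f)"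
proof -
  have "swap_vars i (swap_vars i f - f) = - (swap_vars i f - f)"
    by (rule pseries_eqI) (simp add: multiset.map_comp)
  note * = divdiff_eq[OF this]
  show ?thesis unfolding divided_diff_def
  proof (rule the_equality, rule *)
    fix g assume "(pvar i - pvar (Suc i)) * g = swap_vars i f - f"
    then have "(pvar i - pvar (Suc i)) * (g - divdiff i (swap_vars i f - f)) = 0"
      using * by (simp add: right_diff_distrib)
    then show "g = divdiff i (swap_vars i f - f)"
      using vandermonde_factor_cancel by fastforce
  qed
qed

text \<open>At t = 1 the prefactor t x_i - x_{i+1} becomes the denominator of the divided
  difference, which leaves f' + (K f' - f') with K the exchange of the two variables.\<close>

lemma pspec1_hecke_T:
  assumes "pspec1 f f'" shows "pspec1 (hecke_T i f) (swap_vars i f')"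
proof -
  let ?d = "divdiff i (swap_vars i f - f)" and ?d' = "divdiff i (swap_vars i f' - f')"
  have h: "pspec1 (swap_vars i f - f) (swap_vars i f' - f')"
    by (intro pspec1_diff pspec1_swap_vars assms)
  then have d: "pspec1 ?d ?d'"
    unfolding pspec1_def divdiff.rep_eq by (intro allI spec1_sum) blast
  have "swap_vars i (swap_vars i f' - f') = - (swap_vars i f' - f')"
    by (rule pseries_eqI) (simp add: multiset.map_comp)
  then have eq: "(pvar i - pvar (Suc i)) * ?d' = swap_vars i f' - f'" by (rule divdiff_eq)
  have "pspec1 (hecke_T i f) (pscale 1 f' + (pscale 1 (pvar i) - pvar (Suc i)) * ?d')"
    unfolding hecke_T_def divided_diff_eq
    by (intro pspec1_add pspec1_mult pspec1_diff pspec1_scale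
        spec1_tv pspec1_pvar assms d)
  also have "pscale 1 f' + (pscale 1 (pvar i) - pvar (Suc i)) * ?d' = swap_vars i f'"
    by (simp add: eq)
  finally show ?thesis .
qed

definition poly_in :: "nat \<Rightarrow> nat \<Rightarrow> 'a::comm_ring_1 pseries \<Rightarrow> bool" where
  "poly_in m d f \<longleftrightarrow> (\<forall>M. pcoeff f M \<noteq> 0 \<longrightarrow> set_mset M \<subseteq> {..<m} \<and> size M \<le> d)"

lemma poly_in_add: "poly_in m d f \<Longrightarrow> poly_in m d g \<Longrightarrow> poly_in m d (f + g)"
  unfolding poly_in_def pcoeff_add by (metis add_0)

lemma poly_in_diff: "poly_in m d f \<Longrightarrow> poly_in m d g \<Longrightarrow> poly_in m d (f - g)"
  unfolding poly_in_def pcoeff_diff by (metis diff_0_right)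

lemma poly_in_scale: "poly_in m d f \<Longrightarrow> poly_in m d (pscale c f)"
  unfolding poly_in_def pcoeff_scale by (metis mult_zero_right)

lemma poly_in_xpow: "poly_in (length a) (sum_list a) (xpow a)"
  using set_expo[of a] by (auto simp: poly_in_def xpow_eq_pmono pcoeff_pmono size_expo split: if_splits)

lemma poly_in_pvar_mult:
  assumes "poly_in m d f" "i < m" shows "poly_in m (Suc d) (pvar i * f)"
  unfolding poly_in_def
proof (intro allI impI)
  fix M assume "pcoeff (pvar i * f) M \<noteq> 0"
  then have i: "i \<in># M" and "pcoeff f (M - {#i#}) \<noteq> 0" by (auto simp: pcoeff_pvar_mult split: if_splits)
  then have "set_mset (M - {#i#}) \<subseteq> {..<m}" "size (M - {#i#}) \<le> d" using assms(1) by (auto simp: poly_in_def)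
  moreover have "M = add_mset i (M - {#i#})" using i by simp
  ultimately show "set_mset M \<subseteq> {..<m} \<and> size M \<le> Suc d"
    using \<open>i < m\<close> by (metis insert_subset lessThan_iff set_mset_add_mset_insert size_add_mset Suc_le_mono)
qed

lemma poly_in_swap_vars:
  assumes "poly_in m d f" "Suc i < m" shows "poly_in m d (swap_vars i f)"
  unfolding poly_in_def
proof (intro allI impI)
  fix M assume "pcoeff (swap_vars i f) M \<noteq> 0"
  then have "set_mset (image_mset (transpose i (Suc i)) M) \<subseteq> {..<m} \<and>
      size (image_mset (transpose i (Suc i)) M) \<le> d"
    using assms(1) unfolding poly_in_def pcoeff_swap_vars by blast
  then have *: "transpose i (Suc i) ` set_mset M \<subseteq> {..<m}" "size M \<le> d" by simp_all
  have "x < m" if "x \<in># M" for x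
    using * that assms(2) by (auto simp: transpose_def image_subset_iff split: if_splits dest!: bspec[of _ _ x])
  with * show "set_mset M \<subseteq> {..<m} \<and> size M \<le> d" by auto
qed

text \<open>The divided difference lowers the degree by one and the linear prefactor restores it. In
  degree 0 the divided difference is zero.\<close>

lemma poly_in_hecke_T:
  assumes "poly_in m d f" "Suc i < m" shows "poly_in m d (hecke_T i f)"
proof -
  let ?h = "swap_vars i f - f"
  have h: "poly_in m d ?h" by (intro poly_in_diff poly_in_swap_vars assms)
  have D: "set_mset N \<subseteq> {..<m} \<and> Suc (size N) \<le> d" if "pcoeff (divdiff i ?h) N \<noteq> 0" for N
  proof -
    obtain k where k: "k \<le> count N (Suc i)"
      "pcoeff ?h (N - replicate_mset k (Suc i) + replicate_mset (Suc k) i) \<noteq> 0"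
      using \<open>pcoeff (divdiff i ?h) N \<noteq> 0\<close> unfolding divdiff.rep_eq by (meson atMost_iff sum.not_neutral_contains_not_neutral)
    let ?M = "N - replicate_mset k (Suc i) + replicate_mset (Suc k) i"
    have M: "set_mset ?M \<subseteq> {..<m}" "size ?M \<le> d" using h k(2) unfolding poly_in_def by blast+
    have sub: "replicate_mset k (Suc i) \<subseteq># N" using k(1) by (simp add: count_le_replicate_mset_subset_eq)
    then have eq: "?M + replicate_mset k (Suc i) = N + replicate_mset (Suc k) i"
      using k(1) by (simp add: multiset_eq_iff)
    have "set_mset N \<subseteq> set_mset ?M \<union> {Suc i}"
    proof
      fix x assume "x \<in># N"
      then have "x \<in># ?M + replicate_mset k (Suc i)" unfolding eq by simp
      then show "x \<in> set_mset ?M \<union> {Suc i}" by (auto split: if_splits)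
    qed
    moreover have "size N + Suc k = size ?M + k" using arg_cong[OF eq, of size] by simp
    ultimately have "set_mset N \<subseteq> set_mset ?M \<union> {Suc i}" "Suc (size N) = size ?M" by auto
    then show ?thesis using M assms(2) by auto
  qed
  show ?thesis
  proof (cases d)
    case 0
    then have "divdiff i ?h = 0" using D by (intro pseries_eqI) fastforce
    then show ?thesis using assms by (simp add: hecke_T_def divided_diff_eq poly_in_scale)
  next
    case (Suc d')
    then have "poly_in m d' (divdiff i ?h)" using D by (auto simp: poly_in_def)
    then have "poly_in m d (pscale tv (pvar i * divdiff i ?h) - pvar (Suc i) * divdiff i ?h)"
      unfolding Suc using assms(2) by (intro poly_in_diff poly_in_scale poly_in_pvar_mult) auto
    then show ?thesis unfolding hecke_T_def divided_diff_eq left_diff_distrib pscale_mult_left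
      by (intro poly_in_add poly_in_scale assms)
  qed
qed

abbreviation swap_at :: "'b list \<Rightarrow> nat \<Rightarrow> 'b list" where
  "swap_at a i \<equiv> a[i := a ! Suc i, Suc i := a ! i]"

text \<open>Induction on the termination measure of \<open>hecke_extend\<close>. The premise
  \<open>step\<close> is for an arbitrary ascent, so that applications do not see which ascent the
  recursion picks.\<close>

lemma hecke_extend_invariant:
  assumes dom: "\<And>a. length a = m \<Longrightarrow> (\<And>i. \<not> ascent a i) \<Longrightarrow> Q a (f a)"
    and step: "\<And>a i g. length a = m \<Longrightarrow> ascent a i \<Longrightarrow> Q (swap_at a i) g \<Longrightarrow> Q a (hecke_T i g)"
    and "length a = m"
  shows "Q a (hecke_extend f a)"
  using assms(3)
proof (induction "\<Sum>j<length a. j * a ! j" arbitrary: a rule: less_induct)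
  case less
  show ?case
  proof (cases "\<exists>i. ascent a i")
    case True
    define i where "i = (LEAST i. ascent a i)"
    have i: "ascent a i" unfolding i_def using True by (rule LeastI_ex)
    have "Q (swap_at a i) (hecke_extend f (swap_at a i))"
      using weight_swap_less[OF i] less by (intro less(1)) simp_all
    then have "Q a (hecke_T i (hecke_extend f (swap_at a i)))" using step i less by blast
    then show ?thesis using True by (subst hecke_extend.simps) (simp add: i_def Let_def)
  next
    case False
    then have "hecke_extend f a = f a" by (subst hecke_extend.simps, subst if_not_P) auto
    then show ?thesis using False dom less by simp
  qed
qed

text \<open>At t = 1 the recursion says that adjacent swaps of entries act as swaps of variables. A
  family C with this equivariance that is correct on dominant compositions is therefore the
  specialization.\<close>

lemma pspec1_hecke_extend:
  assumes "\<And>a. length a = m \<Longrightarrow> (\<And>i. \<not> ascent a i) \<Longrightarrow> pspec1 (f a) (C a)"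
    and "\<And>a i. length a = m \<Longrightarrow> ascent a i \<Longrightarrow> swap_vars i (C (swap_at a i)) = C a"
    and "length a = m"
  shows "pspec1 (hecke_extend f a) (C a)"
proof (rule hecke_extend_invariant[where Q = "\<lambda>a g. pspec1 g (C a)", OF assms(1) _ assms(3)])
  fix a i g assume "length a = m" "ascent a i" "pspec1 g (C (swap_at a i))"
  then show "pspec1 (hecke_T i g) (C a)"
    using pspec1_hecke_T[of g "C (swap_at a i)" i] assms(2) by simp
qed auto

lemma expo_swap_at:
  assumes "Suc i < length a"
  shows "image_mset (transpose i (Suc i)) (expo (swap_at a i)) = expo a"
proof (rule multiset_eqI)
  fix x
  let ?\<tau> = "transpose i (Suc i)"
  have "count (image_mset ?\<tau> N) x = count N (?\<tau> x)" for N
    by (induction N) (auto simp: transpose_def)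
  then show "count (image_mset ?\<tau> (expo (swap_at a i))) x = count (expo a) x"
    using assms by (auto simp: count_expo transpose_def nth_list_update)
qed

lemma swap_vars_xpow:
  "Suc i < length a \<Longrightarrow> swap_vars i (xpow (swap_at a i)) = xpow a"
  by (simp add: xpow_eq_pmono swap_vars_eq permute_vars_pmono expo_swap_at)

lemma pspec1_hecke_xpow: "pspec1 (hecke_extend xpow a) (xpow a)"
  by (rule pspec1_hecke_extend[OF _ _ refl]) (auto simp: ascent_def swap_vars_xpow)

lemma poly_in_hecke_xpow: "poly_in (length a) (sum_list a) (hecke_extend xpow a)"
proof (rule hecke_extend_invariant[where Q = "\<lambda>b g. poly_in (length a) (sum_list b) g", OF _ _ refl])
  fix b i and g :: "Qqt pseries" assume *: "length b = length a" "ascent b i" "poly_in (length a) (sum_list (swap_at b i)) g"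
  have "sum_list (swap_at b i) = sum_list b"
    using * by (metis ascent_def mset_swap sum_mset_sum_list Suc_lessD)
  then show "poly_in (length a) (sum_list b) (hecke_T i g)"
    using * by (intro poly_in_hecke_T) (auto simp: ascent_def)
qed (use poly_in_xpow in metis)

section \<open>Leading monomials\<close>

definition mult_type :: "nat multiset \<Rightarrow> nat multiset" where
  "mult_type B = image_mset (count B) (mset_set (set_mset B))"

lemma count_mult_type: "count (mult_type B) r = card {i \<in> set_mset B. count B i = r}"
proof -
  have "count (image_mset (count B) (mset_set S)) r = card {i \<in> S. count B i = r}" if "finite S" for S
  proof -
    have "count (image_mset (count B) (mset_set S)) r = size (filter_mset (\<lambda>i. count B i = r) (mset_set S))"
      by (metis (mono_tags, lifting) count_conv_size_mset filter_mset_image_mset size_image_mset filter_mset_cong)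
    also have "\<dots> = card {i \<in> S. count B i = r}" using that by (simp add: filter_mset_mset_set)
    finally show ?thesis .
  qed
  then show ?thesis by (simp add: mult_type_def)
qed

lemma pcoeff_powersum_mult:
  assumes "r > 0"
  shows "pcoeff (powersum r * f) B
    = (\<Sum>i | i \<in># B \<and> r \<le> count B i. pcoeff f (B - replicate_mset r i))"
proof -
  have inj: "replicate_mset r i = replicate_mset r j \<longleftrightarrow> i = j" for i j :: nat
    using assms by (metis in_replicate_mset less_irrefl)
  have "pcoeff (powersum r * f) B
      = (\<Sum>(A, C) | A + C = B \<and> (\<exists>i. A = replicate_mset r i). pcoeff f C)"
    unfolding pcoeff_mult powersum.rep_eq
    by (rule sum.mono_neutral_cong_right) (auto simp: finite_splittings split: if_splits)
  also have "\<dots> = (\<Sum>i | i \<in># B \<and> r \<le> count B i. pcoeff f (B - replicate_mset r i))"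
  proof (rule sum.reindex_bij_betw[of "\<lambda>i. (replicate_mset r i, B - replicate_mset r i)", THEN trans[rotated], symmetric])
    show "bij_betw (\<lambda>i. (replicate_mset r i, B - replicate_mset r i)) {i. i \<in># B \<and> r \<le> count B i}
        {(A, C). A + C = B \<and> (\<exists>i. A = replicate_mset r i)}"
      unfolding bij_betw_def
    proof
      show "inj_on (\<lambda>i. (replicate_mset r i, B - replicate_mset r i)) {i. i \<in># B \<and> r \<le> count B i}"
        by (auto simp: inj_on_def inj)
      have "i \<in># B" if "r \<le> count B i" for i
        using that assms by (metis count_greater_zero_iff less_le_trans)
      then show "(\<lambda>i. (replicate_mset r i, B - replicate_mset r i)) ` {i. i \<in># B \<and> r \<le> count B i}
          = {(A, C). A + C = B \<and> (\<exists>i. A = replicate_mset r i)}"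
        by (auto simp: image_iff count_le_replicate_mset_subset_eq subset_mset.add_diff_inverse)
    qed
  qed simp
  finally show ?thesis .
qed

text \<open>Every factor contributes a power of one variable, so a monomial of the product has at
  most as many variables as there are factors.\<close>

lemma card_le_if_powersum_part:
  "0 \<notin># l \<Longrightarrow> pcoeff (powersum_part l :: 'a::comm_ring_1 pseries) B \<noteq> 0 \<Longrightarrow> card (set_mset B) \<le> size l"
proof (induction l arbitrary: B)
  case empty
  then show ?case by (auto simp: powersum_part_def pcoeff_1 split: if_splits)
next
  case (add r l)
  then have "r > 0" by auto
  have "pcoeff (powersum r * powersum_part l :: 'a pseries) B \<noteq> 0" using add.prems(2) by (simp add: powersum_part_def)
  then obtain i where i: "pcoeff (powersum_part l :: 'a pseries) (B - replicate_mset r i) \<noteq> 0"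
    unfolding pcoeff_powersum_mult[OF \<open>r > 0\<close>] by (meson sum.not_neutral_contains_not_neutral)
  have "set_mset B \<subseteq> insert i (set_mset (B - replicate_mset r i))"
  proof
    fix x assume "x \<in># B"
    then show "x \<in> insert i (set_mset (B - replicate_mset r i))"
      by (cases "x = i") (auto simp: in_diff_count)
  qed
  then have "card (set_mset B) \<le> card (insert i (set_mset (B - replicate_mset r i)))"
    by (intro card_mono) auto
  also have "\<dots> \<le> Suc (card (set_mset (B - replicate_mset r i)))"
    by (simp add: card_insert_if)
  also have "\<dots> \<le> Suc (size l)" using add i by auto
  finally show ?case by simp
qed

text \<open>The coefficient of m_l in p_l: the number of ways to distribute equal parts over the
  variables that carry them.\<close>

definition mult_fact :: "nat multiset \<Rightarrow> nat" where
  "mult_fact l = (\<Prod>r\<in>set_mset l. fact (count l r))"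

lemma mult_fact_add_mset: "mult_fact (add_mset r l) = Suc (count l r) * mult_fact l"
proof -
  have "mult_fact (add_mset r l)
      = (\<Prod>x\<in>insert r (set_mset l). if x = r then fact (Suc (count l r)) else fact (count l x))"
    unfolding mult_fact_def by (rule prod.cong) auto
  also have "\<dots> = fact (Suc (count l r)) * (\<Prod>x\<in>set_mset l - {r}. fact (count l x))"
    by (subst prod.insert_remove) (auto intro!: prod.cong)
  also have "\<dots> = Suc (count l r) * (fact (count l r) * (\<Prod>x\<in>set_mset l - {r}. fact (count l x)))"
    by (simp add: algebra_simps)
  also have "fact (count l r) * (\<Prod>x\<in>set_mset l - {r}. fact (count l x)) = mult_fact l"
    unfolding mult_fact_def
    by (cases "r \<in># l") (auto simp: prod.remove[of "set_mset l" r] not_in_iff)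
  finally show ?thesis .
qed

lemma mult_fact_pos: "mult_fact l > 0"
  by (simp add: mult_fact_def prod_pos)

text \<open>With as many variables as factors, no two factors share a variable, so the exponents are
  the parts. The variable for a part r can be chosen in as many ways as r occurs, which is the
  recursion \<open>mult_fact_add_mset\<close>.\<close>

lemma pcoeff_powersum_part_top:
  "0 \<notin># l \<Longrightarrow> card (set_mset B) = size l \<Longrightarrow>
    pcoeff (powersum_part l :: 'a::comm_ring_1 pseries) B = (if mult_type B = l then of_nat (mult_fact l) else 0)"
proof (induction l arbitrary: B)
  case empty
  then show ?case by (simp add: powersum_part_def pcoeff_1 mult_type_def mult_fact_def)
next
  case (add r l)
  then have "r > 0" by auto
  let ?S = "{i \<in> set_mset B. count B i = r}"
  \<comment> \<open>If x_i survives the removal of x_i^r, too many variables remain for the factors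
    in l.\<close>
  have zero: "pcoeff (powersum_part l :: 'a pseries) (B - replicate_mset r i) = 0" if "i \<in># B" "count B i > r" for i
  proof -
    have "set_mset (B - replicate_mset r i) = set_mset B"
      using that by (auto simp: in_diff_count dest: in_diffD split: if_splits)
    then show ?thesis using card_le_if_powersum_part[of l "B - replicate_mset r i", where 'a = 'a] add.prems by fastforce
  qed
  have eq: "pcoeff (powersum_part l :: 'a pseries) (B - replicate_mset r i)
      = (if mult_type B = add_mset r l then of_nat (mult_fact l) else 0)" if "i \<in> ?S" for i
  proof -
    have s: "set_mset (B - replicate_mset r i) = set_mset B - {i}"
      using that by (auto simp: in_diff_count dest: in_diffD split: if_splits)
    have "mult_type (B - replicate_mset r i) = image_mset (count B) (mset_set (set_mset B - {i}))"
      unfolding mult_type_def s by (rule image_mset_cong) (auto split: if_splits)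
    then have t: "mult_type B = add_mset r (mult_type (B - replicate_mset r i))"
      using that unfolding mult_type_def
      by (subst (asm) mset_set_Diff) (auto simp: mset_set.remove[of _ i])
    have "card (set_mset (B - replicate_mset r i)) = size l"
      unfolding s using that add.prems by simp
    then have "pcoeff (powersum_part l :: 'a pseries) (B - replicate_mset r i)
        = (if mult_type (B - replicate_mset r i) = l then of_nat (mult_fact l) else 0)"
      using add by simp
    then show ?thesis unfolding t by simp
  qed
  have "pcoeff (powersum_part (add_mset r l) :: 'a pseries) B
      = (\<Sum>i | i \<in># B \<and> r \<le> count B i. pcoeff (powersum_part l :: 'a pseries) (B - replicate_mset r i))"
    using pcoeff_powersum_mult[OF \<open>r > 0\<close>] by (simp add: powersum_part_def)
  also have "\<dots> = (\<Sum>i\<in>?S. pcoeff (powersum_part l :: 'a pseries) (B - replicate_mset r i))"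
    by (rule sum.mono_neutral_right) (use zero in \<open>auto simp: le_less\<close>)
  also have "\<dots> = (\<Sum>i\<in>?S. if mult_type B = add_mset r l then of_nat (mult_fact l) else 0)"
    by (rule sum.cong[OF refl eq])
  also have "\<dots> = (if mult_type B = add_mset r l then of_nat (card ?S * mult_fact l) else 0)"
    by simp
  also have "\<dots> = (if mult_type B = add_mset r l then of_nat (mult_fact (add_mset r l)) else 0)"
    using count_mult_type[of B r] mult_fact_add_mset[of r l] by (metis count_add_mset)
  finally show ?case .
qed

text \<open>One monomial of m_l in the variables from m on. Sorting only fixes a choice.\<close>

definition tail_mono :: "nat \<Rightarrow> nat multiset \<Rightarrow> nat multiset" where
  "tail_mono m l = (\<Sum>j<size l. replicate_mset (sorted_list_of_multiset l ! j) (m + j))"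

lemma length_sorted_list_of_multiset: "length (sorted_list_of_multiset l) = size l"
  by (metis mset_sorted_list_of_multiset size_mset)

lemma count_tail_mono:
  "count (tail_mono m l) i
    = (if m \<le> i \<and> i < m + size l then sorted_list_of_multiset l ! (i - m) else 0)"
proof -
  have "count (tail_mono m l) i
      = (\<Sum>j<size l. if j = i - m \<and> m \<le> i then sorted_list_of_multiset l ! j else 0)"
    unfolding tail_mono_def count_sum by (rule sum.cong) auto
  also have "\<dots> = (if m \<le> i \<and> i < m + size l then sorted_list_of_multiset l ! (i - m) else 0)"
    by (cases "m \<le> i") (auto simp: sum.delta)
  finally show ?thesis .
qed

lemma set_tail_mono: assumes "0 \<notin># l" shows "set_mset (tail_mono m l) = {m..<m + size l}"
proof -
  have "sorted_list_of_multiset l ! j \<noteq> 0" if "j < size l" for j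
    using assms that by (metis length_sorted_list_of_multiset nth_mem set_sorted_list_of_multiset)
  then show ?thesis
    by (auto simp: count_tail_mono simp flip: count_greater_zero_iff split: if_splits)
qed

lemma mult_type_tail_mono: assumes "0 \<notin># l" shows "mult_type (tail_mono m l) = l"
proof -
  let ?s = "sorted_list_of_multiset l"
  have "mult_type (tail_mono m l) = image_mset (\<lambda>i. ?s ! (i - m)) (mset_set {m..<m + size l})"
    unfolding mult_type_def set_tail_mono[OF assms]
    by (rule image_mset_cong) (auto simp: count_tail_mono)
  also have "mset_set {m..<m + size l} = image_mset (\<lambda>j. m + j) (mset_set {0..<size l})"
    by (subst image_mset_mset_set) (auto simp: inj_on_def add.commute)
  also have "image_mset (\<lambda>i. ?s ! (i - m)) \<dots> = mset (map ((!) ?s) [0..<length ?s])"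
    by (simp add: multiset.map_comp comp_def length_sorted_list_of_multiset flip: mset_upt)
  also have "\<dots> = l" by (simp only: map_nth mset_sorted_list_of_multiset)
  finally show ?thesis .
qed

text \<open>A monomial that occurs in m_\<Lambda> with coefficient 1 and in no other m_\<Omega>; its
  coefficient reads off coordinates in the basis of monomials.\<close>

definition lead :: "mpart \<Rightarrow> nat multiset" where
  "lead \<Lambda> = expo (fst \<Lambda>) + tail_mono (length (fst \<Lambda>)) (snd \<Lambda>)"

text \<open>H involves only the first m variables, so the variables of the tail come from the power
  sums. There are \<open>size \<mu>\<close> of them, which by \<open>le\<close> already exhausts the
  factors in l; nothing is left for the first m variables, whose exponents are thus due to H
  alone.\<close>

lemma pcoeff_lead:
  fixes H :: "'a::comm_ring_1 pseries"
  assumes H: "poly_in m d H" and "0 \<notin># l" and "(b, \<mu>) \<in> mparts m" and le: "size l \<le> size \<mu>"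
  shows "pcoeff (H * powersum_part l) (lead (b, \<mu>))
    = (if l = \<mu> then of_nat (mult_fact \<mu>) * pcoeff H (expo b) else 0)"
proof -
  let ?T = "tail_mono m \<mu>"
  have b: "length b = m" and \<mu>: "0 \<notin># \<mu>" using assms(3) by (auto simp: mparts_def)
  have split: "A = expo b \<and> B = ?T"
    if AB: "A + B = expo b + ?T" and nz: "pcoeff H A * pcoeff (powersum_part l) B \<noteq> 0" for A B
  proof -
    have A: "set_mset A \<subseteq> {..<m}" using H mult_not_zero[OF nz] unfolding poly_in_def by blast
    have c: "card (set_mset B) \<le> size \<mu>"
      using card_le_if_powersum_part[OF assms(2), of B, where 'a = 'a] nz le by fastforce
    have cnt: "count A x + count B x = count (expo b) x + count ?T x" for x
      using AB by (metis count_union)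
    have Bm: "count B x = count ?T x" if "x \<ge> m" for x
    proof -
      have "count A x = 0" using A that by (metis lessThan_iff not_in_iff not_less subsetD)
      then show ?thesis using cnt[of x] that b by (simp add: count_expo)
    qed
    \<comment> \<open>From m on, B has the exponents of the tail, so it contains all
      \<open>size \<mu>\<close> variables of the tail; by the bound \<open>c\<close> it contains no
      others.\<close>
    have sub: "set_mset ?T \<subseteq> set_mset B"
    proof
      fix x assume x: "x \<in># ?T"
      then have "x \<ge> m" using set_tail_mono[OF \<mu>] by auto
      then show "x \<in># B" using Bm[of x] x by (metis count_greater_zero_iff)
    qed
    have "card (set_mset ?T) = size \<mu>" by (simp add: set_tail_mono[OF \<mu>])
    with c card_mono[OF finite_set_mset sub] have sB: "set_mset ?T = set_mset B"
      by (intro card_subset_eq sub) auto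
    have "count B x = count ?T x" for x
    proof (cases "x \<ge> m")
      case False
      then have "x \<notin># ?T" by (simp add: set_tail_mono[OF \<mu>])
      then show ?thesis using sB by (metis not_in_iff)
    qed (rule Bm)
    then have "B = ?T" by (rule multiset_eqI)
    with AB show ?thesis by simp
  qed
  have "pcoeff (H * powersum_part l) (lead (b, \<mu>))
      = (\<Sum>(A, B)\<in>{(expo b, ?T)}. pcoeff H A * pcoeff (powersum_part l) B)"
    unfolding pcoeff_mult lead_def
    by (rule sum.mono_neutral_right) (use split b in \<open>auto simp: finite_splittings\<close>)
  also have "\<dots> = pcoeff H (expo b) * pcoeff (powersum_part l) ?T" by simp
  also have "pcoeff (powersum_part l) ?T = (if l = \<mu> then of_nat (mult_fact \<mu>) else (0 :: 'a))"
  proof (cases "size l = size \<mu>")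
    case True
    then show ?thesis using pcoeff_powersum_part_top[OF assms(2), of ?T, where 'a = 'a]
      by (auto simp: set_tail_mono[OF \<mu>] mult_type_tail_mono[OF \<mu>])
  next
    case False
    then have "pcoeff (powersum_part l :: 'a pseries) ?T = 0"
      using card_le_if_powersum_part[OF assms(2), of ?T, where 'a = 'a] le by (fastforce simp: set_tail_mono[OF \<mu>])
    then show ?thesis using False by auto
  qed
  finally show ?thesis by (simp add: mult.commute)
qed

lemma pcoeff_lead_sum:
  assumes H: "\<And>a. length a = m \<Longrightarrow> \<exists>d. poly_in m d (H a)"
    and "finite I" "I \<subseteq> mparts m" "(b, \<mu>) \<in> mparts m"
    and top: "\<And>E. E \<in> I \<Longrightarrow> c E \<noteq> 0 \<Longrightarrow> size (snd E) \<le> size \<mu>"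
  shows "pcoeff (\<Sum>E\<in>I. pscale (c E) (H (fst E) * powersum_part (snd E))) (lead (b, \<mu>))
    = of_nat (mult_fact \<mu>) * (\<Sum>E | E \<in> I \<and> snd E = \<mu>. c E * pcoeff (H (fst E)) (expo b))"
proof -
  have "c E * pcoeff (H (fst E) * powersum_part (snd E)) (lead (b, \<mu>))
      = (if snd E = \<mu> then of_nat (mult_fact \<mu>) * (c E * pcoeff (H (fst E)) (expo b)) else 0)"
    if "E \<in> I" for E
  proof (cases "c E = 0")
    case False
    have "length (fst E) = m" "0 \<notin># snd E" using that assms(3) by (auto simp: mparts_def)
    then obtain d where "poly_in m d (H (fst E))" using H by blast
    from pcoeff_lead[OF this \<open>0 \<notin># snd E\<close> assms(4) top[OF that False]] show ?thesis by simp
  qed simp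
  then have "pcoeff (\<Sum>E\<in>I. pscale (c E) (H (fst E) * powersum_part (snd E))) (lead (b, \<mu>))
      = (\<Sum>E\<in>I. if snd E = \<mu> then of_nat (mult_fact \<mu>) * (c E * pcoeff (H (fst E)) (expo b)) else 0)"
    by simp
  then show ?thesis by (subst sum_distrib_left, subst sum.inter_filter[OF assms(2)])
qed

text \<open>A trailing 1 in a name marks the specialization at t = 1.\<close>

definition mpowersum1 :: "mpart \<Rightarrow> Qq pseries" where
  "mpowersum1 \<Lambda> = xpow (fst \<Lambda>) * powersum_part (snd \<Lambda>)"

lemma pspec1_mpowersum: "pspec1 (mpowersum \<Lambda>) (mpowersum1 \<Lambda>)"
  unfolding mpowersum_def mpowersum1_def
  by (intro pspec1_mult pspec1_hecke_xpow pspec1_powersum_part)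

text \<open>Among the terms with nonzero coefficient, take one with the most parts. Its leading
  monomial occurs in no other term of the relation.\<close>

lemma mpowersum1_independent:
  assumes "finite I" "I \<subseteq> mparts m" and z: "(\<Sum>E\<in>I. pscale (c E) (mpowersum1 E)) = 0"
  shows "\<forall>E\<in>I. c E = 0"
proof (rule ccontr)
  assume nonzero: "\<not> (\<forall>E\<in>I. c E = 0)"
  define J where "J = {E \<in> I. c E \<noteq> 0}"
  have J: "finite J" "J \<noteq> {}" using nonzero assms(1) by (auto simp: J_def)
  define k where "k = Max ((\<lambda>E. size (snd E)) ` J)"
  have "k \<in> (\<lambda>E. size (snd E)) ` J" unfolding k_def using J by (intro Max_in) auto
  then obtain b \<mu> where \<Lambda>: "(b, \<mu>) \<in> J" "size \<mu> = k" by auto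
  have top: "size (snd E) \<le> size \<mu>" if "E \<in> I" "c E \<noteq> 0" for E
    unfolding \<Lambda>(2) k_def using that J by (intro Max_ge) (auto simp: J_def)
  have b: "(b, \<mu>) \<in> mparts m" "length b = m" using \<Lambda> assms(2) by (auto simp: J_def mparts_def)
  have eq: "pcoeff (\<Sum>E\<in>I. pscale (c E) (xpow (fst E) * powersum_part (snd E))) (lead (b, \<mu>))
      = of_nat (mult_fact \<mu>) * (\<Sum>E | E \<in> I \<and> snd E = \<mu>. c E * pcoeff (xpow (fst E)) (expo b))"
  proof (rule pcoeff_lead_sum[OF _ assms(1,2) b(1) top])
    show "\<exists>d. poly_in m d (xpow a :: Qq pseries)" if "length a = m" for a
      using poly_in_xpow[of a] that by auto
  qed
  have "0 = of_nat (mult_fact \<mu>) * (\<Sum>E | E \<in> I \<and> snd E = \<mu>. c E * pcoeff (xpow (fst E)) (expo b))"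
    using eq unfolding z[unfolded mpowersum1_def] by (simp only: pcoeff_0)
  then have "0 = (\<Sum>E | E \<in> I \<and> snd E = \<mu>. c E * pcoeff (xpow (fst E)) (expo b))"
    using mult_fact_pos[of \<mu>] by simp
  also have "\<dots> = (\<Sum>E\<in>{(b, \<mu>)}. c E * pcoeff (xpow (fst E)) (expo b))"
    by (rule sum.mono_neutral_right)
      (use assms(1,2) \<Lambda> b in \<open>auto simp: J_def xpow_eq_pmono pcoeff_pmono expo_inject mparts_def\<close>)
  also have "\<dots> = c (b, \<mu>)" by (simp add: xpow_eq_pmono pcoeff_pmono)
  finally show False using \<Lambda> by (simp add: J_def)
qed

section \<open>Monomial functions and their leading monomials\<close>

definition mmonomial1 :: "mpart \<Rightarrow> Qq pseries" where
  "mmonomial1 \<Lambda> = xpow (fst \<Lambda>) * monomial_part (length (fst \<Lambda>)) (snd \<Lambda>)"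

lemma pspec1_mmonomial: "pspec1 (mmonomial \<Lambda>) (mmonomial1 \<Lambda>)"
proof -
  have "pspec1 (monomial_part m l) (monomial_part m l)" for m l
    by (simp add: pspec1_def monomial_part.rep_eq)
  then show ?thesis unfolding mmonomial_def mmonomial1_def by (intro pspec1_mult) simp_all
qed

text \<open>The coefficients at the leading monomials are dual to the monomial functions, over
  Q(q,t) as well as at t = 1. Dividing the monomial by x^a leaves only variables from m on exactly
  if a = b.\<close>

lemma pcoeff_monomial_lead:
  assumes "(a, l) \<in> mparts m" "(b, \<mu>) \<in> mparts m"
  shows "pcoeff (xpow a * monomial_part m l) (lead (b, \<mu>)) = (if (a, l) = (b, \<mu>) then 1 else 0)"
proof -
  let ?T = "tail_mono m \<mu>"
  have ab: "length a = m" "length b = m" and \<mu>: "0 \<notin># \<mu>" using assms by (auto simp: mparts_def)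
  have lead: "lead (b, \<mu>) = expo b + ?T" using ab by (simp add: lead_def)
  have "set_mset (expo b + ?T - expo a) \<subseteq> {m..} \<longleftrightarrow> a = b" if sub: "expo a \<subseteq># expo b + ?T"
  proof
    assume "a = b"
    then show "set_mset (expo b + ?T - expo a) \<subseteq> {m..}" using set_tail_mono[OF \<mu>] by auto
  next
    assume s: "set_mset (expo b + ?T - expo a) \<subseteq> {m..}"
    show "a = b"
    proof (rule nth_equalityI)
      fix i assume i: "i < length a"
      then have "i \<notin># expo b + ?T - expo a" using s ab by fastforce
      then have "count (expo b + ?T) i - count (expo a) i = 0" by (metis count_diff not_in_iff)
      moreover have "count (expo a) i \<le> count (expo b + ?T) i" using sub by (rule mset_subset_eq_count)
      ultimately show "a ! i = b ! i" using i ab by (simp add: count_expo count_tail_mono)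
    qed (use ab in simp)
  qed
  moreover have "mult_type ?T = \<mu>" by (rule mult_type_tail_mono[OF \<mu>])
  moreover have "set_mset ?T \<subseteq> {m..}" by (auto simp: set_tail_mono[OF \<mu>])
  ultimately show ?thesis unfolding lead xpow_eq_pmono pcoeff_pmono_mult
    by (auto simp: monomial_part.rep_eq mult_type_def)
qed

lemma pcoeff_mmonomial_lead:
  "\<Lambda> \<in> mparts m \<Longrightarrow> \<Omega> \<in> mparts m \<Longrightarrow> pcoeff (mmonomial \<Lambda>) (lead \<Omega>) = (if \<Lambda> = \<Omega> then 1 else 0)"
  using pcoeff_monomial_lead[of "fst \<Lambda>" "snd \<Lambda>" m "fst \<Omega>" "snd \<Omega>", where 'a = Qqt]
  by (auto simp: mmonomial_def mparts_def split: if_splits)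

lemma pcoeff_mmonomial1_lead:
  "\<Lambda> \<in> mparts m \<Longrightarrow> \<Omega> \<in> mparts m \<Longrightarrow> pcoeff (mmonomial1 \<Lambda>) (lead \<Omega>) = (if \<Lambda> = \<Omega> then 1 else 0)"
  using pcoeff_monomial_lead[of "fst \<Lambda>" "snd \<Lambda>" m "fst \<Omega>" "snd \<Omega>", where 'a = Qq]
  by (auto simp: mmonomial1_def mparts_def split: if_splits)

lemma mmonomial1_coeff:
  assumes "finite I" "I \<subseteq> mparts m" "\<Lambda> \<in> I"
  shows "pcoeff (\<Sum>E\<in>I. pscale (c E) (mmonomial1 E)) (lead \<Lambda>) = c \<Lambda>"
proof -
  have "pcoeff (\<Sum>E\<in>I. pscale (c E) (mmonomial1 E)) (lead \<Lambda>)
      = (\<Sum>E\<in>I. if E = \<Lambda> then c E else 0)"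
    unfolding pcoeff_sum pcoeff_scale
  proof (rule sum.cong[OF refl])
    fix E assume "E \<in> I"
    then have "E \<in> mparts m" "\<Lambda> \<in> mparts m" using assms by auto
    then show "c E * pcoeff (mmonomial1 E) (lead \<Lambda>) = (if E = \<Lambda> then c E else 0)"
      by (simp add: pcoeff_mmonomial1_lead)
  qed
  then show ?thesis using assms by simp
qed

section \<open>The ring of m-symmetric functions\<close>

lemma permute_vars_fixed_iff:
  assumes "bij \<pi>"
  shows "permute_vars \<pi> f = f \<longleftrightarrow> (\<forall>M. pcoeff f (image_mset \<pi> M) = pcoeff f M)"
proof
  assume "permute_vars \<pi> f = f"
  then show "\<forall>M. pcoeff f (image_mset \<pi> M) = pcoeff f M"
    using pcoeff_permute_vars_image[OF assms, of f] by simp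
next
  assume *: "\<forall>M. pcoeff f (image_mset \<pi> M) = pcoeff f M"
  show "permute_vars \<pi> f = f"
  proof (rule pseries_eqI)
    fix M
    show "pcoeff (permute_vars \<pi> f) M = pcoeff f M"
      unfolding pcoeff_permute_vars
      using *[rule_format, of "image_mset (inv_into UNIV \<pi>) M"] image_mset_inv(1)[OF assms, of M]
      by simp
  qed
qed

lemma Rm_iff:
  "f \<in> Rm m \<longleftrightarrow> (\<exists>d. \<forall>M. pcoeff f M \<noteq> 0 \<longrightarrow> size M \<le> d) \<and>
     (\<forall>\<pi>. \<pi> permutes {m..} \<longrightarrow> permute_vars \<pi> f = f)"
  using permute_vars_fixed_iff[OF permutes_bij] by (auto simp: Rm_def)

lemma Rm_mult: assumes "f \<in> Rm m" "g \<in> Rm m" shows "f * g \<in> Rm m"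
proof -
  obtain d e where d: "\<And>M. pcoeff f M \<noteq> 0 \<Longrightarrow> size M \<le> d" and e: "\<And>M. pcoeff g M \<noteq> 0 \<Longrightarrow> size M \<le> e"
    using assms by (auto simp: Rm_iff)
  have "size M \<le> d + e" if nz: "pcoeff (f * g) M \<noteq> 0" for M
  proof -
    obtain z where "z \<in> {(A, B). A + B = M}" "(case z of (A, B) \<Rightarrow> pcoeff f A * pcoeff g B) \<noteq> 0"
      using nz unfolding pcoeff_mult by (rule sum.not_neutral_contains_not_neutral)
    then obtain A B where AB: "A + B = M" "pcoeff f A * pcoeff g B \<noteq> 0" by auto
    then show ?thesis using d[of A] e[of B] by auto
  qed
  moreover have "permute_vars \<pi> (f * g) = f * g" if "\<pi> permutes {m..}" for \<pi>
    using assms that by (simp add: Rm_iff permute_vars_mult permutes_bij)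
  ultimately show ?thesis unfolding Rm_iff by blast
qed

text \<open>A permutation of the indices from m on fixes the monomials in the first m variables and
  turns no other monomial into one of these.\<close>

lemma Rm_poly_in: assumes "poly_in m d f" shows "f \<in> Rm m"
proof -
  have "pcoeff f (image_mset \<pi> M) = pcoeff f M" if \<pi>: "\<pi> permutes {m..}" for \<pi> M
  proof (cases "set_mset M \<subseteq> {..<m}")
    case True
    then have "image_mset \<pi> M = image_mset id M"
      by (intro image_mset_cong) (use \<pi> in \<open>auto simp: permutes_not_in\<close>)
    then show ?thesis by simp
  next
    case False
    then obtain x where "x \<in># M" "x \<ge> m" by (auto simp: subset_eq not_less)
    then have "\<pi> x \<in># image_mset \<pi> M" "\<pi> x \<ge> m" using permutes_in_image[OF \<pi>, of x] by auto
    then have "\<not> set_mset (image_mset \<pi> M) \<subseteq> {..<m}" by (metis leD lessThan_iff subsetD)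
    then show ?thesis using False assms unfolding poly_in_def by metis
  qed
  then show ?thesis using assms by (auto simp: Rm_def poly_in_def)
qed

lemma powersum_part_in_Rm: "powersum_part l \<in> Rm m"
proof (induction l)
  case empty
  have "poly_in m 0 (1 :: Qqt pseries)" by (auto simp: poly_in_def pcoeff_1)
  then show ?case by (auto simp: powersum_part_def intro: Rm_poly_in)
next
  case (add r l)
  have "powersum r \<in> Rm m"
    by (auto simp: Rm_iff permute_vars_powersum permutes_bij powersum.rep_eq intro!: exI[of _ r])
  then show ?case using add by (simp add: powersum_part_def Rm_mult)
qed

lemma mpowersum_in_Rm: "\<Lambda> \<in> mparts m \<Longrightarrow> mpowersum \<Lambda> \<in> Rm m"
  using Rm_poly_in[OF poly_in_hecke_xpow, of "fst \<Lambda>"]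
  by (auto simp: mpowersum_def mparts_def intro!: Rm_mult powersum_part_in_Rm)

section \<open>The action of permutations on m-partitions\<close>

lemma count_image_mset_bij:
  assumes "bij \<sigma>" shows "count (image_mset \<sigma> N) x = count N (inv_into UNIV \<sigma> x)"
  by (induction N) (use assms in \<open>auto simp: bij_inv_eq_iff\<close>)

lemma length_permute_mpart: "length (fst (permute_mpart \<sigma> \<Lambda>)) = length (fst \<Lambda>)"
  by (simp add: permute_mpart_def)

lemma snd_permute_mpart [simp]: "snd (permute_mpart \<sigma> \<Lambda>) = snd \<Lambda>"
  by (simp add: permute_mpart_def)

lemma permute_mpart_in: "\<Lambda> \<in> mparts m \<Longrightarrow> permute_mpart \<sigma> \<Lambda> \<in> mparts m"
  by (auto simp: mparts_def permute_mpart_def)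

lemma expo_permute_mpart:
  assumes "\<sigma> permutes {..<m}" "length (fst \<Lambda>) = m"
  shows "expo (fst (permute_mpart \<sigma> \<Lambda>)) = image_mset \<sigma> (expo (fst \<Lambda>))"
proof (rule multiset_eqI)
  fix x
  have "inv_into UNIV \<sigma> x < m \<longleftrightarrow> x < m"
    using permutes_in_image[OF permutes_inv[OF assms(1)], of x] by simp
  then show "count (expo (fst (permute_mpart \<sigma> \<Lambda>))) x = count (image_mset \<sigma> (expo (fst \<Lambda>))) x"
    using assms by (simp add: count_image_mset_bij permutes_bij count_expo permute_mpart_def)
qed

text \<open>The tail uses only variables from m on, which \<sigma> fixes.\<close>

lemma lead_permute_mpart:
  assumes "\<sigma> permutes {..<m}" "\<Lambda> \<in> mparts m"
  shows "lead (permute_mpart \<sigma> \<Lambda>) = image_mset \<sigma> (lead \<Lambda>)"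
proof -
  have l: "length (fst \<Lambda>) = m" "0 \<notin># snd \<Lambda>" using assms(2) by (auto simp: mparts_def)
  have "image_mset \<sigma> (tail_mono m (snd \<Lambda>)) = image_mset id (tail_mono m (snd \<Lambda>))"
    by (rule image_mset_cong)
      (use assms(1) l in \<open>auto simp: set_tail_mono permutes_not_in\<close>)
  then show ?thesis
    using expo_permute_mpart[OF assms(1) l(1)] l by (simp add: lead_def length_permute_mpart)
qed

lemma mset_permute_mpart:
  assumes "\<sigma> permutes {..<m}" "length (fst \<Lambda>) = m"
  shows "mset (fst (permute_mpart \<sigma> \<Lambda>)) = mset (fst \<Lambda>)"
proof -
  have "fst (permute_mpart \<sigma> \<Lambda>) = permute_list (inv_into UNIV \<sigma>) (fst \<Lambda>)"
    using assms by (simp add: permute_mpart_def permute_list_def)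
  then show ?thesis using assms permutes_inv[OF assms(1)] by (metis mset_permute_list)
qed

lemma bij_permute_mpart:
  assumes "\<sigma> permutes {..<m}"
  shows "bij_betw (permute_mpart \<sigma>) (mparts m) (mparts m)"
proof (rule bij_betw_byWitness[where f' = "permute_mpart (inv_into UNIV \<sigma>)"])
  have "permute_mpart \<tau> (permute_mpart \<rho> \<Lambda>) = \<Lambda>"
    if "\<tau> permutes {..<m}" "\<rho> permutes {..<m}" "\<And>x. \<tau> (\<rho> x) = x" "\<Lambda> \<in> mparts m" for \<tau> \<rho> \<Lambda>
  proof -
    have l: "length (fst \<Lambda>) = m" using that by (auto simp: mparts_def)
    have "expo (fst (permute_mpart \<tau> (permute_mpart \<rho> \<Lambda>))) = expo (fst \<Lambda>)"
      using that l by (simp add: expo_permute_mpart length_permute_mpart multiset.map_comp comp_def)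
    then show ?thesis using l by (simp add: expo_inject length_permute_mpart prod_eq_iff)
  qed
  from this[of "inv_into UNIV \<sigma>" \<sigma>] this[of \<sigma> "inv_into UNIV \<sigma>"]
  show "\<forall>\<Lambda>\<in>mparts m. permute_mpart (inv_into UNIV \<sigma>) (permute_mpart \<sigma> \<Lambda>) = \<Lambda>"
    "\<forall>\<Lambda>\<in>mparts m. permute_mpart \<sigma> (permute_mpart (inv_into UNIV \<sigma>) \<Lambda>) = \<Lambda>"
    using assms permutes_inv[OF assms] permutes_inverses[OF assms] by blast+
qed (auto simp: permute_mpart_in)

lemma permute_vars_mpowersum1:
  assumes "\<sigma> permutes {..<m}" "length (fst \<Lambda>) = m"
  shows "permute_vars \<sigma> (mpowersum1 \<Lambda>) = mpowersum1 (permute_mpart \<sigma> \<Lambda>)"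
  using assms by (simp add: mpowersum1_def permute_vars_mult permutes_bij permute_vars_powersum_part
      xpow_eq_pmono permute_vars_pmono expo_permute_mpart)

section \<open>Diagrams up to the labels of the circles\<close>

lemma map_sort_key: "map f (sort_key (g \<circ> f) xs) = sort_key g (map f xs)"
proof -
  have "map f (insort_key (g \<circ> f) x xs) = insort_key g (f x) (map f xs)" for x xs
    by (induction xs) auto
  then show ?thesis by (induction xs) auto
qed

text \<open>Permuting the entries of a changes only the labels of the circles. What remains without
  labels is invariant, and it suffices for everything at t = 1.\<close>

definition shape :: "mpart \<Rightarrow> (nat \<times> bool) list" where
  "shape \<Lambda> = map (\<lambda>(r, c). (r, c \<noteq> None)) (diagram \<Lambda>)"

definition shape_rows :: "mpart \<Rightarrow> (nat \<times> bool) list" where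
  "shape_rows \<Lambda> = map (\<lambda>r. (r, True)) (fst \<Lambda>)
     @ map (\<lambda>r. (r, False)) (sorted_list_of_multiset (snd \<Lambda>))"

lemma shape_eq: "shape \<Lambda> = sort_key (\<lambda>x. - int (fst x)) (shape_rows \<Lambda>)"
proof -
  let ?f = "\<lambda>(r, c :: nat option). (r :: nat, c \<noteq> None)"
  have "map ?f (zip xs (map Some ys)) = map (\<lambda>r. (r, True)) xs" if "length xs = length ys" for xs ys
    using that by (induction xs ys rule: list_induct2) auto
  then have "shape_rows \<Lambda> = map ?f (zip (fst \<Lambda>) (map Some [0..<length (fst \<Lambda>)])
      @ map (\<lambda>r. (r, None)) (sorted_list_of_multiset (snd \<Lambda>)))"
    by (simp add: shape_rows_def)
  moreover have "(\<lambda>(r, _ :: nat option). - int r) = (\<lambda>x. - int (fst x)) \<circ> ?f" by auto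
  ultimately show ?thesis unfolding shape_def diagram_def by (simp only: map_sort_key)
qed

lemma filter_shape_rows:
  "filter (\<lambda>x. fst x = r) (shape_rows \<Lambda>)
    = replicate (count (mset (fst \<Lambda>)) r) (r, True) @ replicate (count (snd \<Lambda>) r) (r, False)"
proof -
  have "filter (\<lambda>x. fst x = r) (map (\<lambda>r. (r, b)) xs) = replicate (count (mset xs) r) (r, b)"
    for xs and b :: bool
    by (induction xs) auto
  then show ?thesis by (simp add: shape_rows_def)
qed

lemma filter_shape:
  "filter (\<lambda>x. fst x = r) (shape \<Lambda>)
    = replicate (count (mset (fst \<Lambda>)) r) (r, True) @ replicate (count (snd \<Lambda>) r) (r, False)"
  using filter_shape_rows[of r \<Lambda>] sort_key_stable[of "\<lambda>x. - int (fst x)" "- int r" "shape_rows \<Lambda>"]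
  by (simp add: shape_eq)

text \<open>A stable sort is determined by the subsequences of equal keys. Here these are circled
  rows followed by uncircled ones, so they depend on a only through its multiset.\<close>

lemma shape_cong:
  assumes "mset a = mset b" shows "shape (a, l) = shape (b, l)"
  unfolding shape_eq[of "(a, l)"]
proof (rule properties_for_sort_key)
  show "mset (shape (b, l)) = mset (shape_rows (a, l))"
    using assms by (simp add: shape_eq) (simp add: shape_rows_def)
  show "sorted (map (\<lambda>x. - int (fst x)) (shape (b, l)))"
    by (simp add: shape_eq)
  show "filter (\<lambda>x. - int (fst k) = - int (fst x)) (shape (b, l))
      = filter (\<lambda>x. - int (fst k) = - int (fst x)) (shape_rows (a, l))" for k
    using filter_shape[of "fst k" "(b, l)"] filter_shape_rows[of "fst k" "(a, l)"] assms
    by (simp add: eq_commute)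
qed

lemma shape_permute_mpart:
  assumes "\<sigma> permutes {..<m}" "\<Lambda> \<in> mparts m"
  shows "shape (permute_mpart \<sigma> \<Lambda>) = shape \<Lambda>"
  using shape_cong[OF mset_permute_mpart[OF assms(1), of \<Lambda>], of "snd \<Lambda>"] assms(2)
  by (auto simp: mparts_def permute_mpart_def)

lemma shape_sorted:
  assumes "i < j" "j < length (shape \<Lambda>)"
  shows "fst (shape \<Lambda> ! j) \<le> fst (shape \<Lambda> ! i)"
    and "fst (shape \<Lambda> ! j) = fst (shape \<Lambda> ! i) \<Longrightarrow> snd (shape \<Lambda> ! j) \<Longrightarrow> snd (shape \<Lambda> ! i)"
proof -
  have *: "sorted_wrt (\<lambda>x y. fst y < fst x \<or> fst y = fst x \<and> (snd y \<longrightarrow> snd x)) xs"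
    if "sorted_wrt (\<lambda>x y. fst y \<le> fst x) xs"
      "\<And>r. sorted_wrt (\<lambda>x y. snd y \<longrightarrow> snd x) (filter (\<lambda>x. fst x = r) xs)"
    for xs :: "(nat \<times> bool) list"
    using that
  proof (induction xs)
    case (Cons x xs)
    have "sorted_wrt (\<lambda>x y. snd y \<longrightarrow> snd x) (filter (\<lambda>x. fst x = r) xs)" for r
      using Cons.prems(2)[of r] by (auto split: if_splits)
    moreover have "fst y < fst x \<or> fst y = fst x \<and> (snd y \<longrightarrow> snd x)" if y: "y \<in> set xs" for y
    proof (cases "fst y = fst x")
      case True
      have "sorted_wrt (\<lambda>x y. snd y \<longrightarrow> snd x) (x # filter (\<lambda>z. fst z = fst x) xs)"
        using Cons.prems(2)[of "fst x"] by simp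
      then have "\<forall>z \<in> set (filter (\<lambda>z. fst z = fst x) xs). snd z \<longrightarrow> snd x"
        unfolding sorted_wrt.simps by (rule conjunct1)
      moreover have "y \<in> set (filter (\<lambda>z. fst z = fst x) xs)" using y True by simp
      ultimately show ?thesis using True by blast
    next
      case False
      then show ?thesis using Cons.prems(1) y by (simp add: le_less) blast
    qed
    ultimately show ?case using Cons by simp
  qed simp
  have "sorted (map (\<lambda>x. - int (fst x)) (shape \<Lambda>))" by (simp add: shape_eq)
  then have "sorted_wrt (\<lambda>x y. fst y \<le> fst x) (shape \<Lambda>)" by (simp add: sorted_wrt_map)
  moreover have "sorted_wrt (\<lambda>x y. snd y \<longrightarrow> snd x) (filter (\<lambda>x. fst x = r) (shape \<Lambda>))" for r
  proof -
    have "sorted_wrt (\<lambda>x y. snd y \<longrightarrow> snd x) (replicate n z)" for n and z :: "nat \<times> bool"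
      by (induction n) auto
    then show ?thesis unfolding filter_shape by (auto simp: sorted_wrt_append)
  qed
  ultimately have "sorted_wrt (\<lambda>x y. fst y < fst x \<or> fst y = fst x \<and> (snd y \<longrightarrow> snd x)) (shape \<Lambda>)"
    by (rule *)
  from sorted_wrt_nth_less[OF this assms]
  show "fst (shape \<Lambda> ! j) \<le> fst (shape \<Lambda> ! i)"
    "fst (shape \<Lambda> ! j) = fst (shape \<Lambda> ! i) \<Longrightarrow> snd (shape \<Lambda> ! j) \<Longrightarrow> snd (shape \<Lambda> ! i)"
    by auto
qed

lemma down_closed_eq_lessThan:
  fixes S :: "nat set"
  assumes "finite S" "\<And>i j. j \<in> S \<Longrightarrow> i \<le> j \<Longrightarrow> i \<in> S"
  shows "S = {..<card S}"
proof (cases "S = {}")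
  case False
  define M where "M = Max S"
  have "M \<in> S" using assms(1) False by (simp add: M_def)
  have "x \<in> S \<longleftrightarrow> x < Suc M" for x
    using assms(2)[OF \<open>M \<in> S\<close>, of x] Max_ge[OF assms(1), of x] by (auto simp: M_def less_Suc_eq_le)
  then have "S = {..<Suc M}" by auto
  then show ?thesis by simp
qed simp

lemma indices_eq_lessThan:
  fixes xs :: "nat list"
  assumes "\<And>i j. i < j \<Longrightarrow> j < length xs \<Longrightarrow> xs ! j \<le> xs ! i"
    and "\<And>x y. P x \<Longrightarrow> x \<le> y \<Longrightarrow> P y"
  shows "{i. i < length xs \<and> P (xs ! i)} = {..<length (filter P xs)}"
  unfolding length_filter_conv_card
proof (rule down_closed_eq_lessThan)
  fix i j assume *: "j \<in> {i. i < length xs \<and> P (xs ! i)}" "i \<le> j"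
  then show "i \<in> {i. i < length xs \<and> P (xs ! i)}"
    using assms(1)[of i j] assms(2)[of "xs ! j" "xs ! i"] by (cases "i = j") auto
qed simp

lemma filter_nth_antitone:
  fixes xs :: "nat list"
  assumes "\<And>i j. i < j \<Longrightarrow> j < length xs \<Longrightarrow> xs ! j \<le> xs ! i"
    and "\<And>x y. P x \<Longrightarrow> x \<le> y \<Longrightarrow> P y" and "i < length (filter P xs)"
  shows "filter P xs ! i = xs ! i"
  using assms
proof (induction xs arbitrary: i)
  case (Cons x xs)
  show ?case
  proof (cases "P x")
    case True
    have "\<And>i j. i < j \<Longrightarrow> j < length xs \<Longrightarrow> xs ! j \<le> xs ! i" using Cons.prems(1)[of "Suc _" "Suc _"] by auto
    from Cons.IH[OF this Cons.prems(2)] True Cons.prems(3) show ?thesis by (cases i) auto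
  next
    case False
    have "\<not> P y" if y: "y \<in> set xs" for y
    proof -
      obtain j where "j < length xs" "y = xs ! j" using y by (metis in_set_conv_nth)
      then have "y \<le> x" using Cons.prems(1)[of 0 "Suc j"] by simp
      then show ?thesis using False Cons.prems(2) by blast
    qed
    then show ?thesis using Cons.prems(3) False by (simp add: filter_empty_conv[THEN iffD2])
  qed
qed simp

section \<open>Dual Schur functions at t = 1\<close>

text \<open>\<open>h\<^sub>r[X + \<Sum>\<^sub>i\<^sub>\<in>\<^sub>A x\<^sub>i]\<close>.\<close>

lift_definition hgen :: "nat set \<Rightarrow> int \<Rightarrow> 'a::comm_ring_1 pseries" is
  "\<lambda>K r M. if int (size M) = r
     then of_nat (card {(A, B). A + B = M \<and> set_mset A \<subseteq> K}) else 0" .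

lemma hcomplete_eq: "hcomplete k = hgen {..<k}"
  by (rule ext, rule pseries_eqI) (simp add: hcomplete.rep_eq hgen.rep_eq)

text \<open>The alphabet X is invariant; only the added variables move.\<close>

lemma permute_vars_hgen:
  assumes "bij \<sigma>" shows "permute_vars \<sigma> (hgen K r) = hgen (\<sigma> ` K) r"
proof (rule pseries_eqI)
  fix M
  let ?i = "inv_into UNIV \<sigma>"
  let ?f = "map_prod (image_mset \<sigma>) (image_mset \<sigma>)"
  let ?g = "map_prod (image_mset ?i) (image_mset ?i)"
  let ?S = "{(A, B). A + B = image_mset ?i M \<and> set_mset A \<subseteq> K}"
  let ?T = "{(A, B). A + B = M \<and> set_mset A \<subseteq> \<sigma> ` K}"
  have i: "?i (\<sigma> x) = x" "\<sigma> (?i y) = y" for x y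
    using assms by (meson bij_is_inj inv_f_f, meson bij_is_surj surj_f_inv_f)
  have "card ?S
      = card ?T"
  proof (rule bij_betw_same_card, rule bij_betw_byWitness[where f = "?f"
        and f' = "?g"])
    show "\<forall>x\<in>?S.
        ?g (?f x) = x"
      by (auto simp: image_mset_inv[OF assms])
    show "\<forall>x\<in>?T.
        ?f (?g x) = x"
      by (auto simp: image_mset_inv[OF assms])
    show "?f ` ?S
        \<subseteq> ?T"
      by (auto simp: image_mset_inv[OF assms] simp flip: image_mset_union intro!: imageI dest: subsetD)
    show "?g ` ?T
        \<subseteq> ?S"
    proof
      fix z
      assume "z \<in> ?g ` ?T"
      then obtain A B where AB: "A + B = M" "set_mset A \<subseteq> \<sigma> ` K" "z = (image_mset ?i A, image_mset ?i B)"
        by auto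
      have "?i x \<in> K" if "x \<in># A" for x using AB(2) that i(1) by (metis imageE subsetD)
      with AB show "z \<in> ?S" by auto
    qed
  qed
  then show "pcoeff (permute_vars \<sigma> (hgen K r)) M = pcoeff (hgen (\<sigma> ` K) r) M"
    by (simp add: pcoeff_permute_vars hgen.rep_eq)
qed

text \<open>Either the added copy of x_p does not occur in a factorization, or one such factor can
  be removed. This is the relation behind the row operations on the determinant.\<close>

lemma hgen_insert:
  assumes "p \<notin> K"
  shows "hgen (insert p K) r = hgen K r + pvar p * hgen (insert p K) (r - 1)"
proof (rule pseries_eqI)
  fix M
  let ?S = "{(A, B). A + B = M \<and> set_mset A \<subseteq> insert p K}"
  let ?h = "\<lambda>(A, B). (add_mset p A, B)"
  let ?T = "{(A, B). A + B = M \<and> set_mset A \<subseteq> K}"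
  let ?U = "{(A, B). A + B = M - {#p#} \<and> set_mset A \<subseteq> insert p K}"
  have fin: "finite {(A, B). A + B = M \<and> Q A B}" for M :: "nat multiset" and Q
    by (rule finite_subset[OF _ finite_splittings[of M]]) auto
  have "card ?S = card ?T + (if p \<in># M then card ?U else 0)"
  proof (cases "p \<in># M")
    case True
    have inj: "inj_on ?h ?U" by (auto simp: inj_on_def)
    have "?h ` ?U \<subseteq> ?S"
    proof (rule image_subsetI)
      fix z assume "z \<in> ?U"
      then show "(case z of (A, B) \<Rightarrow> (add_mset p A, B)) \<in> ?S" using True by (cases z) simp
    qed
    moreover have "?T \<subseteq> ?S" by auto
    ultimately have "?T \<union> ?h ` ?U \<subseteq> ?S" by (rule Un_least[rotated])
    moreover have "?S \<subseteq> ?T \<union> ?h ` ?U"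
    proof
      fix z assume "z \<in> ?S"
      then obtain A B where z: "z = (A, B)" "A + B = M" "set_mset A \<subseteq> insert p K" by auto
      show "z \<in> ?T \<union> ?h ` ?U"
      proof (cases "p \<in># A")
        case True
        have "(A - {#p#}, B) \<in> ?U" using z True by (auto dest: in_diffD simp: multiset_diff_union_assoc)
        moreover have "z = ?h (A - {#p#}, B)" using z True by simp
        ultimately have "z \<in> ?h ` ?U" by (rule image_eqI[rotated])
        then show ?thesis by (rule UnI2)
      qed (use z in auto)
    qed
    ultimately have "?S = ?T \<union> ?h ` ?U" by (rule subset_antisym[rotated])
    moreover have "?T \<inter> ?h ` ?U = {}"
    proof (rule equals0I, elim IntE imageE)
      fix z y assume "z \<in> ?T" "z = (case y of (A, B) \<Rightarrow> (add_mset p A, B))"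
      then show False using assms by (cases y) auto
    qed
    ultimately have "card ?S = card ?T + card (?h ` ?U)"
      using fin by (simp add: card_Un_disjoint)
    then show ?thesis using True card_image[OF inj] by simp
  next
    case False
    then have "?S = ?T" by auto
    then show ?thesis using False by simp
  qed
  moreover have "int (size (M - {#p#})) = r - 1 \<longleftrightarrow> int (size M) = r" if "p \<in># M"
    using size_Diff_singleton[OF that] size_eq_0_iff_empty[of M] that by (cases "size M") auto
  ultimately show "pcoeff (hgen (insert p K) r) M = pcoeff (hgen K r + pvar p * hgen (insert p K) (r - 1)) M"
    by (simp add: hgen.rep_eq pcoeff_pvar_mult)
qed

definition row_lengths :: "mpart \<Rightarrow> nat list" where
  "row_lengths \<Lambda> = filter (\<lambda>r. r > 0) (map fst (shape \<Lambda>))"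

text \<open>Row operations turn the alphabet of a row of length \<open>r\<close> into \<open>X + \<Sum> x\<^sub>i\<close>, the sum being over
  all \<open>i\<close> with \<open>a\<^sub>i \<ge> r\<close>. In this form the symmetry in the variables is visible.\<close>

definition dual_schur1 :: "mpart \<Rightarrow> 'a::comm_ring_1 pseries" where
  "dual_schur1 \<Lambda> = (let \<nu> = row_lengths \<Lambda> in
     det (mat (length \<nu>) (length \<nu>) (\<lambda>(i, j).
       hgen {p. p < length (fst \<Lambda>) \<and> \<nu> ! i \<le> fst \<Lambda> ! p} (int (\<nu> ! i) - int i + int j))))"

lemma permute_vars_dual_schur1:
  assumes \<sigma>: "\<sigma> permutes {..<m}" and "length a = m" "length b = m"
    and ab: "\<And>p. p < m \<Longrightarrow> b ! \<sigma> p = a ! p"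
  shows "permute_vars \<sigma> (dual_schur1 (a, l)) = dual_schur1 (b, l)"
proof -
  have \<sigma>b: "\<sigma> permutes {..<length b}" using assms by simp
  have "a = permute_list \<sigma> b"
  proof (rule nth_equalityI)
    fix i assume "i < length a"
    then show "a ! i = permute_list \<sigma> b ! i"
      using ab[of i] assms(2,3) permute_list_nth[OF \<sigma>b, of i] by simp
  qed (simp add: assms(2,3))
  then have "mset a = mset b" using mset_permute_list[OF \<sigma>b] by simp
  then have rl: "row_lengths (a, l) = row_lengths (b, l)"
    unfolding row_lengths_def by (simp only: shape_cong[of a b l])
  have img: "\<sigma> ` {p. p < m \<and> r \<le> a ! p} = {p. p < m \<and> r \<le> b ! p}" for r
  proof (intro equalityI subsetI)
    fix x assume x: "x \<in> {p. p < m \<and> r \<le> b ! p}"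
    obtain p where p: "x = \<sigma> p" using permutes_surj[OF \<sigma>] by (metis surjD)
    have "p < m" using x p permutes_in_image[OF \<sigma>, of p] by simp
    with x p ab show "x \<in> \<sigma> ` {p. p < m \<and> r \<le> a ! p}" by auto
  next
    fix x assume "x \<in> \<sigma> ` {p. p < m \<and> r \<le> a ! p}"
    then obtain p where p: "p < m" "r \<le> a ! p" "x = \<sigma> p" by auto
    then show "x \<in> {p. p < m \<and> r \<le> b ! p}" using ab[OF p(1)] permutes_in_image[OF \<sigma>, of p] by simp
  qed
  have e: "(\<lambda>x. permute_vars \<sigma> (case x of (i, j) \<Rightarrow> hgen {p. p < m \<and> \<nu> ! i \<le> a ! p} (h i j)))
      = (\<lambda>(i, j). hgen {p. p < m \<and> \<nu> ! i \<le> b ! p} (h i j))" for \<nu> and h :: "nat \<Rightarrow> nat \<Rightarrow> int"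
  proof (rule ext)
    fix x :: "nat \<times> nat"
    show "permute_vars \<sigma> (case x of (i, j) \<Rightarrow> hgen {p. p < m \<and> \<nu> ! i \<le> a ! p} (h i j))
        = (case x of (i, j) \<Rightarrow> hgen {p. p < m \<and> \<nu> ! i \<le> b ! p} (h i j))"
      by (cases x) (simp only: prod.case permute_vars_hgen[OF permutes_bij[OF \<sigma>]] img)
  qed
  then show ?thesis
    unfolding dual_schur1_def Let_def permute_vars_det[OF permutes_bij[OF \<sigma>]] rl fst_conv assms(2,3)
    by (simp only: e[of "row_lengths (b, l)" "\<lambda>i j. int (row_lengths (b, l) ! i) - int i + int j"])
qed

lemma permute_mpart_dual_schur1:
  assumes "\<sigma> permutes {..<m}" "\<Lambda> \<in> mparts m"
  shows "permute_vars \<sigma> (dual_schur1 \<Lambda>) = dual_schur1 (permute_mpart \<sigma> \<Lambda>)"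
proof -
  have l: "length (fst \<Lambda>) = m" using assms(2) by (auto simp: mparts_def)
  have "permute_vars \<sigma> (dual_schur1 (fst \<Lambda>, snd \<Lambda>)) = dual_schur1 (fst (permute_mpart \<sigma> \<Lambda>), snd \<Lambda>)"
  proof (rule permute_vars_dual_schur1[OF assms(1) l])
    fix p assume "p < m"
    then have "\<sigma> p < m" using permutes_in_image[OF assms(1), of p] by simp
    then show "fst (permute_mpart \<sigma> \<Lambda>) ! \<sigma> p = fst \<Lambda> ! p"
      using l permutes_inverses(2)[OF assms(1)] by (simp add: permute_mpart_def)
  qed (simp add: length_permute_mpart l)
  then show ?thesis by (metis prod.collapse snd_permute_mpart)
qed

text \<open>Row i starts with the alphabet X + x_1 + ... + x_{k i} and is to end with
  \<open>K i\<close> added variables. As long as these numbers differ, row i+1 has the same length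
  and one more added variable, and its degrees are lower by one; adding the right variable times row
  i+1 to row i then enlarges the alphabet of row i by that variable, by
  \<open>hgen_insert\<close>.\<close>

lemma dual_schur_dominant_eq:
  assumes dom: "\<And>i. \<not> ascent a i"
  shows "dual_schur_dominant (a, l) = dual_schur1 (a, l)"
proof -
  define E where "E = shape (a, l)"
  define \<nu> where "\<nu> = row_lengths (a, l)"
  define n where "n = length \<nu>"
  define k where "k i = length (filter snd (take (Suc i) E))" for i
  define K where "K i = length (filter (\<lambda>x. \<nu> ! i \<le> x) a)" for i
  have E_sorted: "fst (E ! j) \<le> fst (E ! i)" if "i \<le> j" "j < length E" for i j
    using shape_sorted(1)[of i j "(a, l)"] that by (cases "i = j") (auto simp: E_def)
  have E_circles: "snd (E ! i)" if "i \<le> j" "j < length E" "fst (E ! j) = fst (E ! i)" "snd (E ! j)" for i j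
    using shape_sorted(2)[of i j "(a, l)"] that by (cases "i = j") (auto simp: E_def)
  have a_sorted: "a ! j \<le> a ! i" if "i < j" "j < length a" for i j
  proof -
    have "sorted_wrt (\<ge>) a"
      using dom[unfolded ascent_def]
      by (subst sorted_wrt_iff_nth_Suc_transp) (auto simp: transp_def simp flip: not_less)
    from sorted_wrt_nth_less[OF this that] show ?thesis .
  qed
  have \<nu>_filter: "\<nu> = filter (\<lambda>r. r > 0) (map fst E)" by (simp add: \<nu>_def row_lengths_def E_def)
  have mono: "\<And>i j. i < j \<Longrightarrow> j < length (map fst E) \<Longrightarrow> map fst E ! j \<le> map fst E ! i"
    using E_sorted by simp
  have \<nu>_nth: "\<nu> ! i = fst (E ! i)" if "i < n" for i
  proof -
    have "\<nu> ! i = map fst E ! i" unfolding \<nu>_filter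
      by (rule filter_nth_antitone[OF mono]) (use that in \<open>auto simp: n_def \<nu>_filter\<close>)
    moreover have "n \<le> length E" unfolding n_def \<nu>_filter by (metis length_filter_le length_map)
    ultimately show ?thesis using that by simp
  qed
  have n_iff: "i < n \<longleftrightarrow> i < length E \<and> 0 < fst (E ! i)" for i
  proof -
    have "{i. i < length (map fst E) \<and> 0 < map fst E ! i} = {..<n}"
      unfolding n_def \<nu>_filter by (rule indices_eq_lessThan[OF mono]) auto
    from eqset_imp_iff[OF this, of i] show ?thesis by auto
  qed
  have K_eq: "K i = length (filter (\<lambda>x. snd x \<and> \<nu> ! i \<le> fst x) E)" for i
  proof -
    have "mset E = mset (shape_rows (a, l))" by (simp add: E_def shape_eq)
    then have "length (filter (\<lambda>x. snd x \<and> \<nu> ! i \<le> fst x) E)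
        = length (filter (\<lambda>x. snd x \<and> \<nu> ! i \<le> fst x) (shape_rows (a, l)))"
      by (metis mset_filter size_mset)
    then show ?thesis by (simp add: shape_rows_def K_def comp_def filter_map)
  qed
  \<comment> \<open>Circled rows weakly above row i are at least as long as row i, hence counted by
    \<open>K i\<close>.\<close>
  have k_le_K: "k i \<le> K i" if "i < n" for i
  proof -
    have "filter snd (take (Suc i) E) = filter (\<lambda>x. snd x \<and> \<nu> ! i \<le> fst x) (take (Suc i) E)"
    proof (rule filter_cong[OF refl])
      fix x assume "x \<in> set (take (Suc i) E)"
      then obtain j where "j < Suc i" "j < length E" "x = E ! j" by (auto simp: in_set_conv_nth)
      then show "snd x \<longleftrightarrow> snd x \<and> \<nu> ! i \<le> fst x"
        using E_sorted[of j i] that n_iff[of i] \<nu>_nth[OF that] by auto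
    qed
    then have "k i = length (filter (\<lambda>x. snd x \<and> \<nu> ! i \<le> fst x) (take (Suc i) E))" by (simp add: k_def)
    also have "\<dots> \<le> length (filter (\<lambda>x. snd x \<and> \<nu> ! i \<le> fst x) (take (Suc i) E @ drop (Suc i) E))"
      by (simp only: filter_append length_append)
    finally show ?thesis by (simp add: K_eq)
  qed
  \<comment> \<open>If circles counted by \<open>K i\<close> are missing above, a circled row of
    length at least \<nu>_i lies below row i. By sorting it has exactly this length, and as circles
    come first among equal rows, row i+1 is circled too.\<close>
  have next_row: "Suc i < n \<and> \<nu> ! Suc i = \<nu> ! i \<and> k (Suc i) = Suc (k i)" if i: "i < n" "k i < K i" for i
  proof -
    let ?P = "\<lambda>x. snd x \<and> \<nu> ! i \<le> fst x"
    have "filter ?P (drop (Suc i) E) \<noteq> []"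
    proof
      assume *: "filter ?P (drop (Suc i) E) = []"
      have "K i = length (filter ?P (take (Suc i) E @ drop (Suc i) E))" by (simp add: K_eq)
      also have "\<dots> = length (filter ?P (take (Suc i) E))" by (simp only: filter_append * append_Nil2)
      also have "\<dots> \<le> length (filter snd (take (Suc i) E))"
        by (simp add: length_filter_conv_card) (intro card_mono, auto)
      finally show False using i(2) by (simp add: k_def)
    qed
    then obtain x where x: "x \<in> set (drop (Suc i) E)" "snd x" "\<nu> ! i \<le> fst x"
      by (auto simp: filter_empty_conv)
    then obtain j' where j': "j' < length (drop (Suc i) E)" "x = drop (Suc i) E ! j'"
      by (auto simp: in_set_conv_nth)
    define j where "j = Suc i + j'"
    have j: "Suc i \<le> j" "j < length E" "snd (E ! j)" "\<nu> ! i \<le> fst (E ! j)"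
      using j' x by (auto simp: j_def)
    have "fst (E ! j) \<le> fst (E ! Suc i)" "fst (E ! Suc i) \<le> fst (E ! i)"
      using E_sorted[of "Suc i" j] E_sorted[of i "Suc i"] j by auto
    then have eq: "fst (E ! Suc i) = \<nu> ! i" "fst (E ! j) = fst (E ! Suc i)"
      using j(4) \<nu>_nth[OF i(1)] by auto
    have "snd (E ! Suc i)" using E_circles[OF j(1,2) eq(2) j(3)] .
    moreover have l: "Suc i < length E" using j by simp
    ultimately have "k (Suc i) = Suc (k i)"
      by (simp add: k_def take_Suc_conv_app_nth[of "Suc i"])
    moreover have "Suc i < n" using n_iff i eq l \<nu>_nth[OF i(1)] by (metis (no_types))
    ultimately show ?thesis using eq \<nu>_nth by metis
  qed
  \<comment> \<open>The number of added variables in row i after s rounds. A round treats all rows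
    at once, and row i+1 stays one variable ahead of row i until row i is complete.\<close>
  define \<kappa> where "\<kappa> s i = min (k i + s) (K i)" for s i
  define A :: "nat \<Rightarrow> Qqt pseries mat" where
    "A s = mat n n (\<lambda>(i, j). hgen {..<\<kappa> s i} (int (\<nu> ! i) - int i + int j))" for s
  have step: "det (A (Suc s)) = det (A s)" for s
  proof -
    \<comment> \<open>The next variable for row i, or 0 if the row is complete. The round is
      multiplication by the unitriangular matrix \<open>U\<close>.\<close>
    define u :: "nat \<Rightarrow> Qqt pseries" where "u i = (if \<kappa> s i < K i then pvar (\<kappa> s i) else 0)" for i
    define U where "U = mat n n (\<lambda>(i, j). if j = i then 1 else if j = Suc i then u i else 0)"
    have carrier: "U \<in> carrier_mat n n" "A s \<in> carrier_mat n n" by (simp_all add: U_def A_def)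
    have "upper_triangular U" by (auto simp: U_def upper_triangular_def)
    then have "det U = prod_list (diag_mat U)" using carrier(1) by (rule det_upper_triangular)
    also have "diag_mat U = replicate n 1"
      by (rule nth_equalityI) (auto simp: diag_mat_def U_def)
    finally have "det U = 1" by simp
    have "A (Suc s) = U * A s"
    proof (rule eq_matI)
      fix i j assume "i < dim_row (U * A s)" "j < dim_col (U * A s)"
      then have ij: "i < n" "j < n" by (simp_all add: U_def A_def)
      have "(U * A s) $$ (i, j) = (\<Sum>p<n. U $$ (i, p) * A s $$ (p, j))"
        using ij carrier by (simp add: scalar_prod_def atLeast0LessThan)
      also have "\<dots> = (\<Sum>p<n. (if p = i then A s $$ (i, j) else 0)
          + (if p = Suc i then u i * A s $$ (Suc i, j) else 0))"
        by (rule sum.cong) (use ij in \<open>auto simp: U_def\<close>)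
      also have "\<dots> = A s $$ (i, j) + (if Suc i < n then u i * A s $$ (Suc i, j) else 0)"
        using ij by (simp add: sum.distrib)
      also have "\<dots> = A (Suc s) $$ (i, j)"
      proof (cases "\<kappa> s i < K i")
        case False
        then have "\<kappa> (Suc s) i = \<kappa> s i" by (simp add: \<kappa>_def)
        then show ?thesis using False ij by (simp add: A_def u_def)
      next
        case True
        then have lt: "k i + s < K i" by (simp add: \<kappa>_def)
        then have nx: "Suc i < n" "\<nu> ! Suc i = \<nu> ! i" "k (Suc i) = Suc (k i)"
          using next_row[OF ij(1)] by auto
        have "K (Suc i) = K i" by (simp add: K_def nx)
        then have \<kappa>: "\<kappa> s i = k i + s" "\<kappa> s (Suc i) = Suc (k i + s)" "\<kappa> (Suc s) i = Suc (k i + s)"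
          using lt nx by (simp_all add: \<kappa>_def)
        let ?N = "int (\<nu> ! i) - int i + int j"
        have "hgen {..<Suc (k i + s)} ?N = hgen {..<k i + s} ?N
            + pvar (k i + s) * (hgen {..<Suc (k i + s)} (?N - 1) :: Qqt pseries)"
          using hgen_insert[of "k i + s" "{..<k i + s}" ?N] by (simp add: lessThan_Suc)
        moreover have "?N - 1 = int (\<nu> ! Suc i) - int (Suc i) + int j" using nx by simp
        ultimately show ?thesis using ij nx(1) True by (simp add: A_def u_def \<kappa>)
      qed
      finally show "A (Suc s) $$ (i, j) = (U * A s) $$ (i, j)" by simp
    qed (simp_all add: A_def U_def)
    then show ?thesis using det_mult[OF carrier] \<open>det U = 1\<close> by simp
  qed
  have "det (A s) = det (A 0)" for s by (induction s) (simp_all add: step)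
  then have "det (A (length a)) = det (A 0)" .
  moreover have "A 0 = mat n n (\<lambda>(i, j). hcomplete (k i) (int (\<nu> ! i) - int i + int j))"
    unfolding A_def by (rule cong_mat) (auto simp: hcomplete_eq \<kappa>_def k_le_K min_absorb1)
  moreover have "A (length a) = mat n n (\<lambda>(i, j).
      hgen {p. p < length a \<and> \<nu> ! i \<le> a ! p} (int (\<nu> ! i) - int i + int j))"
  proof -
    have "{p. p < length a \<and> \<nu> ! i \<le> a ! p} = {..<K i}" for i
      unfolding K_def by (rule indices_eq_lessThan) (auto intro: a_sorted)
    \<comment> \<open>\<open>K i\<close> is at most the length of a, so this many rounds complete
      every row.\<close>
    moreover have "\<kappa> (length a) i = K i" for i
      by (simp add: \<kappa>_def K_def trans_le_add2)
    ultimately show ?thesis unfolding A_def by simp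
  qed
  moreover have "filter (\<lambda>r. r > 0) (map fst (diagram (a, l))) = \<nu>"
    by (simp add: \<nu>_def row_lengths_def shape_def comp_def split_beta)
  moreover have "length (filter (\<lambda>(_, c). c \<noteq> None) (take (Suc i) (diagram (a, l)))) = k i" for i
    by (simp add: k_def E_def shape_def take_map filter_map comp_def case_prod_unfold)
  ultimately show ?thesis
    unfolding dual_schur_dominant_def dual_schur1_def Let_def \<nu>_def[symmetric]
    by (simp add: n_def)
qed

lemma pspec1_dual_schur1: "pspec1 (dual_schur1 \<Lambda>) (dual_schur1 \<Lambda>)"
  unfolding dual_schur1_def Let_def
  by (rule pspec1_det) (simp add: pspec1_def hgen.rep_eq)

lemma pspec1_dual_schur: "pspec1 (dual_schur \<Lambda>) (dual_schur1 \<Lambda>)"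
proof -
  have "pspec1 (hecke_extend (\<lambda>a. dual_schur_dominant (a, snd \<Lambda>)) (fst \<Lambda>))
      (dual_schur1 (fst \<Lambda>, snd \<Lambda>))"
  proof (rule pspec1_hecke_extend[OF _ _ refl])
    fix a assume "\<And>i. \<not> ascent a i"
    then show "pspec1 (dual_schur_dominant (a, snd \<Lambda>)) (dual_schur1 (a, snd \<Lambda>))"
      by (simp add: dual_schur_dominant_eq pspec1_dual_schur1)
  next
    fix a i assume "ascent a i"
    then have i: "Suc i < length a" by (simp add: ascent_def)
    show "swap_vars i (dual_schur1 (swap_at a i, snd \<Lambda>)) = dual_schur1 (a, snd \<Lambda>)"
      unfolding swap_vars_eq
    proof (rule permute_vars_dual_schur1[where m = "length a"])
      show "transpose i (Suc i) permutes {..<length a}" using i by (intro permutes_swap_id) auto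
    qed (use i in \<open>auto simp: transpose_def nth_list_update\<close>)
  qed
  then show ?thesis by (simp add: dual_schur_def)
qed

section \<open>The normalization of the integral form at t = 1\<close>

text \<open>The value at t = 1 of c_\<Lambda> divided by the power of 1 - t given by the number of
  uncircled rows. The last square of such a row has arm 0 and factor 1 - t^(leg+1), whose quotient
  by 1 - t becomes leg + 1. For all other squares the leg disappears with t, and with it the labels
  of the circles.\<close>

definition cnorm1 :: "(nat \<times> bool) list \<Rightarrow> Qq" where
  "cnorm1 E = (\<Prod>r<length E. \<Prod>c<fst (E ! r).
     if \<not> snd (E ! r) \<and> Suc c = fst (E ! r)
     then of_nat (Suc (card {r'. r < r' \<and> r' < length E \<and> c < fst (E ! r')}))
     else 1 - (Fract [:0, 1:] 1) ^ (fst (E ! r) - Suc c + (if snd (E ! r) then 1 else 0)))"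

lemma geometric_one_minus: "1 - x ^ n = (1 - x) * (\<Sum>i<n. x ^ i)" for x :: "'a::comm_ring_1"
  by (induction n) (simp_all add: algebra_simps)

lemma cnorm_spec1:
  assumes "0 \<notin># snd \<Lambda>"
  obtains x where "cnorm \<Lambda> = (1 - tv) ^ size (snd \<Lambda>) * x" "spec1 x (cnorm1 (shape \<Lambda>))"
proof -
  define D E where "D = diagram \<Lambda>" and "E = shape \<Lambda>"
  have len: "length D = length E" by (simp add: D_def E_def shape_def)
  have nth: "E ! r = (fst (D ! r), snd (D ! r) \<noteq> None)" if "r < length E" for r
    using that by (simp add: D_def E_def shape_def split_beta)
  define last_cell where "last_cell r c \<longleftrightarrow> \<not> snd (E ! r) \<and> Suc c = fst (E ! r)" for r c
  define L where "L r c = card {r'. r < r' \<and> r' < length E \<and> c < fst (E ! r')}" for r c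
  define g where "g r c = (if last_cell r c then \<Sum>i<Suc (L r c). tv ^ i
      else 1 - qv ^ arm \<Lambda> r c * tv ^ (leg \<Lambda> r c + 1))" for r c
  have factor: "1 - qv ^ arm \<Lambda> r c * tv ^ (leg \<Lambda> r c + 1) = (if last_cell r c then 1 - tv else 1) * g r c"
    if "r < length E" "c < fst (E ! r)" for r c
  proof (cases "last_cell r c")
    case True
    then have "arm \<Lambda> r c = 0" using nth[OF that(1)]
      by (simp add: arm_def Let_def last_cell_def D_def[symmetric])
    moreover have "leg \<Lambda> r c = L r c"
    proof -
      have "{r'. r < r' \<and> r' < length D \<and> c < fst (D ! r')} = {r'. r < r' \<and> r' < length E \<and> c < fst (E ! r')}"
        using nth by (auto simp: len)
      then show ?thesis using True nth[OF that(1)]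
        by (simp add: leg_def Let_def last_cell_def D_def[symmetric] L_def)
    qed
    ultimately show ?thesis using True geometric_one_minus[of tv "Suc (L r c)"]
      by (simp add: g_def del: sum.lessThan_Suc power_Suc)
  qed (simp add: g_def)
  have "cnorm \<Lambda> = (\<Prod>r<length E. \<Prod>c<fst (E ! r). 1 - qv ^ arm \<Lambda> r c * tv ^ (leg \<Lambda> r c + 1))"
    unfolding cnorm_def Let_def D_def[symmetric] len
    by (intro prod.cong refl) (simp_all add: nth)
  also have "\<dots> = (\<Prod>r<length E. \<Prod>c<fst (E ! r). (if last_cell r c then 1 - tv else 1) * g r c)"
    by (intro prod.cong refl factor) simp_all
  also have "\<dots> = (\<Prod>r<length E. \<Prod>c<fst (E ! r). if last_cell r c then 1 - tv else 1)
      * (\<Prod>r<length E. \<Prod>c<fst (E ! r). g r c)"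
    by (simp only: prod.distrib)
  also have "(\<Prod>r<length E. \<Prod>c<fst (E ! r). if last_cell r c then 1 - tv else 1)
      = (\<Prod>r<length E. if snd (E ! r) then 1 else 1 - tv)"
  proof (rule prod.cong[OF refl])
    fix r assume "r \<in> {..<length E}"
    then have "E ! r \<in> set E" by simp
    also have "set E = set (shape_rows \<Lambda>)" by (simp add: E_def shape_eq)
    finally have "\<not> snd (E ! r) \<Longrightarrow> fst (E ! r) \<in># snd \<Lambda>" by (auto simp: shape_rows_def)
    \<comment> \<open>An uncircled row is not empty, so it has a last square and contributes exactly
      one factor 1 - t.\<close>
    then have pos: "\<not> snd (E ! r) \<Longrightarrow> fst (E ! r) > 0" using assms by (metis neq0_conv)
    show "(\<Prod>c<fst (E ! r). if last_cell r c then 1 - tv else 1) = (if snd (E ! r) then 1 else 1 - tv)"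
    proof (cases "snd (E ! r)")
      case False
      then have "(\<Prod>c<fst (E ! r). if last_cell r c then 1 - tv else 1)
          = (\<Prod>c<fst (E ! r). if c = fst (E ! r) - 1 then 1 - tv else 1)"
        by (intro prod.cong refl) (auto simp: last_cell_def)
      then show ?thesis using False pos by simp
    qed (simp add: last_cell_def)
  qed
  also have "\<dots> = (1 - tv) ^ card {r. r < length E \<and> \<not> snd (E ! r)}"
    by (simp add: prod.If_cases Int_def Collect_conj_eq[symmetric] conj_commute)
  also have "card {r. r < length E \<and> \<not> snd (E ! r)} = length (filter (\<lambda>x. \<not> snd x) E)"
    by (simp add: length_filter_conv_card)
  also have "\<dots> = length (filter (\<lambda>x. \<not> snd x) (shape_rows \<Lambda>))"
    unfolding E_def shape_eq by (metis mset_filter mset_sort size_mset)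
  also have "\<dots> = size (snd \<Lambda>)"
    by (simp add: shape_rows_def filter_map comp_def length_sorted_list_of_multiset)
  finally have "cnorm \<Lambda> = (1 - tv) ^ size (snd \<Lambda>) * (\<Prod>r<length E. \<Prod>c<fst (E ! r). g r c)" .
  moreover have "spec1 (\<Prod>r<length E. \<Prod>c<fst (E ! r). g r c) (cnorm1 (shape \<Lambda>))"
    unfolding cnorm1_def E_def[symmetric]
  proof (intro spec1_prod)
    fix r c assume "r \<in> {..<length E}"
    then have r: "r < length E" by simp
    show "spec1 (g r c) (if \<not> snd (E ! r) \<and> Suc c = fst (E ! r)
        then of_nat (Suc (card {r'. r < r' \<and> r' < length E \<and> c < fst (E ! r')}))
        else 1 - (Fract [:0, 1:] 1) ^ (fst (E ! r) - Suc c + (if snd (E ! r) then 1 else 0)))"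
    proof (cases "last_cell r c")
      case True
      have "spec1 (\<Sum>i<Suc (L r c). tv ^ i) (\<Sum>i<Suc (L r c). 1 ^ i)"
        by (intro spec1_sum spec1_power spec1_tv)
      then show ?thesis using True by (simp add: g_def last_cell_def L_def)
    next
      case False
      have "arm \<Lambda> r c = fst (E ! r) - Suc c + (if snd (E ! r) then 1 else 0)"
        using nth[OF r] by (simp add: arm_def Let_def D_def[symmetric])
      moreover have "spec1 (1 - qv ^ arm \<Lambda> r c * tv ^ (leg \<Lambda> r c + 1))
          (1 - (Fract [:0, 1:] 1) ^ arm \<Lambda> r c * 1 ^ (leg \<Lambda> r c + 1))"
        by (intro spec1_diff spec1_1 spec1_mult spec1_power spec1_tv spec1_qv)
      moreover have nl: "\<not> (\<not> snd (E ! r) \<and> Suc c = fst (E ! r))" using False by (simp add: last_cell_def)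
      ultimately show ?thesis unfolding g_def if_not_P[OF False] if_not_P[OF nl] by simp
    qed
  qed
  ultimately show ?thesis by (rule that)
qed

section \<open>Orders of vanishing at t = 1\<close>

text \<open>x vanishes at t = 1 to order at least n; a negative n bounds the order of a
  pole.\<close>

definition order_ge :: "int \<Rightarrow> Qqt \<Rightarrow> bool" where
  "order_ge n x \<longleftrightarrow> (\<exists>v. spec1 (x * (1 - tv) powi (- n)) v)"

lemma order_ge_0 [simp]: "order_ge n 0"
  unfolding order_ge_def by (metis mult_zero_left spec1_0)

lemma order_ge_add: "order_ge n x \<Longrightarrow> order_ge n y \<Longrightarrow> order_ge n (x + y)"
  unfolding order_ge_def distrib_right by (meson spec1_add)

lemma order_ge_uminus: "order_ge n x \<Longrightarrow> order_ge n (- x)"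
  unfolding order_ge_def mult_minus_left by (meson spec1_minus)

lemma order_ge_sum: "(\<And>i. i \<in> A \<Longrightarrow> order_ge n (f i)) \<Longrightarrow> order_ge n (sum f A)"
  by (induction A rule: infinite_finite_induct) (auto intro: order_ge_add)

lemma order_ge_mult: assumes "order_ge n x" "order_ge k y" shows "order_ge (n + k) (x * y)"
proof -
  obtain v w where "spec1 (x * (1 - tv) powi (- n)) v" "spec1 (y * (1 - tv) powi (- k)) w"
    using assms by (auto simp: order_ge_def)
  from spec1_mult[OF this] show ?thesis unfolding order_ge_def
    by (auto simp: power_int_add power_int_minus power_int_diff field_simps)
qed

lemma order_ge_positive: assumes "order_ge n x" "n > 0" shows "spec1 x 0"
proof -
  obtain v where v: "spec1 (x * (1 - tv) powi (- n)) v" using assms(1) by (auto simp: order_ge_def)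
  have n: "n = int (nat n)" "nat n > 0" using assms(2) by auto
  have "spec1 ((1 - tv) ^ nat n * (x * (1 - tv) powi (- n))) (0 ^ nat n * v)"
    by (intro spec1_mult v spec1_power spec1_one_minus_tv)
  moreover have "(1 - tv) ^ nat n * (x * (1 - tv) powi (- n)) = x"
  proof -
    have "(1 - tv) ^ nat n = (1 - tv) powi n" using n(1) by (metis power_int_of_nat)
    then show ?thesis by (simp add: power_int_minus)
  qed
  ultimately show ?thesis using n(2) by (simp add: power_0_left)
qed

lemma order_ge_shift:
  assumes "order_ge (k + n) x" shows "order_ge k (x * (1 - tv) powi (- n))"
proof -
  have "x * (1 - tv) powi (- n) * (1 - tv) powi (- k) = x * (1 - tv) powi (- (k + n))"
  proof -
    have e: "- (k + n) = - n + - k" by simp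
    show ?thesis unfolding e by (subst power_int_add) (simp_all add: mult.assoc)
  qed
  with assms show ?thesis by (simp only: order_ge_def)
qed

lemma order_ge_mono: assumes "order_ge n x" "k \<le> n" shows "order_ge k x"
proof (cases "k = n")
  case False
  then have "n - k > 0" using assms(2) by simp
  have "order_ge (n - k) (x * (1 - tv) powi (- k))" using assms(1) by (intro order_ge_shift) simp
  from order_ge_positive[OF this \<open>n - k > 0\<close>] show ?thesis by (auto simp: order_ge_def)
qed (use assms in simp)

lemma order_ge_if_spec1: "spec1 ((1 - tv) ^ k * x) v \<Longrightarrow> order_ge (- int k) x"
  unfolding order_ge_def by (auto simp: mult.commute)

lemma order_ge_Suc_if_spec1_0:
  assumes "spec1 ((1 - tv) ^ k * x) 0" shows "order_ge (1 - int k) x"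
proof -
  have "(1 - tv) ^ k * x = (1 - tv) * (x * (1 - tv) powi (- (1 - int k)))"
    by (simp add: power_int_diff)
  with assms obtain v where "spec1 (x * (1 - tv) powi (- (1 - int k))) v"
    by (metis spec1_cancel_one_minus_tv)
  then show ?thesis by (auto simp: order_ge_def)
qed

text \<open>The Gram matrix \<open>G\<close> has order at least \<open>- min (k i) (k j)\<close> at \<open>(i, j)\<close>, and after
  multiplication of row and column \<open>i\<close> by \<open>(1 - t)\<^sup>k\<^sup>/\<^sup>2\<close>, \<open>k = k i\<close>, it is diagonal and invertible at
  \<open>t = 1\<close>. To avoid square roots, one looks at an index where twice the order of \<open>d i\<close>, minus
  \<open>k i\<close>, is minimal.\<close>

lemma gram_solution_vanishes:
  fixes d :: "'i \<Rightarrow> Qqt" and k :: "'i \<Rightarrow> nat"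
  assumes fin: "finite D" and k0: "\<And>i. i \<in> D \<Longrightarrow> k0 \<le> k i"
    and eq: "\<And>j. j \<in> D \<Longrightarrow> g j + (\<Sum>i\<in>D. d i * G i j) = 0"
    and G: "\<And>i j. i \<in> D \<Longrightarrow> j \<in> D \<Longrightarrow> order_ge (- int (min (k i) (k j))) (G i j)"
    and G0: "\<And>i j. i \<in> D \<Longrightarrow> j \<in> D \<Longrightarrow> i \<noteq> j \<Longrightarrow> k i = k j \<Longrightarrow> order_ge (1 - int (k j)) (G i j)"
    and Gd: "\<And>i. i \<in> D \<Longrightarrow> \<exists>v. v \<noteq> 0 \<and> spec1 ((1 - tv) ^ k i * G i i) v"
    and g: "\<And>j. j \<in> D \<Longrightarrow> order_ge (- int k0) (g j)"
    and g0: "\<And>j. j \<in> D \<Longrightarrow> k j = k0 \<Longrightarrow> order_ge (1 - int k0) (g j)"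
    and "i \<in> D"
  shows "spec1 (d i) 0"
proof (cases "d i = 0")
  case False
  define J where "J = {i \<in> D. d i \<noteq> 0}"
  have "\<exists>n v. v \<noteq> 0 \<and> spec1 (d j * (1 - tv) powi (- n)) v" if "j \<in> J" for j
  proof -
    have "d j \<noteq> 0" using that by (simp add: J_def)
    then obtain n v where "v \<noteq> 0" "spec1 (d j * (1 - tv) powi n) v" by (rule order_at_t1)
    then show ?thesis by (intro exI[of _ "- n"] exI[of _ v]) simp
  qed
  then obtain n where n: "\<And>j. j \<in> J \<Longrightarrow> \<exists>v. v \<noteq> 0 \<and> spec1 (d j * (1 - tv) powi (- n j)) v"
    by metis
  have ge: "order_ge (n j) (d j)" if "j \<in> J" for j using n[OF that] by (auto simp: order_ge_def)
  have J: "finite J" "J \<noteq> {}" "J \<subseteq> D" using fin False \<open>i \<in> D\<close> by (auto simp: J_def)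
  define f where "f j = 2 * n j - int (k j)" for j
  have "Min (f ` J) \<in> f ` J" using J by (intro Min_in) auto
  then obtain j where j: "j \<in> J" "f j = Min (f ` J)" by auto
  have f_min: "f j \<le> f i" if "i \<in> J" for i unfolding j(2) using that J by (intro Min_le) auto
  have jD: "j \<in> D" using j J by auto
  have kj: "k0 \<le> k j" using k0[OF jD] .
  \<comment> \<open>Bounds at the minimizing index j, chosen to give \<open>n i > 0\<close> for
    every i in \<open>J\<close> through the minimality of \<open>f j\<close>.\<close>
  have main: "(k j = k0 \<longrightarrow> n j \<ge> 1) \<and> (k j > k0 \<longrightarrow> n j \<ge> int (k j) - int k0)"
  proof (rule ccontr)
    assume neg: "\<not> ?thesis"
    \<comment> \<open>The exact order of \<open>d j * G j j\<close>. If a bound failed, all other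
      terms of equation j would have order at least \<open>e + 1\<close>, a contradiction.\<close>
    define e where "e = n j - int (k j)"
    have 1: "order_ge (e + 1) (g j)"
    proof (cases "k j = k0")
      case True
      then have "e + 1 \<le> 1 - int k0" using neg by (simp add: e_def)
      with g0[OF jD True] show ?thesis by (rule order_ge_mono)
    next
      case False
      then have "e + 1 \<le> - int k0" using neg kj by (simp add: e_def)
      with g[OF jD] show ?thesis by (rule order_ge_mono)
    qed
    have 2: "order_ge (e + 1) (d i * G i j)" if "i \<in> D - {j}" for i
    proof (cases "d i = 0")
      case False
      then have iJ: "i \<in> J" and iD: "i \<in> D" and "i \<noteq> j" using that by (auto simp: J_def)
      have le: "2 * n j - int (k j) \<le> 2 * n i - int (k i)" using f_min[OF iJ] by (simp add: f_def)
      show ?thesis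
      proof (cases "k i = k j")
        case True
        then have "order_ge (n i + (1 - int (k j))) (d i * G i j)"
          using order_ge_mult[OF ge[OF iJ] G0[OF iD jD \<open>i \<noteq> j\<close> True]] by simp
        moreover have "e + 1 \<le> n i + (1 - int (k j))" using le True by (simp add: e_def)
        ultimately show ?thesis by (rule order_ge_mono)
      next
        case False
        have "order_ge (n i + - int (min (k i) (k j))) (d i * G i j)"
          by (rule order_ge_mult[OF ge[OF iJ] G[OF iD jD]])
        moreover have "e + 1 \<le> n i + - int (min (k i) (k j))"
        proof -
          \<comment> \<open>By minimality of \<open>f j\<close> the two sides differ by at least k i
            + k j - 2 min (k i) (k j), the distance of \<open>k i\<close> and
            \<open>k j\<close>.\<close>
          have "2 * (n j - int (k j)) < 2 * (n i - int (min (k i) (k j)))"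
            using le False by (auto simp: min_def)
          then show ?thesis by (simp add: e_def)
        qed
        ultimately show ?thesis by (rule order_ge_mono)
      qed
    qed simp
    have "d j * G j j = - (g j + (\<Sum>i\<in>D - {j}. d i * G i j))"
      using eq[OF jD] fin jD by (simp add: sum.remove[of D j] algebra_simps eq_neg_iff_add_eq_0)
    also have "order_ge (e + 1) \<dots>"
      by (intro order_ge_uminus order_ge_add order_ge_sum 1 2)
    finally have "order_ge 1 (d j * G j j * (1 - tv) powi (- e))"
      by (intro order_ge_shift) (simp add: add.commute)
    then have z: "spec1 (d j * G j j * (1 - tv) powi (- e)) 0" by (rule order_ge_positive) simp
    obtain v w where vw: "v \<noteq> 0" "spec1 (d j * (1 - tv) powi (- n j)) v"
        "w \<noteq> 0" "spec1 ((1 - tv) ^ k j * G j j) w"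
      using n[OF j(1)] Gd[OF jD] by blast
    have e2: "d j * (1 - tv) powi (- n j) * ((1 - tv) ^ k j * G j j)
        = d j * G j j * (1 - tv) powi (- e)"
    proof -
      have e: "- e = - n j + int (k j)" by (simp add: e_def)
      show ?thesis unfolding e by (subst power_int_add) (simp_all add: mult_ac)
    qed
    have "v * w = 0" using spec1_mult[OF vw(2,4)] unfolding e2 by (rule spec1_unique[OF _ z])
    then show False using vw by simp
  qed
  have iJ: "i \<in> J" using False \<open>i \<in> D\<close> by (simp add: J_def)
  \<comment> \<open>Hence 2 n_i is at least 2 n_j - k_j + k0, which by \<open>main\<close> is at
    least 2 if k_j = k0, and at least k_j - k0 otherwise.\<close>
  have "2 * n j - int (k j) \<le> 2 * n i - int (k i)" using f_min[OF iJ] by (simp add: f_def)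
  moreover have "int k0 \<le> int (k i)" using k0[OF \<open>i \<in> D\<close>] by simp
  ultimately have "n i > 0" using main kj by (cases "k j = k0") auto
  then show ?thesis using order_ge_positive ge[OF iJ] by blast
qed simp

section \<open>The order on m-partitions\<close>

text \<open>If Y had more parts than X, its largest \<open>size X\<close> parts would already reach
  the common total, leaving only zeros.\<close>

lemma size_le_if_dominated:
  assumes "dominated X Y" "0 \<notin># X" "0 \<notin># Y" shows "size Y \<le> size X"
proof (rule ccontr)
  assume neg: "\<not> size Y \<le> size X"
  define xs ys where "xs = rev (sorted_list_of_multiset X)" and "ys = rev (sorted_list_of_multiset Y)"
  have X: "mset xs = X" "length xs = size X" and Y: "mset ys = Y" "length ys = size Y"
    by (simp_all add: xs_def ys_def length_sorted_list_of_multiset)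
  have lt: "size X < length ys" using neg Y by simp
  have "sum_list ys = sum_list xs"
    using assms(1) X Y by (metis dominated_def sum_mset_sum_list)
  also have "\<dots> = sum_list (take (size X) xs)" using X by simp
  also have "\<dots> \<le> sum_list (take (size X) ys)" using assms(1) by (simp add: dominated_def xs_def ys_def)
  finally have "sum_list (drop (size X) ys) = 0"
    using sum_list_append[of "take (size X) ys" "drop (size X) ys"] by simp
  moreover have "ys ! size X \<in> set (drop (size X) ys)"
    using lt by (metis Cons_nth_drop_Suc list.set_intros(1))
  ultimately have "ys ! size X = 0" by (simp add: sum_list_eq_0_iff)
  moreover have "ys ! size X \<in># Y" using lt Y(1) by (metis nth_mem_mset)
  ultimately show False using assms(3) by simp
qed

lemma dominated_antisym:
  assumes "dominated X Y" "dominated Y X" "size X = size Y" shows "X = Y"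
proof -
  define xs ys where "xs = rev (sorted_list_of_multiset X)" and "ys = rev (sorted_list_of_multiset Y)"
  have X: "mset xs = X" "length xs = size X" and Y: "mset ys = Y" "length ys = size Y"
    by (simp_all add: xs_def ys_def length_sorted_list_of_multiset)
  have eq: "sum_list (take k xs) = sum_list (take k ys)" for k
    using assms(1,2) by (auto simp: dominated_def xs_def ys_def intro: le_antisym)
  have "xs = ys"
  proof (rule nth_equalityI)
    show "length xs = length ys" using X Y assms(3) by simp
    fix i assume "i < length xs"
    then show "xs ! i = ys ! i" using eq[of i] eq[of "Suc i"] X Y assms(3)
      by (simp add: take_Suc_conv_app_nth)
  qed
  then show ?thesis using X Y by simp
qed

lemma raise_Suc:
  assumes "i < length (fst \<Lambda>)"
  shows "add_mset (fst \<Lambda> ! i) (raise (Suc i) \<Lambda>) = add_mset (Suc (fst \<Lambda> ! i)) (raise i \<Lambda>)"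
proof -
  have "drop i (fst \<Lambda>) = fst \<Lambda> ! i # drop (Suc i) (fst \<Lambda>)" using assms by (simp add: Cons_nth_drop_Suc)
  then show ?thesis using assms by (simp add: raise_def take_Suc_conv_app_nth)
qed

lemma size_raise: "size (raise i \<Lambda>) = length (fst \<Lambda>) + size (snd \<Lambda>)"
  by (simp add: raise_def flip: length_append)

text \<open>For i = m every entry of a has been raised and is positive, so both multisets are
  partitions without zeros and their lengths can be compared.\<close>

lemma mpart_le_size:
  assumes "mpart_le m \<Omega> \<Lambda>" "\<Omega> \<in> mparts m" "\<Lambda> \<in> mparts m"
  shows "size (snd \<Lambda>) \<le> size (snd \<Omega>)"
proof -
  have "0 \<notin># raise m E" if "E \<in> mparts m" for E
    using that by (auto simp: raise_def mparts_def)
  then have "size (raise m \<Lambda>) \<le> size (raise m \<Omega>)"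
    using assms by (intro size_le_if_dominated) (auto simp: mpart_le_def)
  then show ?thesis using assms(2,3) by (auto simp: size_raise mparts_def)
qed

text \<open>All raised multisets agree. Passing from \<open>raise i\<close> to
  \<open>raise (Suc i)\<close> replaces a_i by a_i + 1, so the entries of a can be
  recovered.\<close>

lemma mpart_le_antisym:
  assumes "mpart_le m \<Omega> \<Lambda>" "mpart_le m \<Lambda> \<Omega>" "\<Omega> \<in> mparts m" "\<Lambda> \<in> mparts m"
  shows "\<Omega> = \<Lambda>"
proof -
  have l: "length (fst \<Omega>) = m" "length (fst \<Lambda>) = m" using assms by (auto simp: mparts_def)
  have "size (snd \<Omega>) = size (snd \<Lambda>)" using mpart_le_size assms by (meson le_antisym)
  then have eq: "raise i \<Omega> = raise i \<Lambda>" if "i \<le> m" for i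
    using assms(1,2) that l by (intro dominated_antisym) (auto simp: mpart_le_def size_raise)
  have "fst \<Omega> ! i = fst \<Lambda> ! i" if "i < m" for i
  proof -
    define a b R S where "a = fst \<Omega> ! i" and "b = fst \<Lambda> ! i" and "R = raise i \<Lambda>" and "S = raise (Suc i) \<Lambda>"
    have "add_mset a S = add_mset (Suc a) R" "add_mset b S = add_mset (Suc b) R"
      using raise_Suc[of i \<Omega>] raise_Suc[of i \<Lambda>] eq[of i] eq[of "Suc i"] that l
      by (simp_all add: a_def b_def R_def S_def)
    from arg_cong[OF this(1), of "\<lambda>M. count M a"] arg_cong[OF this(2), of "\<lambda>M. count M a"]
    have "a = b" by (auto split: if_splits)
    then show ?thesis by (simp add: a_def b_def)
  qed
  then have "fst \<Omega> = fst \<Lambda>" using l by (intro nth_equalityI) auto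
  moreover from this have "snd \<Omega> = snd \<Lambda>" using eq[of 0] by (simp add: raise_def)
  ultimately show ?thesis by (simp add: prod_eq_iff)
qed

lemma dominated_trans: assumes "dominated X Y" "dominated Y Z" shows "dominated X Z"
  unfolding dominated_def
proof (intro conjI allI)
  show "sum_mset X = sum_mset Z" using assms by (simp add: dominated_def)
  fix k
  let ?s = "\<lambda>X. sum_list (take k (rev (sorted_list_of_multiset X)))"
  have "?s X \<le> ?s Y"
    "?s Y \<le> ?s Z"
    using assms by (simp_all add: dominated_def)
  then show "?s X \<le> ?s Z"
    by (rule order_trans)
qed

lemma mpart_le_trans: "mpart_le m E \<Omega> \<Longrightarrow> mpart_le m \<Omega> \<Lambda> \<Longrightarrow> mpart_le m E \<Lambda>"
  unfolding mpart_le_def using dominated_trans by blast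

definition below :: "nat \<Rightarrow> mpart \<Rightarrow> mpart set" where
  "below m \<Lambda> = {\<Omega>. \<Omega> \<in> mparts m \<and> mpart_le m \<Omega> \<Lambda> \<and> \<Omega> \<noteq> \<Lambda>}"

lemma size_le_sum_mset: "0 \<notin># l \<Longrightarrow> size l \<le> sum_mset (l :: nat multiset)"
  by (induction l) auto

lemma finite_below: "finite (below m \<Lambda>)"
proof -
  define d where "d = sum_mset (raise 0 \<Lambda>)"
  define A where "A = {a :: nat list. set a \<subseteq> {..d} \<and> length a = m}"
  define L where "L = mset ` {xs :: nat list. set xs \<subseteq> {..d} \<and> length xs \<le> d}"
  have "finite (A \<times> L)" unfolding A_def L_def
    by (intro finite_cartesian_product finite_imageI finite_lists_length_eq finite_lists_length_le) auto
  moreover have "below m \<Lambda> \<subseteq> A \<times> L"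
  proof
    fix \<Omega> assume "\<Omega> \<in> below m \<Lambda>"
    then have \<Omega>: "length (fst \<Omega>) = m" "0 \<notin># snd \<Omega>" and "dominated (raise 0 \<Omega>) (raise 0 \<Lambda>)"
      by (auto simp: below_def mparts_def mpart_le_def)
    then have s: "sum_list (fst \<Omega>) + sum_mset (snd \<Omega>) = d"
      by (simp add: dominated_def d_def raise_def sum_mset_sum_list)
    have "x \<le> d" if "x \<in> set (fst \<Omega>)" for x
      using member_le_sum_list[OF that] s by simp
    then have "fst \<Omega> \<in> A" using \<Omega> by (auto simp: A_def)
    moreover have "snd \<Omega> \<in> L"
    proof -
      have "x \<le> d" if "x \<in># snd \<Omega>" for x
        using sum_mset.remove[OF that] s by simp
      moreover have "size (snd \<Omega>) \<le> d" using size_le_sum_mset[OF \<Omega>(2)] s by simp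
      ultimately show ?thesis unfolding L_def
        by (intro image_eqI[of _ _ "sorted_list_of_multiset (snd \<Omega>)"])
          (auto simp: length_sorted_list_of_multiset)
    qed
    ultimately show "\<Omega> \<in> A \<times> L" by (simp add: mem_Times_iff)
  qed
  ultimately show ?thesis by (rule finite_subset[rotated])
qed

lemma below_psubset:
  assumes "\<Lambda> \<in> mparts m" "\<Omega> \<in> below m \<Lambda>" shows "below m \<Omega> \<subset> below m \<Lambda>"
proof
  have \<Omega>: "\<Omega> \<in> mparts m" "mpart_le m \<Omega> \<Lambda>" "\<Omega> \<noteq> \<Lambda>" using assms(2) by (auto simp: below_def)
  show "below m \<Omega> \<subseteq> below m \<Lambda>"
  proof
    fix E assume "E \<in> below m \<Omega>"
    then have E: "E \<in> mparts m" "mpart_le m E \<Omega>" "E \<noteq> \<Omega>" by (auto simp: below_def)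
    moreover have "E \<noteq> \<Lambda>" using mpart_le_antisym[OF E(2) _ E(1) \<Omega>(1)] \<Omega> E(3) by blast
    ultimately show "E \<in> below m \<Lambda>" using mpart_le_trans \<Omega>(2) unfolding below_def by blast
  qed
  show "below m \<Omega> \<noteq> below m \<Lambda>" using assms(2) by (auto simp: below_def)
qed

lemma below_induct [consumes 1, case_names less]:
  assumes "\<Lambda> \<in> mparts m"
    and "\<And>\<Lambda>. \<Lambda> \<in> mparts m \<Longrightarrow> (\<And>\<Omega>. \<Omega> \<in> below m \<Lambda> \<Longrightarrow> Q \<Omega>) \<Longrightarrow> Q \<Lambda>"
  shows "Q \<Lambda>"
  using assms(1)
proof (induction "card (below m \<Lambda>)" arbitrary: \<Lambda> rule: less_induct)
  case less
  show ?case
  proof (rule assms(2)[OF less.prems])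
    fix \<Omega> assume \<Omega>: "\<Omega> \<in> below m \<Lambda>"
    then have "\<Omega> \<in> mparts m" by (simp add: below_def)
    moreover have "card (below m \<Omega>) < card (below m \<Lambda>)"
      by (rule psubset_card_mono[OF finite_below below_psubset[OF less.prems \<Omega>]])
    ultimately show "Q \<Omega>" by (intro less.hyps)
  qed
qed

section \<open>Coordinates\<close>

definition coord_supp :: "nat \<Rightarrow> (mpart \<Rightarrow> Qqt pseries) \<Rightarrow> Qqt pseries \<Rightarrow> mpart set" where
  "coord_supp m B f = {\<Lambda> \<in> mparts m. coord m B f \<Lambda> \<noteq> 0}"

abbreviation "pcoord m \<equiv> coord m mpowersum"
abbreviation "psupp m \<equiv> coord_supp m mpowersum"

lemma coord_supp_subset: "coord_supp m B f \<subseteq> mparts m"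
  by (auto simp: coord_supp_def)

lemma coord_nonzero_in_span:
  "coord m B f \<Lambda> \<noteq> 0 \<Longrightarrow> f \<in> ps.span (B ` mparts m)"
  unfolding coord_def ps.representation_def by (auto split: if_splits)

lemma finite_coord_supp: assumes "inj_on B (mparts m)" shows "finite (coord_supp m B f)"
proof -
  have "finite (B ` coord_supp m B f)"
    by (rule finite_subset[OF _ ps.finite_representation[of "B ` mparts m" f]])
      (auto simp: coord_supp_def coord_def)
  moreover have "inj_on B (coord_supp m B f)" using assms coord_supp_subset by (rule inj_on_subset)
  ultimately show ?thesis by (rule finite_imageD)
qed

lemma coord_expansion:
  assumes "is_basis_of_Rm m B" "f \<in> Rm m"
  shows "f = (\<Sum>\<Lambda>\<in>coord_supp m B f. pscale (coord m B f \<Lambda>) (B \<Lambda>))"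
proof -
  have B: "inj_on B (mparts m)" "ps.independent (B ` mparts m)" "f \<in> ps.span (B ` mparts m)"
    using assms by (auto simp: is_basis_of_Rm_def)
  have "f = (\<Sum>b | ps.representation (B ` mparts m) f b \<noteq> 0. pscale (ps.representation (B ` mparts m) f b) b)"
    using ps.sum_nonzero_representation_eq[OF B(2,3)] by simp
  also have "{b. ps.representation (B ` mparts m) f b \<noteq> 0} = B ` coord_supp m B f"
    using ps.representation_ne_zero[of "B ` mparts m" f] by (auto simp: coord_supp_def coord_def)
  also have "(\<Sum>b\<in>B ` coord_supp m B f. pscale (ps.representation (B ` mparts m) f b) b)
      = (\<Sum>\<Lambda>\<in>coord_supp m B f. pscale (coord m B f \<Lambda>) (B \<Lambda>))"
    using inj_on_subset[OF B(1) coord_supp_subset] by (simp add: sum.reindex coord_def)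
  finally show ?thesis .
qed

lemma coord_sum:
  assumes "is_basis_of_Rm m B" "\<And>i. i \<in> F \<Longrightarrow> f i \<in> Rm m"
  shows "coord m B (\<Sum>i\<in>F. pscale (c i) (f i)) \<Lambda> = (\<Sum>i\<in>F. c i * coord m B (f i) \<Lambda>)"
proof -
  have B: "ps.independent (B ` mparts m)" "\<And>i. i \<in> F \<Longrightarrow> f i \<in> ps.span (B ` mparts m)"
    using assms by (auto simp: is_basis_of_Rm_def)
  then show ?thesis unfolding coord_def
    by (subst ps.representation_sum) (auto simp: ps.representation_scale ps.span_scale)
qed

lemma coord_basis:
  assumes "is_basis_of_Rm m B" "\<Lambda> \<in> mparts m" "\<Omega> \<in> mparts m"
  shows "coord m B (B \<Omega>) \<Lambda> = (if \<Lambda> = \<Omega> then 1 else 0)"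
  using assms unfolding coord_def is_basis_of_Rm_def
  by (subst ps.representation_basis) (auto dest: inj_onD)

lemma basis_in_Rm: "is_basis_of_Rm m B \<Longrightarrow> \<Lambda> \<in> mparts m \<Longrightarrow> B \<Lambda> \<in> Rm m"
  unfolding is_basis_of_Rm_def using ps.span_base by blast

lemma coord_combination:
  assumes "is_basis_of_Rm m B" "finite F" "F \<subseteq> mparts m" "\<Lambda> \<in> mparts m"
  shows "coord m B (\<Sum>\<Omega>\<in>F. pscale (c \<Omega>) (B \<Omega>)) \<Lambda> = (if \<Lambda> \<in> F then c \<Lambda> else 0)"
proof -
  have "coord m B (\<Sum>\<Omega>\<in>F. pscale (c \<Omega>) (B \<Omega>)) \<Lambda> = (\<Sum>\<Omega>\<in>F. c \<Omega> * coord m B (B \<Omega>) \<Lambda>)"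
    using assms by (intro coord_sum) (auto intro: basis_in_Rm)
  also have "\<dots> = (\<Sum>\<Omega>\<in>F. if \<Omega> = \<Lambda> then c \<Omega> else 0)"
    using assms by (intro sum.cong) (auto simp: coord_basis subsetD)
  finally show ?thesis using assms by simp
qed

lemma subspace_Rm: "ps.subspace (Rm m)"
  unfolding ps.subspace_def
proof (intro conjI ballI allI)
  show "0 \<in> Rm m" by (auto simp: Rm_def)
  show "f + g \<in> Rm m" if fg: "f \<in> Rm m" "g \<in> Rm m" for f g
  proof -
    obtain d e where "\<And>M. pcoeff f M \<noteq> 0 \<Longrightarrow> size M \<le> d" "\<And>M. pcoeff g M \<noteq> 0 \<Longrightarrow> size M \<le> e"
      using fg by (auto simp: Rm_def)
    note de = this
    have "size M \<le> max d e" if "pcoeff (f + g) M \<noteq> 0" for M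
    proof -
      have "pcoeff f M \<noteq> 0 \<or> pcoeff g M \<noteq> 0" using that by auto
      then show ?thesis using de[of M] by (auto simp: le_max_iff_disj)
    qed
    then show ?thesis using fg by (auto simp: Rm_iff permute_vars_add)
  qed
  show "pscale c f \<in> Rm m" if "f \<in> Rm m" for c f
    using that by (auto simp: Rm_iff permute_vars_scale)
qed

text \<open>Inherited from t = 1, where the Hecke polynomials are monomials.\<close>

lemma mpowersum_independent:
  assumes "finite F" "F \<subseteq> mparts m" "(\<Sum>E\<in>F. pscale (c E) (mpowersum E)) = 0" "E \<in> F"
  shows "c E = 0"
  by (rule independent_lifts[OF assms(1) pspec1_mpowersum mpowersum1_independent[OF assms(1,2)] assms(3,4)])

lemma inj_on_mpowersum: "inj_on mpowersum (mparts m)"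
proof (rule inj_onI, rule ccontr)
  fix \<Lambda> \<Omega> assume *: "\<Lambda> \<in> mparts m" "\<Omega> \<in> mparts m" "mpowersum \<Lambda> = mpowersum \<Omega>" "\<Lambda> \<noteq> \<Omega>"
  let ?c = "\<lambda>E. if E = \<Lambda> then 1 else - 1 :: Qqt"
  have "(\<Sum>E\<in>{\<Lambda>, \<Omega>}. pscale (?c E) (mpowersum E)) = 0"
    using * by simp
  from mpowersum_independent[OF _ _ this, of m \<Lambda>] * show False by simp
qed

lemma independent_mpowersum: "ps.independent (mpowersum ` mparts m)"
proof
  assume "ps.dependent (mpowersum ` mparts m)"
  then obtain U u v where U: "finite U" "U \<subseteq> mpowersum ` mparts m" "v \<in> U" "u v \<noteq> 0"
    "(\<Sum>v\<in>U. pscale (u v) v) = 0" unfolding ps.dependent_explicit by blast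
  obtain F where F: "F \<subseteq> mparts m" "finite F" "U = mpowersum ` F"
    using finite_subset_image[OF U(1,2)] by blast
  have "(\<Sum>E\<in>F. pscale (u (mpowersum E)) (mpowersum E)) = 0"
    using U(5) inj_on_subset[OF inj_on_mpowersum F(1)] unfolding F(3) by (simp add: sum.reindex)
  from mpowersum_independent[OF F(2,1) this] U(3,4) F(3) show False by auto
qed

section \<open>The bilinear forms\<close>

lemma powersum_form_eq:
  assumes "finite F" "psupp m f \<subseteq> F" "F \<subseteq> mparts m"
  shows "powersum_form m w f g
    = (\<Sum>E\<in>F. pcoord m f E * pcoord m g E * w E)"
proof -
  have "powersum_form m w f g
      = (\<Sum>E\<in>psupp m f. pcoord m f E * pcoord m g E * w E)"
    by (simp add: powersum_form_def coord_supp_def)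
  also have "\<dots> = (\<Sum>E\<in>F. pcoord m f E * pcoord m g E * w E)"
    by (rule sum.mono_neutral_left) (use assms in \<open>auto simp: coord_supp_def\<close>)
  finally show ?thesis .
qed

lemma powersum_form_commute: "powersum_form m w f g = powersum_form m w g f"
proof -
  let ?F = "psupp m f \<union> psupp m g"
  have F: "finite ?F" "?F \<subseteq> mparts m"
    using finite_coord_supp[OF inj_on_mpowersum] coord_supp_subset by auto
  show ?thesis
    using powersum_form_eq[OF F(1) _ F(2), of f w g] powersum_form_eq[OF F(1) _ F(2), of g w f]
    by (simp add: mult.commute)
qed

lemma powersum_form_sum_left:
  assumes "is_basis_of_Rm m mpowersum" "finite A" "\<And>i. i \<in> A \<Longrightarrow> f i \<in> Rm m"
  shows "powersum_form m w (\<Sum>i\<in>A. pscale (c i) (f i)) g = (\<Sum>i\<in>A. c i * powersum_form m w (f i) g)"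
proof -
  let ?h = "\<Sum>i\<in>A. pscale (c i) (f i)"
  let ?F = "psupp m ?h \<union> (\<Union>i\<in>A. psupp m (f i))"
  have F: "finite ?F" "?F \<subseteq> mparts m"
    using finite_coord_supp[OF inj_on_mpowersum] assms(2) coord_supp_subset by (blast, blast)
  have "powersum_form m w ?h g
      = (\<Sum>E\<in>?F. (\<Sum>i\<in>A. c i * pcoord m (f i) E) * pcoord m g E * w E)"
    using powersum_form_eq[OF F(1) _ F(2), of ?h w g] by (simp add: coord_sum[OF assms(1,3)])
  also have "\<dots> = (\<Sum>i\<in>A. c i * (\<Sum>E\<in>?F. pcoord m (f i) E * pcoord m g E * w E))"
    unfolding sum_distrib_right sum_distrib_left by (subst sum.swap) (simp add: mult.assoc)
  also have "\<dots> = (\<Sum>i\<in>A. c i * powersum_form m w (f i) g)"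
    using F by (intro sum.cong refl arg_cong2[where f = "(*)"] powersum_form_eq[symmetric]) auto
  finally show ?thesis .
qed

lemma powersum_form_sum_right:
  assumes "is_basis_of_Rm m mpowersum" "finite A" "\<And>i. i \<in> A \<Longrightarrow> f i \<in> Rm m"
  shows "powersum_form m w g (\<Sum>i\<in>A. pscale (c i) (f i)) = (\<Sum>i\<in>A. c i * powersum_form m w g (f i))"
  using powersum_form_sum_left[OF assms] by (simp add: powersum_form_commute[of m w g])

text \<open>Outside the span all coordinates are 0 by convention, so a nonzero value of the form
  certifies membership in the span.\<close>

lemma powersum_form_nonzero:
  assumes "powersum_form m w f g \<noteq> 0"
  shows "f \<in> ps.span (mpowersum ` mparts m)" "g \<in> ps.span (mpowersum ` mparts m)"
proof -
  obtain E where "pcoord m f E * pcoord m g E * w E \<noteq> 0"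
    using assms unfolding powersum_form_def by (meson sum.not_neutral_contains_not_neutral)
  then show "f \<in> ps.span (mpowersum ` mparts m)" "g \<in> ps.span (mpowersum ` mparts m)"
    using coord_nonzero_in_span[of m mpowersum f E] coord_nonzero_in_span[of m mpowersum g E] by auto
qed

section \<open>Norms of the power sums and their poles\<close>

definition qt_weight :: "mpart \<Rightarrow> Qqt" where
  "qt_weight \<Lambda> = qv ^ sum_list (fst \<Lambda>) * tv ^ inversions (fst \<Lambda>) * of_nat (zee (snd \<Lambda>)) *
     (\<Prod>r\<in>#snd \<Lambda>. (1 - qv ^ r) / (1 - tv ^ r))"

definition t_weight :: "mpart \<Rightarrow> Qqt" where
  "t_weight \<Lambda> = tv ^ inversions (fst \<Lambda>) * of_nat (zee (snd \<Lambda>))"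

lemma form_qt_eq: "form_qt m = powersum_form m qt_weight"
  unfolding form_qt_def by (rule arg_cong[of _ _ "powersum_form m"]) (auto simp: qt_weight_def)

lemma form_m_eq: "form_m m = powersum_form m t_weight"
  unfolding form_m_def by (rule arg_cong[of _ _ "powersum_form m"]) (auto simp: t_weight_def)

abbreviation q1 :: Qq where "q1 \<equiv> Fract [:0, 1:] 1"

definition qt_weight1 :: "mpart \<Rightarrow> Qq" where
  "qt_weight1 \<Lambda> = q1 ^ sum_list (fst \<Lambda>) * of_nat (zee (snd \<Lambda>)) * (\<Prod>r\<in>#snd \<Lambda>. (1 - q1 ^ r) / of_nat r)"

text \<open>The quotient of 1 - t^r by 1 - t is 1 + t + ... + t^(r-1), with value r at t = 1. Each
  part of the partition thus accounts for one order of the pole.\<close>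

lemma qt_weight_spec1:
  assumes "0 \<notin># snd \<Lambda>"
  shows "spec1 ((1 - tv) ^ size (snd \<Lambda>) * qt_weight \<Lambda>) (qt_weight1 \<Lambda>)"
proof -
  let ?g = "\<lambda>r. (1 - qv ^ r) / (\<Sum>i<r. tv ^ i)"
  have "(1 - tv) ^ size l * (\<Prod>r\<in>#l. (1 - qv ^ r) / (1 - tv ^ r)) = (\<Prod>r\<in>#l. ?g r)" for l
  proof (induction l)
    case (add r l)
    have "(1 - tv) * ((1 - qv ^ r) / (1 - tv ^ r)) = ?g r"
      unfolding geometric_one_minus[of tv r] by simp
    note step = this
    have "(1 - tv) ^ size (add_mset r l) * (\<Prod>r\<in>#add_mset r l. (1 - qv ^ r) / (1 - tv ^ r))
        = (1 - tv) * ((1 - qv ^ r) / (1 - tv ^ r)) * ((1 - tv) ^ size l * (\<Prod>r\<in>#l. (1 - qv ^ r) / (1 - tv ^ r)))"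
      by (simp only: size_add_mset power_Suc image_mset_add_mset prod_mset.add_mset mult_ac)
    then show ?case unfolding step add.IH by simp
  qed simp
  note P = this[of "snd \<Lambda>", symmetric]
  have "(1 - tv) ^ size (snd \<Lambda>) * qt_weight \<Lambda>
      = qv ^ sum_list (fst \<Lambda>) * tv ^ inversions (fst \<Lambda>) * of_nat (zee (snd \<Lambda>)) * (\<Prod>r\<in>#snd \<Lambda>. ?g r)"
    unfolding qt_weight_def P by (simp only: mult_ac)
  moreover have "spec1 (qv ^ sum_list (fst \<Lambda>) * tv ^ inversions (fst \<Lambda>) * of_nat (zee (snd \<Lambda>)) * (\<Prod>r\<in>#snd \<Lambda>. ?g r))
      (q1 ^ sum_list (fst \<Lambda>) * 1 ^ inversions (fst \<Lambda>) * of_nat (zee (snd \<Lambda>)) * (\<Prod>r\<in>#snd \<Lambda>. (1 - q1 ^ r) / (\<Sum>i<r. 1 ^ i)))"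
  proof (intro spec1_mult spec1_power spec1_prod_mset spec1_divide
      spec1_diff spec1_sum spec1_qv spec1_tv spec1_1 spec1_of_nat)
    fix r assume "r \<in># snd \<Lambda>"
    then have "r \<noteq> 0" using assms by metis
    then show "(\<Sum>i<r. 1 ^ i :: Qq) \<noteq> 0" by simp
  qed
  ultimately show ?thesis by (simp add: qt_weight1_def)
qed

lemma q1_neq_0: "q1 \<noteq> 0"
  by (simp add: Zero_fract_def eq_fract)

lemma prod_mset_nonzero: "(\<And>r. r \<in># l \<Longrightarrow> f r \<noteq> 0) \<Longrightarrow> (\<Prod>r\<in>#l. f r) \<noteq> (0 :: 'a::field)"
  by (induction l) auto

lemma qt_weight1_nonzero: assumes "0 \<notin># snd \<Lambda>" shows "qt_weight1 \<Lambda> \<noteq> 0"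
proof -
  have pos: "r > 0" if "r \<in># snd \<Lambda>" for r using that assms by (metis neq0_conv)
  then have "zee (snd \<Lambda>) \<noteq> 0" by (auto simp: zee_def)
  moreover have "(\<Prod>r\<in>#snd \<Lambda>. (1 - q1 ^ r) / of_nat r) \<noteq> 0"
  proof (rule prod_mset_nonzero)
    fix r assume "r \<in># snd \<Lambda>"
    then show "(1 - q1 ^ r) / of_nat r \<noteq> 0"
      using pos[of r] qv_power_specialized_neq_1[of r] by simp
  qed
  ultimately show ?thesis using q1_neq_0 by (simp add: qt_weight1_def)
qed

lemma tv_neq_0: "tv \<noteq> 0"
  using spec1_unique[OF spec1_tv, of 0] by auto

text \<open>The pairing of \<open>s \<Lambda>\<close> with \<open>dual_schur \<Lambda>\<close> is a
  power of t, hence nonzero, which puts both into the span of the power sums. As s spans the ring,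
  so do the power sums.\<close>

lemma schur_basis_imp:
  assumes "is_schur_basis m s"
  shows is_basis_mpowersum: "is_basis_of_Rm m mpowersum"
    and dual_schur_in_Rm: "\<Lambda> \<in> mparts m \<Longrightarrow> dual_schur \<Lambda> \<in> Rm m"
proof -
  let ?V = "ps.span (mpowersum ` mparts m)"
  have s: "ps.span (s ` mparts m) = Rm m" using assms by (simp add: is_schur_basis_def is_basis_of_Rm_def)
  have in_V: "s \<Lambda> \<in> ?V" "dual_schur \<Lambda> \<in> ?V" if "\<Lambda> \<in> mparts m" for \<Lambda>
  proof -
    have "form_m m (s \<Lambda>) (dual_schur \<Lambda>) \<noteq> 0" using assms that tv_neq_0 by (simp add: is_schur_basis_def)
    then show "s \<Lambda> \<in> ?V" "dual_schur \<Lambda> \<in> ?V" unfolding form_m_eq by (rule powersum_form_nonzero)+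
  qed
  have "Rm m \<subseteq> ?V" unfolding s[symmetric] using in_V by (intro ps.span_minimal) (auto simp: ps.subspace_span)
  moreover have "?V \<subseteq> Rm m" using mpowersum_in_Rm by (intro ps.span_minimal subspace_Rm) auto
  ultimately have V: "?V = Rm m" by simp
  then show "is_basis_of_Rm m mpowersum"
    by (simp add: is_basis_of_Rm_def inj_on_mpowersum independent_mpowersum)
  show "\<Lambda> \<in> mparts m \<Longrightarrow> dual_schur \<Lambda> \<in> Rm m" using in_V V by auto
qed

lemma coord_mpowersum_spec1:
  assumes "is_basis_of_Rm m mpowersum" "f \<in> Rm m" "pspec1 f f'"
  obtains c' where "\<And>E. E \<in> psupp m f \<Longrightarrow> spec1 (pcoord m f E) (c' E)"
    "f' = (\<Sum>E\<in>psupp m f. pscale (c' E) (mpowersum1 E))"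
proof (rule coefficients_specialize[of "psupp m f" mpowersum mpowersum1 "pcoord m f" f'])
  show fin: "finite (psupp m f)" by (rule finite_coord_supp[OF inj_on_mpowersum])
  show "\<And>c. (\<Sum>i\<in>psupp m f. pscale (c i) (mpowersum1 i)) = 0 \<Longrightarrow>
      \<forall>i\<in>psupp m f. c i = 0"
    by (rule mpowersum1_independent[OF fin coord_supp_subset])
  show "pspec1 (\<Sum>i\<in>psupp m f. pscale (pcoord m f i) (mpowersum i)) f'"
    using coord_expansion[OF assms(1,2)] assms(3) by simp
qed (use that in \<open>auto simp: pspec1_mpowersum\<close>)

section \<open>Expansion of monomials in power sums\<close>

lemma pcoeff_xpow_sum:
  assumes "finite J" "J \<subseteq> mparts m" "\<And>E. E \<in> J \<Longrightarrow> snd E = \<mu>" "\<Lambda> \<in> J"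
  shows "pcoeff (\<Sum>E\<in>J. pscale (c E) (xpow (fst E))) (expo (fst \<Lambda>)) = c \<Lambda>"
proof -
  have "pcoeff (\<Sum>E\<in>J. pscale (c E) (xpow (fst E))) (expo (fst \<Lambda>)) = (\<Sum>E\<in>J. if E = \<Lambda> then c E else 0)"
    unfolding pcoeff_sum
  proof (rule sum.cong[OF refl])
    fix E assume E: "E \<in> J"
    then have "E \<in> mparts m" "\<Lambda> \<in> mparts m" using assms(2,4) by auto
    then have "length (fst E) = length (fst \<Lambda>)" by (auto simp: mparts_def)
    then have "expo (fst \<Lambda>) = expo (fst E) \<longleftrightarrow> E = \<Lambda>"
      using assms(3)[OF E] assms(3)[OF assms(4)] by (auto simp: expo_inject prod_eq_iff)
    then show "pcoeff (pscale (c E) (xpow (fst E))) (expo (fst \<Lambda>)) = (if E = \<Lambda> then c E else 0)"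
      by (simp add: xpow_eq_pmono pcoeff_pmono)
  qed
  then show ?thesis using assms(1,4) by simp
qed

lemma xpow_independent:
  assumes "finite J" "J \<subseteq> mparts m" "\<And>E. E \<in> J \<Longrightarrow> snd E = \<mu>"
    and "(\<Sum>E\<in>J. pscale (c E) (xpow (fst E))) = 0"
  shows "\<forall>E\<in>J. c E = 0"
  using pcoeff_xpow_sum[OF assms(1,2,3), of _ c] assms(4) by simp

text \<open>The leading coefficient at t = 1 of the norm of m_\<Lambda>, whose coordinate at
  p_\<Lambda> becomes 1 / \<open>mult_fact\<close>.\<close>

definition mono_norm :: "mpart \<Rightarrow> Qq" where
  "mono_norm \<Lambda> = (1 / of_nat (mult_fact (snd \<Lambda>)))\<^sup>2 * qt_weight1 \<Lambda>"

context
  fixes m :: nat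
  assumes bp: "is_basis_of_Rm m mpowersum" and mono_in_Rm: "\<And>\<Lambda>. \<Lambda> \<in> mparts m \<Longrightarrow> mmonomial \<Lambda> \<in> Rm m"
begin

abbreviation "mono_coord \<Lambda> \<equiv> pcoord m (mmonomial \<Lambda>)"
abbreviation "mono_supp \<Lambda> \<equiv> psupp m (mmonomial \<Lambda>)"

lemma mono_supp: "finite (mono_supp \<Lambda>)" "mono_supp \<Lambda> \<subseteq> mparts m"
  by (rule finite_coord_supp[OF inj_on_mpowersum], rule coord_supp_subset)

text \<open>Compares the coefficients of one leading monomial in the expansion of m_\<Lambda> in
  power sums. The premise \<open>top\<close> excludes terms with more parts than \<mu>, which
  \<open>pcoeff_lead\<close> does not control.\<close>

lemma mono_lead_coeff:
  assumes "\<Lambda> \<in> mparts m" and F: "finite F" "mono_supp \<Lambda> \<subseteq> F" "F \<subseteq> mparts m" and b: "(b, \<mu>) \<in> mparts m"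
    and top: "\<And>E. E \<in> mono_supp \<Lambda> \<Longrightarrow> size (snd E) \<le> size \<mu>"
  shows "of_nat (mult_fact \<mu>) * pcoeff (\<Sum>E | E \<in> F \<and> snd E = \<mu>.
      pscale (mono_coord \<Lambda> E) (hecke_extend xpow (fst E))) (expo b) = (if \<Lambda> = (b, \<mu>) then 1 else 0)"
proof -
  have "mmonomial \<Lambda> = (\<Sum>E\<in>mono_supp \<Lambda>. pscale (mono_coord \<Lambda> E) (mpowersum E))"
    by (rule coord_expansion[OF bp mono_in_Rm[OF assms(1)]])
  also have "\<dots> = (\<Sum>E\<in>F. pscale (mono_coord \<Lambda> E) (hecke_extend xpow (fst E) * powersum_part (snd E)))"
  proof (rule sum.mono_neutral_cong_left[OF F(1,2)])
    show "\<forall>E\<in>F - mono_supp \<Lambda>. pscale (mono_coord \<Lambda> E) (hecke_extend xpow (fst E) * powersum_part (snd E)) = 0"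
      using F(3) by (auto simp: coord_supp_def)
    show "pscale (mono_coord \<Lambda> E) (mpowersum E)
        = pscale (mono_coord \<Lambda> E) (hecke_extend xpow (fst E) * powersum_part (snd E))" for E
      by (rule arg_cong[OF mpowersum_def])
  qed
  finally have eq: "mmonomial \<Lambda> = \<dots>" .
  have "pcoeff (mmonomial \<Lambda>) (lead (b, \<mu>)) = of_nat (mult_fact \<mu>) *
      (\<Sum>E | E \<in> F \<and> snd E = \<mu>. mono_coord \<Lambda> E * pcoeff (hecke_extend xpow (fst E)) (expo b))"
  proof (subst eq, rule pcoeff_lead_sum[OF _ F(1,3) b])
    show "\<exists>d. poly_in m d (hecke_extend xpow a)" if "length a = m" for a
      using poly_in_hecke_xpow[of a] that by auto
    show "size (snd E) \<le> size \<mu>" if "E \<in> F" "mono_coord \<Lambda> E \<noteq> 0" for E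
      using top[of E] that F(3) by (auto simp: coord_supp_def)
  qed
  then show ?thesis using pcoeff_mmonomial_lead[OF assms(1) b] by simp
qed

lemma hecke_sum_eqI:
  assumes "J \<subseteq> mparts m" and v: "\<And>b. length b = m \<Longrightarrow>
      pcoeff (\<Sum>E\<in>J. pscale (c E) (hecke_extend xpow (fst E))) (expo b) = pcoeff (pscale v (xpow a)) (expo b)"
    and "length a = m"
  shows "(\<Sum>E\<in>J. pscale (c E) (hecke_extend xpow (fst E))) = pscale v (xpow a)"
proof (rule pseries_eqI)
  fix M
  show "pcoeff (\<Sum>E\<in>J. pscale (c E) (hecke_extend xpow (fst E))) M = pcoeff (pscale v (xpow a)) M"
  proof (cases "set_mset M \<subseteq> {..<m}")
    case True
    then obtain b where "length b = m" "M = expo b" by (rule expo_surj)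
    then show ?thesis using v by simp
  next
    case False
    have "pcoeff (hecke_extend xpow (fst E)) M = 0" if "E \<in> J" for E
    proof -
      have "E \<in> mparts m" using that assms(1) by auto
      then have "length (fst E) = m" by (auto simp: mparts_def)
      then show ?thesis using poly_in_hecke_xpow[of "fst E"] False unfolding poly_in_def by blast
    qed
    moreover have "pcoeff (xpow a) M = (0 :: Qqt)"
      using poly_in_xpow[of a] assms(3) False by (auto simp: poly_in_def)
    ultimately show ?thesis by simp
  qed
qed

text \<open>Otherwise the combination of Hecke polynomials that multiplies p_\<mu>, for \<mu> of
  maximal length, has only zero coefficients, against the independence of the Hecke
  polynomials.\<close>

lemma mono_supp_max:
  assumes "\<Lambda> \<in> mparts m" "E1 \<in> mono_supp \<Lambda>"
    and top: "\<And>E. E \<in> mono_supp \<Lambda> \<Longrightarrow> size (snd E) \<le> size (snd E1)"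
  shows "snd E1 = snd \<Lambda>"
proof (rule ccontr)
  assume neq: "snd E1 \<noteq> snd \<Lambda>"
  define \<mu> where "\<mu> = snd E1"
  have E1: "E1 \<in> mparts m" using assms(2) mono_supp(2) by blast
  let ?J = "{E. E \<in> mono_supp \<Lambda> \<and> snd E = \<mu>}"
  have J: "finite ?J" "?J \<subseteq> mparts m" using mono_supp(1)[of \<Lambda>] mono_supp(2)[of \<Lambda>] by auto
  have "(\<Sum>E\<in>?J. pscale (mono_coord \<Lambda> E) (hecke_extend xpow (fst E))) = pscale 0 (xpow (fst E1))"
  proof (rule hecke_sum_eqI[OF J(2)])
    fix b :: "nat list" assume "length b = m"
    then have b: "(b, \<mu>) \<in> mparts m" using E1 by (auto simp: mparts_def \<mu>_def)
    have "of_nat (mult_fact \<mu>) * pcoeff (\<Sum>E\<in>?J. pscale (mono_coord \<Lambda> E) (hecke_extend xpow (fst E))) (expo b) = 0"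
      using mono_lead_coeff[OF assms(1) mono_supp(1) _ mono_supp(2) b] top neq by (auto simp: \<mu>_def)
    then show "pcoeff (\<Sum>E\<in>?J. pscale (mono_coord \<Lambda> E) (hecke_extend xpow (fst E))) (expo b)
        = pcoeff (pscale 0 (xpow (fst E1))) (expo b)"
      using mult_fact_pos[of \<mu>] by simp
  qed (use E1 in \<open>auto simp: mparts_def\<close>)
  then have z: "(\<Sum>E\<in>?J. pscale (mono_coord \<Lambda> E) (hecke_extend xpow (fst E))) = 0" by simp
  have "mono_coord \<Lambda> E1 = 0"
  proof (rule independent_lifts[OF J(1) pspec1_hecke_xpow _ z])
    show "\<And>c. (\<Sum>E\<in>?J. pscale (c E) (xpow (fst E))) = 0 \<Longrightarrow> \<forall>E\<in>?J. c E = (0 :: Qq)"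
      by (rule xpow_independent[OF J]) auto
    show "E1 \<in> ?J" using assms(2) by (simp add: \<mu>_def)
  qed
  then show False using assms(2) by (simp add: coord_supp_def)
qed

lemma mono_supp_cases:
  assumes "\<Lambda> \<in> mparts m" "E \<in> mono_supp \<Lambda>"
  shows "size (snd E) < size (snd \<Lambda>) \<or> snd E = snd \<Lambda>"
proof -
  define K where "K = Max ((\<lambda>E. size (snd E)) ` mono_supp \<Lambda>)"
  have "K \<in> (\<lambda>E. size (snd E)) ` mono_supp \<Lambda>"
    unfolding K_def using mono_supp(1) assms(2) by (intro Max_in) auto
  then obtain E1 where 1: "E1 \<in> mono_supp \<Lambda>" "size (snd E1) = K" by auto
  have le: "size (snd \<Delta>) \<le> K" if "\<Delta> \<in> mono_supp \<Lambda>" for \<Delta>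
    unfolding K_def using mono_supp(1) that by (intro Max_ge) auto
  have "K = size (snd \<Lambda>)" using mono_supp_max[OF assms(1) 1(1)] 1(2) le by simp
  moreover have "snd E = snd \<Lambda>" if "size (snd E) = K"
    using mono_supp_max[OF assms] le that by simp
  ultimately show ?thesis using le[OF assms(2)] by (cases "size (snd E) = K") auto
qed

text \<open>Over Q(q,t) the Hecke polynomials multiplying p_\<lambda> combine exactly to x^a /
  \<open>mult_fact\<close>. At t = 1 they become distinct monomials, so only the one for \<Lambda>
  keeps a nonzero coefficient.\<close>

lemma mono_coord_top:
  assumes "\<Lambda> \<in> mparts m" "E \<in> mparts m" "snd E = snd \<Lambda>"
  shows "spec1 (mono_coord \<Lambda> E) (if E = \<Lambda> then 1 / of_nat (mult_fact (snd \<Lambda>)) else 0)"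
proof -
  define \<mu> where "\<mu> = snd \<Lambda>"
  \<comment> \<open>E and \<Lambda> are included so that vanishing coordinates need no separate
    treatment.\<close>
  define F where "F = insert E (insert \<Lambda> (mono_supp \<Lambda>))"
  have F: "finite F" "mono_supp \<Lambda> \<subseteq> F" "F \<subseteq> mparts m" using mono_supp assms by (auto simp: F_def)
  let ?J = "{E. E \<in> F \<and> snd E = \<mu>}"
  let ?v = "1 / of_nat (mult_fact \<mu>)"
  have J: "finite ?J" "?J \<subseteq> mparts m" using F by auto
  have top: "size (snd \<Delta>) \<le> size \<mu>" if "\<Delta> \<in> mono_supp \<Lambda>" for \<Delta>
    using mono_supp_cases[OF assms(1) that] by (auto simp: \<mu>_def)
  have len: "length (fst \<Lambda>) = m" using assms by (auto simp: mparts_def)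
  have "(\<Sum>E\<in>?J. pscale (mono_coord \<Lambda> E) (hecke_extend xpow (fst E))) = pscale ?v (xpow (fst \<Lambda>))"
  proof (rule hecke_sum_eqI[OF J(2)])
    fix b :: "nat list" assume lb: "length b = m"
    then have b: "(b, \<mu>) \<in> mparts m" using assms by (auto simp: mparts_def \<mu>_def)
    have "of_nat (mult_fact \<mu>) * pcoeff (\<Sum>E\<in>?J. pscale (mono_coord \<Lambda> E) (hecke_extend xpow (fst E))) (expo b)
        = (if b = fst \<Lambda> then 1 else 0)"
      using mono_lead_coeff[OF assms(1) F b top] by (auto simp: \<mu>_def prod_eq_iff)
    moreover have "expo b = expo (fst \<Lambda>) \<longleftrightarrow> b = fst \<Lambda>" using expo_inject lb len by metis
    ultimately show "pcoeff (\<Sum>E\<in>?J. pscale (mono_coord \<Lambda> E) (hecke_extend xpow (fst E))) (expo b)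
        = pcoeff (pscale ?v (xpow (fst \<Lambda>))) (expo b)"
      using mult_fact_pos[of \<mu>] by (auto simp: xpow_eq_pmono pcoeff_pmono field_simps)
  qed (rule len)
  moreover have "pspec1 (pscale ?v (xpow (fst \<Lambda>))) (pscale ?v (xpow (fst \<Lambda>)))"
    using mult_fact_pos[of \<mu>]
    by (intro pspec1_scale spec1_divide spec1_1 spec1_of_nat pspec1_xpow) simp
  ultimately have sp: "pspec1 (\<Sum>E\<in>?J. pscale (mono_coord \<Lambda> E) (hecke_extend xpow (fst E)))
      (pscale ?v (xpow (fst \<Lambda>)))" by simp
  have "\<exists>c'. (\<forall>E\<in>?J. spec1 (mono_coord \<Lambda> E) (c' E)) \<and>
      pscale ?v (xpow (fst \<Lambda>)) = (\<Sum>E\<in>?J. pscale (c' E) (xpow (fst E)))"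
  proof (rule coefficients_specialize[OF J(1) pspec1_hecke_xpow _ sp])
    show "\<And>c. (\<Sum>E\<in>?J. pscale (c E) (xpow (fst E))) = 0 \<Longrightarrow> \<forall>E\<in>?J. c E = (0 :: Qq)"
      by (rule xpow_independent[OF J]) auto
  qed blast
  then obtain c' where c': "\<And>E. E \<in> ?J \<Longrightarrow> spec1 (mono_coord \<Lambda> E) (c' E)"
    "pscale ?v (xpow (fst \<Lambda>)) = (\<Sum>E\<in>?J. pscale (c' E) (xpow (fst E)))" by blast
  have E: "E \<in> ?J" using assms by (simp add: F_def \<mu>_def)
  have "c' E = pcoeff (pscale ?v (xpow (fst \<Lambda>))) (expo (fst E))"
    unfolding c'(2) by (rule pcoeff_xpow_sum[OF J _ E, symmetric]) simp
  also have "\<dots> = (if E = \<Lambda> then ?v else 0)"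
  proof -
    have "expo (fst E) = expo (fst \<Lambda>) \<longleftrightarrow> E = \<Lambda>"
      using assms by (auto simp: expo_inject mparts_def prod_eq_iff)
    then show ?thesis by (simp add: xpow_eq_pmono pcoeff_pmono)
  qed
  finally show ?thesis using c'(1)[OF E] unfolding \<mu>_def by (simp only:)
qed

lemma mono_coord_regular:
  assumes "\<Lambda> \<in> mparts m" "E \<in> mparts m" obtains v where "spec1 (mono_coord \<Lambda> E) v"
proof (cases "E \<in> mono_supp \<Lambda>")
  case True
  then show ?thesis
    using coord_mpowersum_spec1[OF bp mono_in_Rm[OF assms(1)] pspec1_mmonomial] that by metis
next
  case False
  then show ?thesis using that[of 0] assms by (simp add: coord_supp_def)
qed

section \<open>The Gram matrix of the monomials\<close>

text \<open>The contribution of p_E to the Gram entry. The pole of its norm has order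
  \<open>size (snd E)\<close>, at most k for E in both supports, so for equal lengths the leading
  order sees only E with the partition of \<Lambda> and of \<Omega>.\<close>

lemma gram_term:
  assumes \<Lambda>: "\<Lambda> \<in> mparts m" and \<Omega>: "\<Omega> \<in> mparts m" and E: "E \<in> mparts m"
    and k: "k = min (size (snd \<Lambda>)) (size (snd \<Omega>))"
  obtains v where "spec1 ((1 - tv) ^ k * (mono_coord \<Lambda> E * mono_coord \<Omega> E * qt_weight E)) v"
    "size (snd \<Lambda>) = size (snd \<Omega>) \<Longrightarrow> v = (if E = \<Lambda> \<and> E = \<Omega> then mono_norm \<Lambda> else 0)"
proof (cases "E \<in> mono_supp \<Lambda> \<and> E \<in> mono_supp \<Omega>")
  case False
  then have z: "mono_coord \<Lambda> E * mono_coord \<Omega> E = 0" using E by (auto simp: coord_supp_def)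
  have "\<not> (E = \<Lambda> \<and> E = \<Omega>)"
  proof
    assume *: "E = \<Lambda> \<and> E = \<Omega>"
    then have "\<Omega> = \<Lambda>" by blast
    with z * have "mono_coord \<Lambda> \<Lambda> = 0" by simp
    with mono_coord_top[OF \<Lambda> \<Lambda>] have "spec1 0 (1 / of_nat (mult_fact (snd \<Lambda>)) :: Qq)" by simp
    from spec1_unique[OF this spec1_0] show False using mult_fact_pos[of "snd \<Lambda>"] by simp
  qed
  then show ?thesis using z by (intro that[of 0]) auto
next
  case True
  have cases: "size (snd E) < size (snd \<Lambda>) \<or> snd E = snd \<Lambda>" "size (snd E) < size (snd \<Omega>) \<or> snd E = snd \<Omega>"
    using mono_supp_cases \<Lambda> \<Omega> True by auto
  define j where "j = size (snd E)"
  have jk: "j \<le> k" using cases by (auto simp: j_def k)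
  have w: "spec1 ((1 - tv) ^ j * qt_weight E) (qt_weight1 E)"
    unfolding j_def using E by (intro qt_weight_spec1) (auto simp: mparts_def)
  have eq: "(1 - tv) ^ k * (x * y * qt_weight E) = (1 - tv) ^ (k - j) * (x * y * ((1 - tv) ^ j * qt_weight E))" for x y
  proof -
    have "(1 - tv) ^ k = (1 - tv) ^ (k - j) * (1 - tv) ^ j" using jk by (simp flip: power_add)
    then show ?thesis by (simp add: mult_ac)
  qed
  \<comment> \<open>The power of 0 expresses that the term vanishes unless the pole has the full
    order k.\<close>
  have sp: "spec1 ((1 - tv) ^ k * (mono_coord \<Lambda> E * mono_coord \<Omega> E * qt_weight E))
      (0 ^ (k - j) * (x * y * qt_weight1 E))"
    if "spec1 (mono_coord \<Lambda> E) x" "spec1 (mono_coord \<Omega> E) y" for x y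
    unfolding eq by (intro spec1_mult spec1_power spec1_one_minus_tv that w)
  show ?thesis
  proof (cases "size (snd \<Lambda>) = size (snd \<Omega>) \<and> j = k")
    case True
    then have snd: "snd E = snd \<Lambda>" "snd E = snd \<Omega>" using cases by (auto simp: j_def k)
    let ?v = "1 / of_nat (mult_fact (snd E)) :: Qq"
    have "spec1 (mono_coord \<Lambda> E) (if E = \<Lambda> then ?v else 0)"
      "spec1 (mono_coord \<Omega> E) (if E = \<Omega> then ?v else 0)"
      by (rule mono_coord_top[OF \<Lambda> E snd(1), folded snd(1)],
          rule mono_coord_top[OF \<Omega> E snd(2), folded snd(2)])
    note sps = this
    have val: "0 ^ (k - j) * ((if E = \<Lambda> then ?v else 0) * (if E = \<Omega> then ?v else 0) * qt_weight1 E)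
        = (if E = \<Lambda> \<and> E = \<Omega> then mono_norm \<Lambda> else 0)"
      using True by (auto simp: mono_norm_def power2_eq_square)
    show ?thesis by (rule that[OF sp[OF sps, unfolded val] refl])
  next
    case False
    obtain x y where xy: "spec1 (mono_coord \<Lambda> E) x" "spec1 (mono_coord \<Omega> E) y"
      using mono_coord_regular[OF \<Lambda> E] mono_coord_regular[OF \<Omega> E] by metis
    show ?thesis
    proof (rule that[OF sp[OF xy]])
      assume "size (snd \<Lambda>) = size (snd \<Omega>)"
      then have "j < k" using False jk by simp
      moreover from this have "E \<noteq> \<Lambda>" by (auto simp: j_def k)
      ultimately show "0 ^ (k - j) * (x * y * qt_weight1 E) = (if E = \<Lambda> \<and> E = \<Omega> then mono_norm \<Lambda> else 0)"
        by simp
    qed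
  qed
qed

lemma gram:
  assumes \<Lambda>: "\<Lambda> \<in> mparts m" and \<Omega>: "\<Omega> \<in> mparts m"
    and k: "k = min (size (snd \<Lambda>)) (size (snd \<Omega>))"
  obtains v where "spec1 ((1 - tv) ^ k * form_qt m (mmonomial \<Lambda>) (mmonomial \<Omega>)) v"
    "size (snd \<Lambda>) = size (snd \<Omega>) \<Longrightarrow> v = (if \<Lambda> = \<Omega> then mono_norm \<Lambda> else 0)"
proof -
  let ?F = "insert \<Lambda> (mono_supp \<Lambda>)"
  have F: "finite ?F" "?F \<subseteq> mparts m" using mono_supp \<Lambda> by auto
  let ?t = "\<lambda>E. mono_coord \<Lambda> E * mono_coord \<Omega> E * qt_weight E"
  have "\<forall>E\<in>?F. \<exists>v. spec1 ((1 - tv) ^ k * ?t E) v \<and>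
      (size (snd \<Lambda>) = size (snd \<Omega>) \<longrightarrow> v = (if E = \<Lambda> \<and> E = \<Omega> then mono_norm \<Lambda> else 0))"
  proof
    fix E assume "E \<in> ?F"
    then have "E \<in> mparts m" using F(2) by blast
    from gram_term[OF \<Lambda> \<Omega> this k] show "\<exists>v. spec1 ((1 - tv) ^ k * ?t E) v \<and>
      (size (snd \<Lambda>) = size (snd \<Omega>) \<longrightarrow> v = (if E = \<Lambda> \<and> E = \<Omega> then mono_norm \<Lambda> else 0))"
      by blast
  qed
  then obtain v where v: "\<And>E. E \<in> ?F \<Longrightarrow> spec1 ((1 - tv) ^ k * ?t E) (v E)"
    "\<And>E. E \<in> ?F \<Longrightarrow> size (snd \<Lambda>) = size (snd \<Omega>) \<Longrightarrow> v E = (if E = \<Lambda> \<and> E = \<Omega> then mono_norm \<Lambda> else 0)"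
    unfolding bchoice_iff by blast
  have "form_qt m (mmonomial \<Lambda>) (mmonomial \<Omega>) = (\<Sum>E\<in>?F. ?t E)"
    unfolding form_qt_eq by (rule powersum_form_eq[OF F(1) _ F(2)]) auto
  then have "(1 - tv) ^ k * form_qt m (mmonomial \<Lambda>) (mmonomial \<Omega>) = (\<Sum>E\<in>?F. (1 - tv) ^ k * ?t E)"
    by (simp only: sum_distrib_left)
  then have "spec1 ((1 - tv) ^ k * form_qt m (mmonomial \<Lambda>) (mmonomial \<Omega>)) (\<Sum>E\<in>?F. v E)"
    by (simp only:) (intro spec1_sum v(1))
  moreover have "(\<Sum>E\<in>?F. v E) = (if \<Lambda> = \<Omega> then mono_norm \<Lambda> else 0)" if "size (snd \<Lambda>) = size (snd \<Omega>)"
  proof -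
    have "(\<Sum>E\<in>?F. v E) = (\<Sum>E\<in>?F. if E = \<Lambda> then (if \<Lambda> = \<Omega> then mono_norm \<Lambda> else 0) else 0)"
      by (rule sum.cong[OF refl]) (use v(2) that in auto)
    also have "\<dots> = (if \<Lambda> = \<Omega> then mono_norm \<Lambda> else 0)" using F(1) by (subst sum.delta) auto
    finally show ?thesis .
  qed
  ultimately show ?thesis using that by blast
qed

lemma mono_norm_nonzero: "\<Lambda> \<in> mparts m \<Longrightarrow> mono_norm \<Lambda> \<noteq> 0"
  using qt_weight1_nonzero[of \<Lambda>] mult_fact_pos[of "snd \<Lambda>"] by (auto simp: mono_norm_def mparts_def)

end

section \<open>Macdonald polynomials and Kostka coefficients at t = 1\<close>

text \<open>The ratio of the two norms of p_\<Lambda>, up to the product of the 1 - t^r. Dividing by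
  it yields the map adjoint to the plethysm.\<close>

definition q_factor :: "mpart \<Rightarrow> Qqt" where
  "q_factor \<Lambda> = qv ^ sum_list (fst \<Lambda>) * (\<Prod>r\<in>#snd \<Lambda>. 1 - qv ^ r)"

definition q_factor1 :: "mpart \<Rightarrow> Qq" where
  "q_factor1 \<Lambda> = q1 ^ sum_list (fst \<Lambda>) * (\<Prod>r\<in>#snd \<Lambda>. 1 - q1 ^ r)"

lemma q_factor_spec1: "spec1 (q_factor \<Lambda>) (q_factor1 \<Lambda>)"
  unfolding q_factor_def q_factor1_def
  by (intro spec1_mult spec1_power spec1_qv spec1_prod_mset
      spec1_diff spec1_1)

lemma q_factor1_nonzero: assumes "\<Lambda> \<in> mparts m" shows "q_factor1 \<Lambda> \<noteq> 0"
proof -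
  have "(\<Prod>r\<in>#snd \<Lambda>. 1 - q1 ^ r) \<noteq> 0"
  proof (rule prod_mset_nonzero)
    fix r assume "r \<in># snd \<Lambda>"
    then have "r > 0" using assms by (auto simp: mparts_def intro: gr0I)
    then show "1 - q1 ^ r \<noteq> 0" using qv_power_specialized_neq_1[of r] by simp
  qed
  then show ?thesis using q1_neq_0 by (simp add: q_factor1_def)
qed

lemma q_factor_nonzero: assumes "\<Lambda> \<in> mparts m" shows "q_factor \<Lambda> \<noteq> 0"
  using q_factor_spec1[of \<Lambda>] q_factor1_nonzero[OF assms] spec1_unique[OF _ spec1_0] by metis

lemma t_weight_eq:
  assumes "E \<in> mparts m"
  shows "x / (\<Prod>r\<in>#snd E. 1 - tv ^ r) * y * t_weight E = x * (y / q_factor E) * qt_weight E"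
proof -
  have "(\<Prod>r\<in>#l. (1 - qv ^ r) / (1 - tv ^ r)) = (\<Prod>r\<in>#l. 1 - qv ^ r) / (\<Prod>r\<in>#l. 1 - tv ^ r)" for l
    by (induction l) simp_all
  then have "qt_weight E = q_factor E * t_weight E / (\<Prod>r\<in>#snd E. 1 - tv ^ r)"
    by (simp add: qt_weight_def q_factor_def t_weight_def)
  then show ?thesis using q_factor_nonzero[OF assms] by simp
qed

locale macdonald_schur =
  fixes m :: nat and P s :: "mpart \<Rightarrow> Qqt pseries"
  assumes mac: "is_macdonald_basis m P" and schur: "is_schur_basis m s"
begin

lemmas bp = is_basis_mpowersum[OF schur]

lemma basis_P: "is_basis_of_Rm m P"
  using mac by (simp add: is_macdonald_basis_def)

lemma basis_s: "is_basis_of_Rm m s"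
  using schur by (simp add: is_schur_basis_def)

lemma P_orthogonal:
  "\<Lambda> \<in> mparts m \<Longrightarrow> \<Omega> \<in> mparts m \<Longrightarrow> \<Lambda> \<noteq> \<Omega> \<Longrightarrow> form_qt m (P \<Lambda>) (P \<Omega>) = 0"
  using mac by (simp add: is_macdonald_basis_def)

lemma not_below_self: "\<Lambda> \<notin> below m \<Lambda>"
  by (simp add: below_def)

lemma below_in: "\<Omega> \<in> below m \<Lambda> \<Longrightarrow> \<Omega> \<in> mparts m"
  by (simp add: below_def)

lemma insert_below: "\<Lambda> \<in> mparts m \<Longrightarrow> insert \<Lambda> (below m \<Lambda>) \<subseteq> mparts m"
  by (auto simp: below_def)

lemma ex_triangular:
  assumes "\<Lambda> \<in> mparts m"
  shows "\<exists>d. d \<Lambda> = 1 \<and> P \<Lambda> = (\<Sum>\<Omega>\<in>insert \<Lambda> (below m \<Lambda>). pscale (d \<Omega>) (mmonomial \<Omega>))"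
proof -
  obtain d where d: "P \<Lambda> = mmonomial \<Lambda> + (\<Sum>\<Omega>\<in>below m \<Lambda>. pscale (d \<Omega>) (mmonomial \<Omega>))"
    using mac assms unfolding is_macdonald_basis_def below_def by blast
  have "(\<Sum>\<Omega>\<in>below m \<Lambda>. pscale (d \<Omega>) (mmonomial \<Omega>))
      = (\<Sum>\<Omega>\<in>below m \<Lambda>. pscale ((d(\<Lambda> := 1)) \<Omega>) (mmonomial \<Omega>))"
    by (rule sum.cong) (use not_below_self in auto)
  then have "P \<Lambda> = (\<Sum>\<Omega>\<in>insert \<Lambda> (below m \<Lambda>). pscale ((d(\<Lambda> := 1)) \<Omega>) (mmonomial \<Omega>))"
    unfolding d by (simp add: finite_below not_below_self)
  then show ?thesis by (intro exI[of _ "d(\<Lambda> := 1)"]) simp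
qed

definition tri :: "mpart \<Rightarrow> mpart \<Rightarrow> Qqt" where
  "tri \<Lambda> = (SOME d. d \<Lambda> = 1 \<and> P \<Lambda> = (\<Sum>\<Omega>\<in>insert \<Lambda> (below m \<Lambda>). pscale (d \<Omega>) (mmonomial \<Omega>)))"

lemma tri:
  assumes "\<Lambda> \<in> mparts m"
  shows "tri \<Lambda> \<Lambda> = 1" "P \<Lambda> = (\<Sum>\<Omega>\<in>insert \<Lambda> (below m \<Lambda>). pscale (tri \<Lambda> \<Omega>) (mmonomial \<Omega>))"
  using someI_ex[OF ex_triangular[OF assms]] unfolding tri_def by blast+

text \<open>Triangularity solved for the monomial: m_\<Lambda> is P_\<Lambda> minus lower monomials,
  which lie in the ring by induction.\<close>

lemma mono_in_Rm: "\<Lambda> \<in> mparts m \<Longrightarrow> mmonomial \<Lambda> \<in> Rm m"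
proof (induction rule: below_induct)
  case (less \<Lambda>)
  have "P \<Lambda> = mmonomial \<Lambda> + (\<Sum>\<Omega>\<in>below m \<Lambda>. pscale (tri \<Lambda> \<Omega>) (mmonomial \<Omega>))"
    by (subst tri(2)[OF less(1)]) (simp add: finite_below not_below_self tri(1)[OF less(1)])
  then have "mmonomial \<Lambda> = P \<Lambda> - (\<Sum>\<Omega>\<in>below m \<Lambda>. pscale (tri \<Lambda> \<Omega>) (mmonomial \<Omega>))" by simp
  also have "\<dots> \<in> Rm m"
    using less by (intro ps.subspace_diff ps.subspace_sum ps.subspace_scale subspace_Rm basis_in_Rm[OF basis_P]) auto
  finally show ?case .
qed

lemma form_P_left:
  assumes "\<Lambda> \<in> mparts m"
  shows "form_qt m (P \<Lambda>) g = (\<Sum>\<Omega>\<in>insert \<Lambda> (below m \<Lambda>). tri \<Lambda> \<Omega> * form_qt m (mmonomial \<Omega>) g)"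
  unfolding form_qt_eq
  by (subst tri(2)[OF assms], rule powersum_form_sum_left[OF bp])
    (use finite_below mono_in_Rm insert_below[OF assms] in auto)

lemma form_P_right:
  assumes "\<Lambda> \<in> mparts m"
  shows "form_qt m g (P \<Lambda>) = (\<Sum>\<Omega>\<in>insert \<Lambda> (below m \<Lambda>). tri \<Lambda> \<Omega> * form_qt m g (mmonomial \<Omega>))"
  using form_P_left[OF assms, of g] unfolding form_qt_eq by (simp only: powersum_form_commute[of m _ g])

text \<open>P_\<Omega> is m_\<Omega> plus lower monomials, to which P_\<Lambda> is orthogonal by
  induction.\<close>

lemma P_orthogonal_below:
  assumes "\<Lambda> \<in> mparts m" "\<Omega> \<in> below m \<Lambda>"
  shows "form_qt m (P \<Lambda>) (mmonomial \<Omega>) = 0"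
proof -
  have "\<Omega> \<in> below m \<Lambda> \<longrightarrow> form_qt m (P \<Lambda>) (mmonomial \<Omega>) = 0"
    using below_in[OF assms(2)]
  proof (induction rule: below_induct)
    case (less \<Omega>)
    show ?case
    proof
      assume \<Omega>: "\<Omega> \<in> below m \<Lambda>"
      have "form_qt m (P \<Lambda>) (mmonomial E) = 0" if "E \<in> below m \<Omega>" for E
        using less(2)[OF that] below_psubset[OF assms(1) \<Omega>] that by blast
      then have "form_qt m (P \<Lambda>) (P \<Omega>) = form_qt m (P \<Lambda>) (mmonomial \<Omega>)"
        by (subst form_P_right[OF less(1)]) (simp add: finite_below not_below_self tri(1)[OF less(1)])
      moreover have "form_qt m (P \<Lambda>) (P \<Omega>) = 0"
        using P_orthogonal[OF assms(1) less(1)] \<Omega> not_below_self by metis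
      ultimately show "form_qt m (P \<Lambda>) (mmonomial \<Omega>) = 0" by simp
    qed
  qed
  then show ?thesis using assms(2) by blast
qed

lemma below_size: "\<Lambda> \<in> mparts m \<Longrightarrow> \<Omega> \<in> below m \<Lambda> \<Longrightarrow> size (snd \<Lambda>) \<le> size (snd \<Omega>)"
  using mpart_le_size[of m \<Omega> \<Lambda>] by (simp add: below_def)

abbreviation "G \<Lambda> \<Omega> \<equiv> form_qt m (mmonomial \<Lambda>) (mmonomial \<Omega>)"

lemmas gram' = gram[OF bp mono_in_Rm]

text \<open>Orthogonality of P_\<Lambda> to the monomials below it is a linear system for the
  triangular coefficients, with the Gram matrix of these monomials. The right-hand side has poles of
  order at most the length for \<Lambda>, the smallest length involved, and of lower order at equal
  length.\<close>

lemma tri_vanishes: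
  assumes \<Lambda>: "\<Lambda> \<in> mparts m" and \<Omega>: "\<Omega> \<in> below m \<Lambda>" shows "spec1 (tri \<Lambda> \<Omega>) 0"
proof (rule gram_solution_vanishes[where D = "below m \<Lambda>" and k = "\<lambda>E. size (snd E)" and ?k0.0 = "size (snd \<Lambda>)"
      and g = "G \<Lambda>" and G = G, OF finite_below])
  show "size (snd \<Lambda>) \<le> size (snd E)" if "E \<in> below m \<Lambda>" for E by (rule below_size[OF \<Lambda> that])
  show "G \<Lambda> \<Delta> + (\<Sum>E\<in>below m \<Lambda>. tri \<Lambda> E * G E \<Delta>) = 0" if "\<Delta> \<in> below m \<Lambda>" for \<Delta>
    using P_orthogonal_below[OF \<Lambda> that]
    by (subst (asm) form_P_left[OF \<Lambda>]) (simp add: finite_below not_below_self tri(1)[OF \<Lambda>])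
  show "order_ge (- int (min (size (snd E)) (size (snd \<Delta>)))) (G E \<Delta>)"
    if "E \<in> below m \<Lambda>" "\<Delta> \<in> below m \<Lambda>" for E \<Delta>
    using gram'[OF _ below_in[OF that(1)] below_in[OF that(2)] refl] order_ge_if_spec1 by metis
  show "order_ge (1 - int (size (snd \<Delta>))) (G E \<Delta>)"
    if h: "E \<in> below m \<Lambda>" "\<Delta> \<in> below m \<Lambda>" "E \<noteq> \<Delta>" "size (snd E) = size (snd \<Delta>)" for E \<Delta>
  proof -
    obtain v where "spec1 ((1 - tv) ^ size (snd \<Delta>) * G E \<Delta>) v" "v = 0"
      using gram'[OF _ below_in[OF h(1)] below_in[OF h(2)], of "size (snd \<Delta>)"] h(3,4) by auto
    then show ?thesis by (intro order_ge_Suc_if_spec1_0) simp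
  qed
  show "\<exists>v. v \<noteq> 0 \<and> spec1 ((1 - tv) ^ size (snd E) * G E E) v" if "E \<in> below m \<Lambda>" for E
  proof -
    have E: "E \<in> mparts m" by (rule below_in[OF that])
    obtain v where "spec1 ((1 - tv) ^ size (snd E) * G E E) v" "v = mono_norm E"
      using gram'[OF _ E E, of "size (snd E)"] by auto
    then show ?thesis using mono_norm_nonzero[OF bp mono_in_Rm E] by auto
  qed
  show "order_ge (- int (size (snd \<Lambda>))) (G \<Lambda> \<Delta>)" if "\<Delta> \<in> below m \<Lambda>" for \<Delta>
    using gram'[OF _ \<Lambda> below_in[OF that], of "size (snd \<Lambda>)"] below_size[OF \<Lambda> that] order_ge_if_spec1
    by (metis min_absorb1)
  show "order_ge (1 - int (size (snd \<Lambda>))) (G \<Lambda> \<Delta>)"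
    if h: "\<Delta> \<in> below m \<Lambda>" "size (snd \<Delta>) = size (snd \<Lambda>)" for \<Delta>
  proof -
    have "\<Lambda> \<noteq> \<Delta>" using h(1) not_below_self by metis
    then obtain v where "spec1 ((1 - tv) ^ size (snd \<Lambda>) * G \<Lambda> \<Delta>) v" "v = 0"
      using gram'[OF _ \<Lambda> below_in[OF h(1)], of "size (snd \<Lambda>)"] h(2) by auto
    then show ?thesis by (intro order_ge_Suc_if_spec1_0) simp
  qed
qed (rule \<Omega>)

lemma tri_spec1:
  assumes "\<Lambda> \<in> mparts m" "\<Omega> \<in> insert \<Lambda> (below m \<Lambda>)"
  shows "spec1 (tri \<Lambda> \<Omega>) (if \<Omega> = \<Lambda> then 1 else 0)"
  using assms(2) tri(1)[OF assms(1)] tri_vanishes[OF assms(1), of \<Omega>] by auto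

lemma P_spec1: assumes "\<Lambda> \<in> mparts m" shows "pspec1 (P \<Lambda>) (mmonomial1 \<Lambda>)"
proof -
  have "pspec1 (P \<Lambda>) (\<Sum>\<Omega>\<in>insert \<Lambda> (below m \<Lambda>). pscale (if \<Omega> = \<Lambda> then 1 else 0) (mmonomial1 \<Omega>))"
    by (subst tri(2)[OF assms])
      (intro pspec1_sum pspec1_scale tri_spec1[OF assms] pspec1_mmonomial)
  also have "(\<Sum>\<Omega>\<in>insert \<Lambda> (below m \<Lambda>). pscale (if \<Omega> = \<Lambda> then 1 else 0) (mmonomial1 \<Omega>))
      = (\<Sum>\<Omega>\<in>insert \<Lambda> (below m \<Lambda>). if \<Omega> = \<Lambda> then mmonomial1 \<Omega> else 0)"
    by (rule sum.cong) auto
  also have "\<dots> = mmonomial1 \<Lambda>" using finite_below by (subst sum.delta) auto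
  finally show ?thesis .
qed

text \<open>By orthogonality the norm is a sum of triangular coefficients times Gram entries against
  m_\<Lambda>. No lower \<Omega> has fewer parts, so one power of 1 - t clears all poles, and the
  vanishing coefficients remove every term but the one of m_\<Lambda>.\<close>

lemma P_norm_spec1:
  assumes \<Lambda>: "\<Lambda> \<in> mparts m"
  shows "spec1 ((1 - tv) ^ size (snd \<Lambda>) * form_qt m (P \<Lambda>) (P \<Lambda>)) (mono_norm \<Lambda>)"
proof -
  let ?k = "size (snd \<Lambda>)" and ?B = "insert \<Lambda> (below m \<Lambda>)"
  have "form_qt m (P \<Lambda>) (P \<Lambda>) = form_qt m (P \<Lambda>) (mmonomial \<Lambda>)"
    by (subst form_P_right[OF \<Lambda>])
      (simp add: finite_below not_below_self tri(1)[OF \<Lambda>] P_orthogonal_below[OF \<Lambda>])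
  also have "\<dots> = (\<Sum>\<Omega>\<in>?B. tri \<Lambda> \<Omega> * G \<Omega> \<Lambda>)" by (rule form_P_left[OF \<Lambda>])
  finally have eq: "(1 - tv) ^ ?k * form_qt m (P \<Lambda>) (P \<Lambda>) = (\<Sum>\<Omega>\<in>?B. tri \<Lambda> \<Omega> * ((1 - tv) ^ ?k * G \<Omega> \<Lambda>))"
    by (simp only: sum_distrib_left mult.left_commute)
  have "spec1 (\<Sum>\<Omega>\<in>?B. tri \<Lambda> \<Omega> * ((1 - tv) ^ ?k * G \<Omega> \<Lambda>)) (\<Sum>\<Omega>\<in>?B. if \<Omega> = \<Lambda> then mono_norm \<Lambda> else 0)"
  proof (rule spec1_sum)
    fix \<Omega> assume \<Omega>: "\<Omega> \<in> ?B"
    then have in_I: "\<Omega> \<in> mparts m" using insert_below[OF \<Lambda>] by blast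
    have "?k \<le> size (snd \<Omega>)" using \<Omega> below_size[OF \<Lambda>, of \<Omega>] by auto
    then have k: "?k = min (size (snd \<Omega>)) ?k" by simp
    obtain v where v: "spec1 ((1 - tv) ^ ?k * G \<Omega> \<Lambda>) v"
      "size (snd \<Omega>) = ?k \<Longrightarrow> v = (if \<Omega> = \<Lambda> then mono_norm \<Omega> else 0)"
      using gram'[OF _ in_I \<Lambda> k] by blast
    have "(if \<Omega> = \<Lambda> then 1 else 0) * v = (if \<Omega> = \<Lambda> then mono_norm \<Lambda> else 0)" using v(2) by auto
    with spec1_mult[OF tri_spec1[OF \<Lambda> \<Omega>] v(1)]
    show "spec1 (tri \<Lambda> \<Omega> * ((1 - tv) ^ ?k * G \<Omega> \<Lambda>)) (if \<Omega> = \<Lambda> then mono_norm \<Lambda> else 0)" by (simp only:)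
  qed
  also have "(\<Sum>\<Omega>\<in>?B. if \<Omega> = \<Lambda> then mono_norm \<Lambda> else 0) = mono_norm \<Lambda>"
    using finite_below by (subst sum.delta) auto
  finally show ?thesis unfolding eq .
qed

lemma kostka_eq:
  assumes \<Lambda>: "\<Lambda> \<in> mparts m" and \<Omega>: "\<Omega> \<in> mparts m"
  defines "S \<equiv> psupp m (dual_schur \<Omega>)"
  defines "f \<equiv> \<Sum>E\<in>S. pscale (pcoord m (dual_schur \<Omega>) E / q_factor E) (mpowersum E)"
  shows "kostka m P s \<Omega> \<Lambda> * tv ^ inversions (fst \<Omega>)
    = cnorm \<Lambda> * (coord m P f \<Lambda> * form_qt m (P \<Lambda>) (P \<Lambda>))"
proof -
  define J where "J = integral_form P \<Lambda>"
  define SJ where "SJ = psupp m J"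
  define \<theta> where "\<theta> = plethysm_1mt m J"
  define T where "T E = (\<Prod>r\<in>#snd E. 1 - tv ^ r)" for E :: mpart
  let ?pc = "pcoord m"
  have S: "finite S" "S \<subseteq> mparts m" and SJ: "finite SJ" "SJ \<subseteq> mparts m"
    unfolding S_def SJ_def by (rule finite_coord_supp[OF inj_on_mpowersum] coord_supp_subset)+
  have p_in: "mpowersum E \<in> Rm m" if "E \<in> mparts m" for E by (rule mpowersum_in_Rm[OF that])
  have \<theta>_eq: "\<theta> = (\<Sum>E\<in>SJ. pscale (?pc J E / T E) (mpowersum E))"
    by (simp add: \<theta>_def plethysm_1mt_def SJ_def coord_supp_def T_def)
  have \<theta>_in: "\<theta> \<in> Rm m" unfolding \<theta>_eq
    using SJ p_in by (intro ps.subspace_sum ps.subspace_scale subspace_Rm) auto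
  have f_in: "f \<in> Rm m" unfolding f_def
    using S p_in by (intro ps.subspace_sum ps.subspace_scale subspace_Rm) auto
  have pc_\<theta>: "?pc \<theta> E = ?pc J E / T E" if "E \<in> mparts m" for E
    unfolding \<theta>_eq using coord_combination[OF bp SJ that] that by (auto simp: SJ_def coord_supp_def)
  have pc_f: "?pc f E = ?pc (dual_schur \<Omega>) E / q_factor E" if "E \<in> mparts m" for E
    unfolding f_def using coord_combination[OF bp S that] that by (auto simp: S_def coord_supp_def)
  let ?Ss = "coord_supp m s \<theta>"
  have Ss: "finite ?Ss" "?Ss \<subseteq> mparts m"
    using basis_s by (auto simp: is_basis_of_Rm_def intro: finite_coord_supp subsetD[OF coord_supp_subset])
  \<comment> \<open>The pairing is evaluated twice. Here duality with s isolates the Kostka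
    coefficient.\<close>
  have "form_m m \<theta> (dual_schur \<Omega>) = (\<Sum>\<Delta>\<in>?Ss. coord m s \<theta> \<Delta> * form_m m (s \<Delta>) (dual_schur \<Omega>))"
    unfolding form_m_eq
    by (subst coord_expansion[OF basis_s \<theta>_in], rule powersum_form_sum_left[OF bp Ss(1)])
      (use Ss(2) basis_in_Rm[OF basis_s] in blast)
  also have "\<dots> = (\<Sum>\<Delta>\<in>?Ss. if \<Delta> = \<Omega> then coord m s \<theta> \<Omega> * tv ^ inversions (fst \<Omega>) else 0)"
  proof (rule sum.cong[OF refl])
    fix \<Delta> assume "\<Delta> \<in> ?Ss"
    then have "\<Delta> \<in> mparts m" using Ss(2) by blast
    then show "coord m s \<theta> \<Delta> * form_m m (s \<Delta>) (dual_schur \<Omega>)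
        = (if \<Delta> = \<Omega> then coord m s \<theta> \<Omega> * tv ^ inversions (fst \<Omega>) else 0)"
      using schur \<Omega> by (simp add: is_schur_basis_def)
  qed
  also have "\<dots> = coord m s \<theta> \<Omega> * tv ^ inversions (fst \<Omega>)"
    using Ss(1) \<Omega> by (simp add: coord_supp_def)
  finally have 1: "kostka m P s \<Omega> \<Lambda> * tv ^ inversions (fst \<Omega>) = form_m m \<theta> (dual_schur \<Omega>)"
    by (simp add: kostka_def \<theta>_def J_def)
  have "psupp m \<theta> \<subseteq> SJ"
    using pc_\<theta> by (auto simp: coord_supp_def SJ_def)
  then have "form_m m \<theta> (dual_schur \<Omega>) = (\<Sum>E\<in>SJ. ?pc \<theta> E * ?pc (dual_schur \<Omega>) E * t_weight E)"
    unfolding form_m_eq by (rule powersum_form_eq[OF SJ(1) _ SJ(2)])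
  \<comment> \<open>The adjunction, term by term: the denominators of the plethysm and of
    \<open>f\<close> convert one norm into the other.\<close>
  also have "\<dots> = (\<Sum>E\<in>SJ. ?pc J E * ?pc f E * qt_weight E)"
  proof (rule sum.cong[OF refl])
    fix E assume "E \<in> SJ"
    then have E: "E \<in> mparts m" using SJ by blast
    show "?pc \<theta> E * ?pc (dual_schur \<Omega>) E * t_weight E = ?pc J E * ?pc f E * qt_weight E"
      unfolding pc_\<theta>[OF E] pc_f[OF E] T_def by (rule t_weight_eq[OF E])
  qed
  also have "\<dots> = form_qt m J f"
    unfolding form_qt_eq by (rule powersum_form_eq[symmetric, OF SJ(1) _ SJ(2)]) (simp add: SJ_def)
  also have "\<dots> = cnorm \<Lambda> * form_qt m (P \<Lambda>) f"
    using powersum_form_sum_left[OF bp, of "{()}" "\<lambda>_. P \<Lambda>" qt_weight "\<lambda>_. cnorm \<Lambda>" f] basis_in_Rm[OF basis_P \<Lambda>]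
    by (simp add: form_qt_eq J_def integral_form_def)
  finally have 2: "form_m m \<theta> (dual_schur \<Omega>) = cnorm \<Lambda> * form_qt m (P \<Lambda>) f" .
  let ?Sf = "coord_supp m P f"
  have Sf: "finite ?Sf" "?Sf \<subseteq> mparts m"
    using basis_P by (auto simp: is_basis_of_Rm_def intro: finite_coord_supp subsetD[OF coord_supp_subset])
  \<comment> \<open>Second evaluation: orthogonality of P isolates the coordinate of
    \<open>f\<close> at P_\<Lambda>.\<close>
  have "form_qt m (P \<Lambda>) f = form_qt m (P \<Lambda>) (\<Sum>E\<in>?Sf. pscale (coord m P f E) (P E))"
    using coord_expansion[OF basis_P f_in] by simp
  also have "\<dots> = (\<Sum>E\<in>?Sf. coord m P f E * form_qt m (P \<Lambda>) (P E))"
    unfolding form_qt_eq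
    by (rule powersum_form_sum_right[OF bp Sf(1)]) (use Sf(2) basis_in_Rm[OF basis_P] in blast)
  also have "\<dots> = (\<Sum>E\<in>?Sf. if E = \<Lambda> then coord m P f \<Lambda> * form_qt m (P \<Lambda>) (P \<Lambda>) else 0)"
  proof (rule sum.cong[OF refl])
    fix E assume "E \<in> ?Sf"
    then have "E \<in> mparts m" using Sf(2) by blast
    then show "coord m P f E * form_qt m (P \<Lambda>) (P E)
        = (if E = \<Lambda> then coord m P f \<Lambda> * form_qt m (P \<Lambda>) (P \<Lambda>) else 0)"
      using P_orthogonal[OF \<Lambda>, of E] by auto
  qed
  also have "\<dots> = coord m P f \<Lambda> * form_qt m (P \<Lambda>) (P \<Lambda>)"
    using Sf(1) \<Lambda> by (simp add: coord_supp_def)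
  finally show ?thesis using 1 2 by simp
qed

text \<open>The basis P specializes to the monomials, which remain independent; hence the coordinate
  is regular, and its value is the coefficient at the leading monomial.\<close>

lemma coord_P_spec1:
  assumes \<Lambda>: "\<Lambda> \<in> mparts m" and f: "f \<in> Rm m" "pspec1 f f'"
  shows "spec1 (coord m P f \<Lambda>) (pcoeff f' (lead \<Lambda>))"
proof -
  let ?S = "coord_supp m P f"
  let ?F = "insert \<Lambda> ?S"
  have S: "finite ?S" "?S \<subseteq> mparts m"
    using basis_P by (auto simp: is_basis_of_Rm_def intro: finite_coord_supp subsetD[OF coord_supp_subset])
  then have F: "finite ?F" "?F \<subseteq> mparts m" using \<Lambda> by auto
  have "f = (\<Sum>E\<in>?S. pscale (coord m P f E) (P E))" by (rule coord_expansion[OF basis_P f(1)])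
  also have "\<dots> = (\<Sum>E\<in>?F. pscale (coord m P f E) (P E))"
    by (rule sum.mono_neutral_left) (use F \<Lambda> in \<open>auto simp: coord_supp_def\<close>)
  finally have sp: "pspec1 (\<Sum>E\<in>?F. pscale (coord m P f E) (P E)) f'" using f(2) by simp
  have "\<exists>c'. (\<forall>E\<in>?F. spec1 (coord m P f E) (c' E)) \<and> f' = (\<Sum>E\<in>?F. pscale (c' E) (mmonomial1 E))"
  proof (rule coefficients_specialize[OF F(1) _ _ sp])
    show "\<And>E. E \<in> ?F \<Longrightarrow> pspec1 (P E) (mmonomial1 E)" using F(2) P_spec1 by blast
    show "\<forall>E\<in>?F. c E = 0" if "(\<Sum>E\<in>?F. pscale (c E) (mmonomial1 E)) = 0" for c
      using mmonomial1_coeff[OF F, of _ c] that by simp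
  qed blast
  then obtain c' where c': "\<forall>E\<in>?F. spec1 (coord m P f E) (c' E)"
    "f' = (\<Sum>E\<in>?F. pscale (c' E) (mmonomial1 E))" by blast
  then have "pcoeff f' (lead \<Lambda>) = c' \<Lambda>" using mmonomial1_coeff[OF F, of \<Lambda> c'] by simp
  then show ?thesis using c'(1) by simp
qed

text \<open>The expansion at t = 1 is obtained only existentially;
  \<open>mpowersum1_functional_unique\<close> makes the value independent of its choice.\<close>

lemma kostka_spec1:
  assumes \<Lambda>: "\<Lambda> \<in> mparts m" and \<Omega>: "\<Omega> \<in> mparts m"
  obtains F c where "finite F" "F \<subseteq> mparts m" "dual_schur1 \<Omega> = (\<Sum>E\<in>F. pscale (c E) (mpowersum1 E))"
    "spec1 (kostka m P s \<Omega> \<Lambda>) (cnorm1 (shape \<Lambda>) * mono_norm \<Lambda> *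
      (\<Sum>E\<in>F. c E * (pcoeff (mpowersum1 E) (lead \<Lambda>) / q_factor1 E)))"
proof -
  define S where "S = psupp m (dual_schur \<Omega>)"
  define f where "f = (\<Sum>E\<in>S. pscale (pcoord m (dual_schur \<Omega>) E / q_factor E) (mpowersum E))"
  have S: "finite S" "S \<subseteq> mparts m"
    unfolding S_def by (rule finite_coord_supp[OF inj_on_mpowersum] coord_supp_subset)+
  obtain c where c: "\<And>E. E \<in> S \<Longrightarrow> spec1 (pcoord m (dual_schur \<Omega>) E) (c E)"
    "dual_schur1 \<Omega> = (\<Sum>E\<in>S. pscale (c E) (mpowersum1 E))"
    using coord_mpowersum_spec1[OF bp dual_schur_in_Rm[OF schur \<Omega>] pspec1_dual_schur]
    unfolding S_def by blast
  define f' where "f' = (\<Sum>E\<in>S. pscale (c E / q_factor1 E) (mpowersum1 E))"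
  have "pspec1 f f'" unfolding f_def f'_def
  proof (intro pspec1_sum pspec1_scale spec1_divide c q_factor_spec1 pspec1_mpowersum)
    show "q_factor1 E \<noteq> 0" if "E \<in> S" for E using that S q_factor1_nonzero by blast
  qed
  moreover have "f \<in> Rm m" unfolding f_def
    using S mpowersum_in_Rm by (intro ps.subspace_sum ps.subspace_scale subspace_Rm) auto
  ultimately have fs: "spec1 (coord m P f \<Lambda>) (pcoeff f' (lead \<Lambda>))"
    by (intro coord_P_spec1 \<Lambda>)
  have "0 \<notin># snd \<Lambda>" using \<Lambda> by (auto simp: mparts_def)
  then obtain x where x: "cnorm \<Lambda> = (1 - tv) ^ size (snd \<Lambda>) * x" "spec1 x (cnorm1 (shape \<Lambda>))"
    by (rule cnorm_spec1)
  have "kostka m P s \<Omega> \<Lambda> * tv ^ inversions (fst \<Omega>)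
      = cnorm \<Lambda> * (coord m P f \<Lambda> * form_qt m (P \<Lambda>) (P \<Lambda>))"
    using kostka_eq[OF \<Lambda> \<Omega>] by (simp only: f_def S_def)
  also have "\<dots> = x * ((1 - tv) ^ size (snd \<Lambda>) * form_qt m (P \<Lambda>) (P \<Lambda>)) * coord m P f \<Lambda>"
    unfolding x(1) by (simp only: mult_ac)
  finally have "kostka m P s \<Omega> \<Lambda>
      = x * ((1 - tv) ^ size (snd \<Lambda>) * form_qt m (P \<Lambda>) (P \<Lambda>)) * coord m P f \<Lambda> / tv ^ inversions (fst \<Omega>)"
    using tv_neq_0 by (simp add: eq_divide_eq)
  moreover have "spec1 (x * ((1 - tv) ^ size (snd \<Lambda>) * form_qt m (P \<Lambda>) (P \<Lambda>)) * coord m P f \<Lambda> / tv ^ inversions (fst \<Omega>))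
      (cnorm1 (shape \<Lambda>) * mono_norm \<Lambda> * pcoeff f' (lead \<Lambda>) / 1 ^ inversions (fst \<Omega>))"
    by (intro spec1_divide spec1_mult spec1_power x(2) P_norm_spec1[OF \<Lambda>] fs spec1_tv) simp
  moreover have "pcoeff f' (lead \<Lambda>) = (\<Sum>E\<in>S. c E * (pcoeff (mpowersum1 E) (lead \<Lambda>) / q_factor1 E))"
    by (simp add: f'_def)
  ultimately show ?thesis by (intro that[OF S c(2)]) simp
qed

end

text \<open>By independence, arbitrary values h on the power sums extend to a linear functional on
  their span, so any two expansions of an element give the same result.\<close>

lemma mpowersum1_functional_unique:
  assumes F: "finite F" "F \<subseteq> mparts m" and F': "finite F'" "F' \<subseteq> mparts m"
    and eq: "(\<Sum>E\<in>F. pscale (c E) (mpowersum1 E)) = (\<Sum>E\<in>F'. pscale (c' E) (mpowersum1 E))"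
  shows "(\<Sum>E\<in>F. c E * h E) = (\<Sum>E\<in>F'. c' E * h E)"
proof -
  let ?U = "F \<union> F'"
  define e where "e E = (if E \<in> F then c E else 0)" for E
  define e' where "e' E = (if E \<in> F' then c' E else 0)" for E
  have "(\<Sum>E\<in>F. pscale (c E) (mpowersum1 E)) = (\<Sum>E\<in>?U. pscale (e E) (mpowersum1 E))"
    by (rule sum.mono_neutral_cong_left) (use F F' in \<open>auto simp: e_def\<close>)
  moreover have "(\<Sum>E\<in>F'. pscale (c' E) (mpowersum1 E)) = (\<Sum>E\<in>?U. pscale (e' E) (mpowersum1 E))"
    by (rule sum.mono_neutral_cong_left) (use F F' in \<open>auto simp: e'_def\<close>)
  ultimately have "(\<Sum>E\<in>?U. pscale (e E - e' E) (mpowersum1 E)) = 0"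
    using eq by (simp add: ps.scale_left_diff_distrib sum_subtractf)
  then have "\<forall>E\<in>?U. e E - e' E = 0"
    using F F' by (intro mpowersum1_independent[of ?U m]) auto
  then have "(\<Sum>E\<in>?U. e E * h E) = (\<Sum>E\<in>?U. e' E * h E)" by (intro sum.cong) auto
  moreover have "(\<Sum>E\<in>F. c E * h E) = (\<Sum>E\<in>?U. e E * h E)"
    by (rule sum.mono_neutral_cong_left) (use F F' in \<open>auto simp: e_def\<close>)
  moreover have "(\<Sum>E\<in>F'. c' E * h E) = (\<Sum>E\<in>?U. e' E * h E)"
    by (rule sum.mono_neutral_cong_left) (use F F' in \<open>auto simp: e'_def\<close>)
  ultimately show ?thesis by simp
qed

theorem proposition15:
  fixes m :: nat and P s :: "mpart \<Rightarrow> Qqt pseries" and \<Lambda> \<Omega> :: mpart and \<sigma> :: "nat \<Rightarrow> nat"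
  assumes "is_macdonald_basis m P"
    and "is_schur_basis m s"
    and "\<Lambda> \<in> mparts m" and "\<Omega> \<in> mparts m"
    and "\<sigma> permutes {..<m}"
  shows "regular_at_t1 (kostka m P s \<Omega> \<Lambda>) \<and>
    regular_at_t1 (kostka m P s (permute_mpart \<sigma> \<Omega>) (permute_mpart \<sigma> \<Lambda>)) \<and>
    at_t1 (kostka m P s \<Omega> \<Lambda>)
      = at_t1 (kostka m P s (permute_mpart \<sigma> \<Omega>) (permute_mpart \<sigma> \<Lambda>))"
proof -
  interpret macdonald_schur m P s by unfold_locales (rule assms)+
  note \<Lambda> = assms(3) and \<Omega> = assms(4) and \<sigma> = assms(5)
  let ?\<sigma> = "permute_mpart \<sigma>"
  have len: "length (fst E) = m" if "E \<in> mparts m" for E using that by (auto simp: mparts_def)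
  have sum_list: "sum_list (fst (?\<sigma> E)) = sum_list (fst E)" if "E \<in> mparts m" for E
    using mset_permute_mpart[OF \<sigma> len[OF that]] by (metis sum_mset_sum_list)
  obtain F c where F: "finite F" "F \<subseteq> mparts m" "dual_schur1 \<Omega> = (\<Sum>E\<in>F. pscale (c E) (mpowersum1 E))"
    and K: "spec1 (kostka m P s \<Omega> \<Lambda>) (cnorm1 (shape \<Lambda>) * mono_norm \<Lambda> *
      (\<Sum>E\<in>F. c E * (pcoeff (mpowersum1 E) (lead \<Lambda>) / q_factor1 E)))"
    by (rule kostka_spec1[OF \<Lambda> \<Omega>])
  obtain F' c' where F': "finite F'" "F' \<subseteq> mparts m"
      "dual_schur1 (?\<sigma> \<Omega>) = (\<Sum>E\<in>F'. pscale (c' E) (mpowersum1 E))"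
    and K': "spec1 (kostka m P s (?\<sigma> \<Omega>) (?\<sigma> \<Lambda>)) (cnorm1 (shape (?\<sigma> \<Lambda>)) * mono_norm (?\<sigma> \<Lambda>) *
      (\<Sum>E\<in>F'. c' E * (pcoeff (mpowersum1 E) (lead (?\<sigma> \<Lambda>)) / q_factor1 E)))"
    by (rule kostka_spec1[OF permute_mpart_in[OF \<Lambda>] permute_mpart_in[OF \<Omega>]])
  define h where "h E = pcoeff (mpowersum1 E) (lead (?\<sigma> \<Lambda>)) / q_factor1 E" for E
  define \<tau> where "\<tau> = inv_into F ?\<sigma>"
  have inj: "inj_on ?\<sigma> F"
    using bij_permute_mpart[OF \<sigma>] F(2) by (meson bij_betw_def inj_on_subset)
  \<comment> \<open>Applying \<sigma> to the expansion for \<Omega> gives a second expansion for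
    \<sigma>(\<Omega>), and the functional given by \<open>h\<close> cannot distinguish the
    two.\<close>
  have "(\<Sum>E\<in>F'. pscale (c' E) (mpowersum1 E)) = permute_vars \<sigma> (dual_schur1 \<Omega>)"
    unfolding F'(3)[symmetric] by (rule permute_mpart_dual_schur1[OF \<sigma> \<Omega>, symmetric])
  also have "\<dots> = (\<Sum>E\<in>F. pscale (c E) (mpowersum1 (?\<sigma> E)))"
    unfolding F(3) permute_vars_sum permute_vars_scale
    by (intro sum.cong refl) (use F(2) len permute_vars_mpowersum1[OF \<sigma>] in auto)
  also have "\<dots> = (\<Sum>E\<in>?\<sigma> ` F. pscale (c (\<tau> E)) (mpowersum1 E))"
    using inj by (simp add: sum.reindex \<tau>_def)
  finally have "(\<Sum>E\<in>F'. c' E * h E) = (\<Sum>E\<in>?\<sigma> ` F. c (\<tau> E) * h E)"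
    using F F' permute_mpart_in by (intro mpowersum1_functional_unique[of _ m]) auto
  also have "\<dots> = (\<Sum>E\<in>F. c E * h (?\<sigma> E))"
    using inj by (simp add: sum.reindex \<tau>_def)
  also have "\<dots> = (\<Sum>E\<in>F. c E * (pcoeff (mpowersum1 E) (lead \<Lambda>) / q_factor1 E))"
  proof (rule sum.cong[OF refl])
    fix E assume "E \<in> F"
    then have E: "E \<in> mparts m" using F(2) by blast
    \<comment> \<open>\<sigma> moves the function and the monomial at which its coefficient is read
      simultaneously.\<close>
    have "pcoeff (mpowersum1 (?\<sigma> E)) (lead (?\<sigma> \<Lambda>)) = pcoeff (mpowersum1 E) (lead \<Lambda>)"
      unfolding permute_vars_mpowersum1[OF \<sigma> len[OF E], symmetric] lead_permute_mpart[OF \<sigma> \<Lambda>]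
      by (rule pcoeff_permute_vars_image[OF permutes_bij[OF \<sigma>]])
    then show "c E * h (?\<sigma> E) = c E * (pcoeff (mpowersum1 E) (lead \<Lambda>) / q_factor1 E)"
      by (simp add: h_def q_factor1_def sum_list[OF E])
  qed
  finally have sums: "(\<Sum>E\<in>F'. c' E * (pcoeff (mpowersum1 E) (lead (?\<sigma> \<Lambda>)) / q_factor1 E))
      = (\<Sum>E\<in>F. c E * (pcoeff (mpowersum1 E) (lead \<Lambda>) / q_factor1 E))"
    by (simp only: h_def)
  have "mono_norm (?\<sigma> \<Lambda>) = mono_norm \<Lambda>"
    by (simp add: mono_norm_def qt_weight1_def sum_list[OF \<Lambda>])
  with K' have "spec1 (kostka m P s (?\<sigma> \<Omega>) (?\<sigma> \<Lambda>)) (cnorm1 (shape \<Lambda>) * mono_norm \<Lambda> *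
      (\<Sum>E\<in>F. c E * (pcoeff (mpowersum1 E) (lead \<Lambda>) / q_factor1 E)))"
    by (simp only: sums shape_permute_mpart[OF \<sigma> \<Lambda>])
  with K show ?thesis by (simp add: spec1_regular spec1_at_t1)
qed

end
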